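(* Let $A,B$ be matrices as in the context. Under the homeomorphism $\Phi:\widehat E_{\mathrm{tight}}\to X_A$, $\Phi(\phi_\xi)=\widehat{\omega_\xi}$, the usual action of the inverse semigroup $\mathcal S^{A,B}$ on $\widehat E_{\mathrm{tight}}$ (given by $\Theta_s(\phi)(x)=\phi(s^*xs)$ for $\phi(s^*s)=1$) becomes the action $\alpha$ of $\mathcal S^{A,B}$ on $X_A$ given by multiplication of elements of $X_A$ on the left by elements of $\mathcal S^{A,B}$; that is, for each $s\in\mathcal S^{A,B}$, $\Phi$ maps $\{\phi:\phi(s^*s)=1\}$ onto $X_{s^*s}$, and $\Phi(\Theta_s(\phi))=s\cdot\Phi(\phi)$ for all such $\phi$.
   Context: Data. Let $N\in\{1,2,\dots\}\cup\{\infty\}$ and $V=\{1,\dots,N\}$ (all positive integers if $N=\infty$). $A$ is an $N\times N$ matrix with entries in $\{0,1,2,\dots\}$, $B$ an $N\times N$ matrix with entries in $\mathbb Z$, both row-finite. Put $\Omega_A=\{(i,j)\in V\times V: A_{i,j}\ge1\}$, $\Omega_A(i)=\{j:(i,j)\in\Omega_A\}$. Standing assumption: $\Omega_A(i)\neq\emptyset$ for all $i$, and $B_{i,j}=0$ whenever $(i,j)\notin\Omega_A$. Katsura algebra. $\mathcal O_{A,B}$ is the universal $C^*$-algebra generated by mutually orthogonal projections $q_i$ ($i\in V$), partial unitaries $u_i$ with $u_iu_i^*=u_i^*u_i=q_i$, and partial isometries $s_{i,j,n}$ ($(i,j)\in\Omega_A$, $n\in\mathbb Z$) subject to: (i) $s_{i,j,n}u_j=s_{i,j,n+A_{i,j}}$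 and $u_is_{i,j,n}=s_{i,j,n+B_{i,j}}$; (ii) $s_{i,j,n}^*s_{i,j,n}=q_j$; (iii) $q_i=\sum_{j\in\Omega_A(i)}\sum_{n=1}^{A_{i,j}}s_{i,j,n}s_{i,j,n}^*$. $\mathcal S^{A,B}\subset\mathcal O_{A,B}$ is the multiplicative semigroup generated by all $u_i,u_i^*,s_{i,j,n},s_{i,j,n}^*$; it is an inverse semigroup with zero whose nonzero elements have the form $s_Iu_i^ts_J^*$ with $t\in\mathbb Z$ and $I,J$ finite paths ending at $i$ in the graph with vertices $V$ and edges $s_{i,j,n}$, $1\le n\le A_{i,j}$, from $i$ to $j$ ($s_I$ is the product of the edges; $s_I=q_i$ for the length-zero path at $i$). Semigroupoid and semilattice. $\Lambda=\Lambda_{A,B}$ is the semigroupoid generated by symbols $h_i$ ($i\in V$) and $g_{i,j,n}$ ($(i,j)\in\Omega_A$, $n\in\mathbb Z$): its elements are nonempty words in which consecutive letters form one of the admissible pairs $(h_i,h_i)$, $(h_i,g_{i,j,n})$, $(g_{i,j,n},h_j)$, $(g_{i,j,n},g_{j,k,m})$, modulo the congruence generated by $g_{i,j,n}h_j=g_{i,j,n+A_{i,j}}$ and $h_ig_{i,j,n}=g_{i,j,n+B_{i,j}}$. $\Lambda^f=\{g:fg\text{ defined}\}$; $f$ divides $m$ if $f=m$ or $fh=m$ for some $h$; elements with a common multiple have a unique lcm. $E$ is the semilattice of idempotents of the inverse semigroup $\mathcal S(\Lambda)$ attached to $\Lambda$; it consists of $0$ and distinct elements $p_f$ ($f\in\Lambda$),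 $q_{h_i}$ ($i\in V$), with $p_fp_g=p_{\mathrm{lcm}(f,g)}$ if $f,g$ have a common multiple and $0$ otherwise; $p_fq_{h_i}=p_f$ if $f\in\Lambda^{h_i}$, $0$ otherwise; $q_{h_i}q_{h_j}=0$ for $i\neq j$. The assignment $h_i\mapsto u_i$, $g_{i,j,n}\mapsto s_{i,j,n}$ extends multiplicatively to $\tau:\Lambda\to\mathcal S^{A,B}$ and induces a surjection $E\to E(\mathcal S^{A,B})$, $p_f\mapsto\tau_f\tau_f^*$, $q_{h_i}\mapsto q_i$. Tight characters. A filter in $E$ is a nonempty upward closed subset closed under products and not containing $0$; $\phi_\xi$ is the indicator function of $\xi$. $\widehat E_{\mathrm{tight}}$ is the closure in $\{0,1\}^E$ (minus the zero function) of the characters of ultrafilters; $\xi$ is tight if $\phi_\xi\in\widehat E_{\mathrm{tight}}$. The value of a tight character at $e\in E$ depends only on the image of $e$ in $E(\mathcal S^{A,B})$, so tight characters are regarded as functions on $E(\mathcal S^{A,B})$; this gives meaning to $\phi(s^*s)$ and $\phi(s^*xs)$ for $s\in\mathcal S^{A,B}$, $x\in E(\mathcal S^{A,B})$. The stem of $\xi$ is $\omega_\xi=\{f\in\Lambda:p_f\in\xi\}$; for tight $\xi$, $\widehat{\omega_\xi}$ is the unique infinite sequence $g_{i_1,i_2,n_1}g_{i_2,i_3,n_2}\cdots$ with $1\le n_k\le A_{i_k,i_{k+1}}$ all of whose finite initial products belong to $\omega_\xi$. Infinite paths and left multiplication. $X_A$ is the space of infinite paths $s_{i_1,i_2,n_1}s_{i_2,i_3,n_2}\cdots$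 with $1\le n_k\le A_{i_k,i_{k+1}}$ (identified with the corresponding sequences of $g$'s), with the topology generated by cylinder sets. For $t\in\mathbb Z$, $u_{i_1}^t\cdot(s_{i_1,i_2,n_1}s_{i_2,i_3,n_2}\cdots)=s_{i_1,i_2,m_1}s_{i_2,i_3,m_2}\cdots$, where $k_0=t$ and recursively $n_r+k_{r-1}B_{i_r,i_{r+1}}=m_r+k_rA_{i_r,i_{r+1}}$ with $1\le m_r\le A_{i_r,i_{r+1}}$, $k_r\in\mathbb Z$. For $s=s_Iu_i^ts_J^*$, $X_{s^*s}$ is the set of $\gamma\in X_A$ of the form $\gamma=s_J\gamma'$ (i.e. $s^*s\cdot\gamma=\gamma$), and $s\cdot\gamma=s_I(u_i^t\cdot\gamma')$; $\alpha_s:X_{s^*s}\to X_{ss^*}$ is $\alpha_s(\gamma)=s\cdot\gamma$. *)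

theory Defs
  imports
    "HOL-Analysis.Analysis"
    "HOL-Library.Poly_Mapping"
    "HOL-Library.Stream"
begin

section \<open>Free monoid on formal generators and their adjoints\<close>

datatype gen = GenQ nat | GenU nat | GenS nat nat int

text \<open>A word is a list of generators, each tagged with a flag that is True for the formal adjoint.
  The type is wrapped so that it can be made a monoid, as the multiplication of
  \<^typ>\<open>'a \<Rightarrow>\<^sub>0 'b\<close> requires.\<close>

datatype fword = FW (letters: "(gen \<times> bool) list")

instantiation fword :: monoid_add
begin
definition zero_fword :: fword where "zero_fword = FW []"
definition plus_fword :: "fword \<Rightarrow> fword \<Rightarrow> fword" where
  "plus_fword v w = FW (letters v @ letters w)"
instance
  by standard (auto simp: zero_fword_def plus_fword_def)
end

definition word_star :: "fword \<Rightarrow> fword" where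
  "word_star w = FW (rev (map (\<lambda>(a, b). (a, \<not> b)) (letters w)))"

lemma word_star_word_star [simp]: "word_star (word_star w) = w"
  by (cases w) (auto simp: word_star_def rev_map comp_def case_prod_unfold)

type_synonym falg = "fword \<Rightarrow>\<^sub>0 complex"

lift_definition star :: "falg \<Rightarrow> falg" is "\<lambda>f w. cnj (f (word_star w))"
proof -
  fix f :: "fword \<Rightarrow> complex"
  assume "finite {w. f w \<noteq> 0}"
  moreover have "{w. cnj (f (word_star w)) \<noteq> 0} \<subseteq> word_star ` {w. f w \<noteq> 0}"
    by (auto intro!: image_eqI[where x = "word_star _"])
  ultimately show "finite {w. cnj (f (word_star w)) \<noteq> 0}"
    by (meson finite_imageI finite_subset)
qed

definition scale :: "complex \<Rightarrow> falg \<Rightarrow> falg" where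
  "scale c x = Poly_Mapping.map ((*) c) x"

definition genq :: "nat \<Rightarrow> falg" where
  "genq i = Poly_Mapping.single (FW [(GenQ i, False)]) 1"
definition genu :: "nat \<Rightarrow> falg" where
  "genu i = Poly_Mapping.single (FW [(GenU i, False)]) 1"
definition gens :: "nat \<Rightarrow> nat \<Rightarrow> int \<Rightarrow> falg" where
  "gens i j n = Poly_Mapping.single (FW [(GenS i j n, False)]) 1"


section \<open>Letters of the semigroupoid, edges of the graph, elements of the semilattice\<close>

datatype letter = LH nat | LG nat nat int

fun adm_pair :: "letter \<Rightarrow> letter \<Rightarrow> bool" where
  "adm_pair (LH i) (LH j) \<longleftrightarrow> i = j"
| "adm_pair (LH i) (LG j k n) \<longleftrightarrow> i = j"
| "adm_pair (LG i j n) (LH k) \<longleftrightarrow> j = k"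
| "adm_pair (LG i j n) (LG k l m) \<longleftrightarrow> j = k"

text \<open>The triple (i, j, n) stands for the edge s_{i,j,n} from i to j.\<close>

type_synonym edge = "nat \<times> nat \<times> int"

fun esrc :: "edge \<Rightarrow> nat" where "esrc (i, j, n) = i"
fun etgt :: "edge \<Rightarrow> nat" where "etgt (i, j, n) = j"

datatype semilat = ZeroE | PE "letter list set" | QE nat


section \<open>The constructions attached to A and B\<close>

text \<open>\<open>N\<close> may be infinite; only the entries of \<open>A\<close>, \<open>B\<close> with both indices in \<open>V\<close> are ever used.\<close>

locale katsura =
  fixes N :: enat and A :: "nat \<Rightarrow> nat \<Rightarrow> nat" and B :: "nat \<Rightarrow> nat \<Rightarrow> int"
begin

definition V :: "nat set" where
  "V = {i. 1 \<le> i \<and> enat i \<le> N}"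

definition Omega :: "(nat \<times> nat) set" where
  "Omega = {(i, j). i \<in> V \<and> j \<in> V \<and> A i j \<ge> 1}"

definition Omega_at :: "nat \<Rightarrow> nat set" where
  "Omega_at i = {j. (i, j) \<in> Omega}"


subsection \<open>The Katsura algebra\<close>

definition generators :: "gen set" where
  "generators = GenQ ` V \<union> GenU ` V \<union> {GenS i j n | i j n. (i, j) \<in> Omega}"

text \<open>The free (non-unital) *-algebra on the generators: non-commutative *-polynomials without
  constant term.\<close>

definition free_alg :: "falg set" where
  "free_alg = {x. \<forall>w \<in> Poly_Mapping.keys x. letters w \<noteq> [] \<and> fst ` set (letters w) \<subseteq> generators}"

inductive_set relators :: "falg set" where
  q_selfadj: "i \<in> V \<Longrightarrow> star (genq i) - genq i \<in> relators"
| q_idem: "i \<in> V \<Longrightarrow> genq i * genq i - genq i \<in> relators"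
| q_orth: "i \<in> V \<Longrightarrow> j \<in> V \<Longrightarrow> i \<noteq> j \<Longrightarrow> genq i * genq j \<in> relators"
| u_range: "i \<in> V \<Longrightarrow> genu i * star (genu i) - genq i \<in> relators"
| u_source: "i \<in> V \<Longrightarrow> star (genu i) * genu i - genq i \<in> relators"
| s_pisom: "(i, j) \<in> Omega \<Longrightarrow> gens i j n * star (gens i j n) * gens i j n - gens i j n \<in> relators"
| s_u: "(i, j) \<in> Omega \<Longrightarrow> gens i j n * genu j - gens i j (n + int (A i j)) \<in> relators"
| u_s: "(i, j) \<in> Omega \<Longrightarrow> genu i * gens i j n - gens i j (n + B i j) \<in> relators"
| s_source: "(i, j) \<in> Omega \<Longrightarrow> star (gens i j n) * gens i j n - genq j \<in> relators"
| q_sum: "i \<in> V \<Longrightarrow>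
    genq i - (\<Sum>j\<in>Omega_at i. \<Sum>n = 1..int (A i j). gens i j n * star (gens i j n)) \<in> relators"

definition cstar_seminorm :: "(falg \<Rightarrow> real) \<Rightarrow> bool" where
  "cstar_seminorm p \<longleftrightarrow>
     (\<forall>x\<in>free_alg. \<forall>y\<in>free_alg.
        0 \<le> p x \<and> p (x + y) \<le> p x + p y \<and> p (x * y) \<le> p x * p y) \<and>
     (\<forall>x\<in>free_alg. \<forall>c. p (scale c x) = cmod c * p x) \<and>
     (\<forall>x\<in>free_alg. p (star x * x) = (p x)\<^sup>2)"

text \<open>The universal C*-algebra is the Hausdorff completion of the free *-algebra in the largest
  C*-seminorm that annihilates the relators, i.e. the supremum of all of them. The supremum is
  finite: the relations force p to be at most 1 on each generator, hence at most the sum of the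
  absolute values of the coefficients on each *-polynomial.\<close>

definition univ_norm :: "falg \<Rightarrow> real" where
  "univ_norm x = (SUP p \<in> {p. cstar_seminorm p \<and> (\<forall>r\<in>relators. p r = 0)}. p x)"

definition cauchy_seq :: "(nat \<Rightarrow> falg) \<Rightarrow> bool" where
  "cauchy_seq x \<longleftrightarrow> (\<forall>n. x n \<in> free_alg) \<and>
     (\<forall>e>0. \<exists>M. \<forall>m\<ge>M. \<forall>n\<ge>M. univ_norm (x m - x n) < e)"

definition null_rel :: "((nat \<Rightarrow> falg) \<times> (nat \<Rightarrow> falg)) set" where
  "null_rel = {(x, y). cauchy_seq x \<and> cauchy_seq y \<and> (\<lambda>n. univ_norm (x n - y n)) \<longlonglongrightarrow> 0}"

definition O_AB :: "(nat \<Rightarrow> falg) set set" where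
  "O_AB = {x. cauchy_seq x} // null_rel"

definition emb :: "falg \<Rightarrow> (nat \<Rightarrow> falg) set" where
  "emb a = null_rel `` {\<lambda>_. a}"

text \<open>Of the operations on the completion only product, adjoint and zero enter the statement; the
  linear structure and the norm are already accounted for in \<^term>\<open>univ_norm\<close>.\<close>

definition mulO :: "(nat \<Rightarrow> falg) set \<Rightarrow> (nat \<Rightarrow> falg) set \<Rightarrow> (nat \<Rightarrow> falg) set"
    (infixl \<open>\<cdot>\<close> 70) where
  "X \<cdot> Y = (\<Union>x\<in>X. \<Union>y\<in>Y. null_rel `` {\<lambda>n. x n * y n})"

definition adjO :: "(nat \<Rightarrow> falg) set \<Rightarrow> (nat \<Rightarrow> falg) set" where
  "adjO X = (\<Union>x\<in>X. null_rel `` {\<lambda>n. star (x n)})"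

definition zeroO :: "(nat \<Rightarrow> falg) set" where "zeroO = emb 0"

definition qO :: "nat \<Rightarrow> (nat \<Rightarrow> falg) set" where "qO i = emb (genq i)"
definition uO :: "nat \<Rightarrow> (nat \<Rightarrow> falg) set" where "uO i = emb (genu i)"
definition sO :: "nat \<Rightarrow> nat \<Rightarrow> int \<Rightarrow> (nat \<Rightarrow> falg) set" where "sO i j n = emb (gens i j n)"

text \<open>Zero is included explicitly: it is a product of generators except in the degenerate case
  N = 1, A = (1), and the semigroup is understood to be an inverse semigroup with zero.\<close>

inductive_set S_AB :: "(nat \<Rightarrow> falg) set set" where
  "zeroO \<in> S_AB"
| "i \<in> V \<Longrightarrow> uO i \<in> S_AB"
| "i \<in> V \<Longrightarrow> adjO (uO i) \<in> S_AB"
| "(i, j) \<in> Omega \<Longrightarrow> sO i j n \<in> S_AB"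
| "(i, j) \<in> Omega \<Longrightarrow> adjO (sO i j n) \<in> S_AB"
| "x \<in> S_AB \<Longrightarrow> y \<in> S_AB \<Longrightarrow> x \<cdot> y \<in> S_AB"

text \<open>Product of a nonempty list; the value on the empty list is irrelevant.\<close>

fun prodO :: "(nat \<Rightarrow> falg) set list \<Rightarrow> (nat \<Rightarrow> falg) set" where
  "prodO [] = zeroO"
| "prodO [x] = x"
| "prodO (x # y # xs) = x \<cdot> prodO (y # xs)"

definition upowO :: "nat \<Rightarrow> int \<Rightarrow> (nat \<Rightarrow> falg) set" where
  "upowO i t = (if t = 0 then qO i
     else if t > 0 then prodO (replicate (nat t) (uO i))
     else prodO (replicate (nat (- t)) (adjO (uO i))))"


subsection \<open>Finite and infinite paths\<close>

definition edges :: "edge set" where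
  "edges = {(i, j, n). (i, j) \<in> Omega \<and> 1 \<le> n \<and> n \<le> int (A i j)}"

text \<open>\<open>path_to I i\<close>: the edge list \<open>I\<close> is a finite path ending at \<open>i\<close>; the empty list is the path
  of length zero at \<open>i\<close>, for every vertex \<open>i\<close>.\<close>

definition path_to :: "edge list \<Rightarrow> nat \<Rightarrow> bool" where
  "path_to I i \<longleftrightarrow> i \<in> V \<and> set I \<subseteq> edges \<and> successively (\<lambda>d e. etgt d = esrc e) I \<and>
     (I \<noteq> [] \<longrightarrow> etgt (last I) = i)"

definition sprodO :: "edge list \<Rightarrow> nat \<Rightarrow> (nat \<Rightarrow> falg) set" where
  "sprodO I i = (if I = [] then qO i else prodO (map (\<lambda>(i, j, n). sO i j n) I))"

definition X_A :: "edge stream set" where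
  "X_A = {\<gamma>. \<forall>k. \<gamma> !! k \<in> edges \<and> etgt (\<gamma> !! k) = esrc (\<gamma> !! Suc k)}"

text \<open>The infinite paths obtained by prolonging the finite path \<open>I\<close> ending at \<open>i\<close>.\<close>

definition cylinder :: "edge list \<Rightarrow> nat \<Rightarrow> edge stream set" where
  "cylinder I i = {I @- \<gamma> | \<gamma>. \<gamma> \<in> X_A \<and> esrc (shd \<gamma>) = i}"

definition X_top :: "edge stream topology" where
  "X_top = topology_generated_by {cylinder I i | I i. path_to I i}"

text \<open>One step of the left multiplication by a power of u: the pair (m, k).\<close>

definition carry :: "int \<Rightarrow> edge \<Rightarrow> int \<times> int" where
  "carry t e = (case e of (i, j, n) \<Rightarrow>
     (THE (m, k). n + t * B i j = m + k * int (A i j) \<and> 1 \<le> m \<and> m \<le> int (A i j)))"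

primcorec u_act :: "int \<Rightarrow> edge stream \<Rightarrow> edge stream" where
  "u_act t \<gamma> = (case shd \<gamma> of (i, j, n) \<Rightarrow> (i, j, fst (carry t (i, j, n))))
     ## u_act (snd (carry t (shd \<gamma>))) (stl \<gamma>)"

text \<open>\<open>std_form s I i t J\<close>: \<open>s\<close> is represented as s_I u_i^t s_J^*. A given \<open>s\<close> may have several
  such representations.\<close>

definition std_form :: "(nat \<Rightarrow> falg) set \<Rightarrow> edge list \<Rightarrow> nat \<Rightarrow> int \<Rightarrow> edge list \<Rightarrow> bool" where
  "std_form s I i t J \<longleftrightarrow> path_to I i \<and> path_to J i \<and>
     s = sprodO I i \<cdot> upowO i t \<cdot> adjO (sprodO J i)"

text \<open>The set X_{s^*s}, as a function of \<open>s\<close>; it is empty for \<open>s = 0\<close>.\<close>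

definition X_dom :: "(nat \<Rightarrow> falg) set \<Rightarrow> edge stream set" where
  "X_dom s = {\<gamma>. \<exists>I i t J. std_form s I i t J \<and> \<gamma> \<in> cylinder J i}"

definition alpha :: "(nat \<Rightarrow> falg) set \<Rightarrow> edge stream \<Rightarrow> edge stream" where
  "alpha s \<gamma> = (THE \<delta>. \<exists>I i t J \<gamma>'. std_form s I i t J \<and> \<gamma>' \<in> X_A \<and> esrc (shd \<gamma>') = i \<and>
     \<gamma> = J @- \<gamma>' \<and> \<delta> = I @- u_act t \<gamma>')"


subsection \<open>The semigroupoid\<close>

text \<open>\<open>LH i\<close> and \<open>LG i j n\<close> are the symbols h_i and g_{i,j,n}; elements of the semigroupoid are
  classes of admissible words.\<close>

definition alphabet :: "letter set" where
  "alphabet = LH ` V \<union> {LG i j n | i j n. (i, j) \<in> Omega}"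

definition wds :: "letter list set" where
  "wds = {w. w \<noteq> [] \<and> set w \<subseteq> alphabet \<and> successively adm_pair w}"

inductive rewr :: "letter list \<Rightarrow> letter list \<Rightarrow> bool" where
  "v @ [LG i j n, LH j] @ w \<in> wds \<Longrightarrow>
     rewr (v @ [LG i j n, LH j] @ w) (v @ [LG i j (n + int (A i j))] @ w)"
| "v @ [LH i, LG i j n] @ w \<in> wds \<Longrightarrow>
     rewr (v @ [LH i, LG i j n] @ w) (v @ [LG i j (n + B i j)] @ w)"

definition wcong :: "(letter list \<times> letter list) set" where
  "wcong = {(v, w). v \<in> wds \<and> w \<in> wds \<and> equivclp rewr v w}"

definition Lambda :: "letter list set set" where
  "Lambda = wds // wcong"

definition cls :: "letter list \<Rightarrow> letter list set" where
  "cls w = wcong `` {w}"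

definition composable :: "letter list set \<Rightarrow> letter list set \<Rightarrow> bool" where
  "composable f g \<longleftrightarrow> (\<exists>v\<in>f. \<exists>w\<in>g. v @ w \<in> wds)"

definition compL :: "letter list set \<Rightarrow> letter list set \<Rightarrow> letter list set" where
  "compL f g = (\<Union>v\<in>f. \<Union>w\<in>g. cls (v @ w))"

definition Lambda_sup :: "letter list set \<Rightarrow> letter list set set" where
  "Lambda_sup f = {g \<in> Lambda. composable f g}"

definition divides :: "letter list set \<Rightarrow> letter list set \<Rightarrow> bool" where
  "divides f m \<longleftrightarrow> f = m \<or> (\<exists>h \<in> Lambda_sup f. compL f h = m)"

definition common_mult :: "letter list set \<Rightarrow> letter list set \<Rightarrow> letter list set \<Rightarrow> bool" where
  "common_mult f g m \<longleftrightarrow> m \<in> Lambda \<and> divides f m \<and> divides g m"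

definition lcmL :: "letter list set \<Rightarrow> letter list set \<Rightarrow> letter list set" where
  "lcmL f g = (THE m. common_mult f g m \<and> (\<forall>m'. common_mult f g m' \<longrightarrow> divides m m'))"

definition tau :: "letter list set \<Rightarrow> (nat \<Rightarrow> falg) set" where
  "tau f = (THE x. \<exists>w\<in>f. x = prodO (map (\<lambda>l. case l of LH i \<Rightarrow> uO i | LG i j n \<Rightarrow> sO i j n) w))"


subsection \<open>The semilattice and its tight characters\<close>

text \<open>The semilattice is given by its presentation: \<open>PE f\<close> is p_f and \<open>QE i\<close> is q_{h_i}.\<close>

definition E :: "semilat set" where
  "E = insert ZeroE (PE ` Lambda \<union> QE ` V)"

fun meet :: "semilat \<Rightarrow> semilat \<Rightarrow> semilat" where
  "meet (PE f) (PE g) = (if \<exists>m. common_mult f g m then PE (lcmL f g) else ZeroE)"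
| "meet (PE f) (QE i) = (if f \<in> Lambda_sup (cls [LH i]) then PE f else ZeroE)"
| "meet (QE i) (PE f) = (if f \<in> Lambda_sup (cls [LH i]) then PE f else ZeroE)"
| "meet (QE i) (QE j) = (if i = j then QE i else ZeroE)"
| "meet ZeroE _ = ZeroE"
| "meet _ ZeroE = ZeroE"

definition below :: "semilat \<Rightarrow> semilat \<Rightarrow> bool" where
  "below e e' \<longleftrightarrow> meet e e' = e"

text \<open>The surjection from \<open>E\<close> onto the idempotents of \<^term>\<open>S_AB\<close>.\<close>

fun img :: "semilat \<Rightarrow> (nat \<Rightarrow> falg) set" where
  "img ZeroE = zeroO"
| "img (PE f) = tau f \<cdot> adjO (tau f)"
| "img (QE i) = qO i"

definition is_filter :: "semilat set \<Rightarrow> bool" where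
  "is_filter \<xi> \<longleftrightarrow> \<xi> \<subseteq> E \<and> \<xi> \<noteq> {} \<and> ZeroE \<notin> \<xi> \<and>
     (\<forall>e\<in>\<xi>. \<forall>e'\<in>E. below e e' \<longrightarrow> e' \<in> \<xi>) \<and> (\<forall>e\<in>\<xi>. \<forall>e'\<in>\<xi>. meet e e' \<in> \<xi>)"

definition is_ultrafilter :: "semilat set \<Rightarrow> bool" where
  "is_ultrafilter \<xi> \<longleftrightarrow> is_filter \<xi> \<and> (\<forall>\<eta>. is_filter \<eta> \<and> \<xi> \<subseteq> \<eta> \<longrightarrow> \<eta> = \<xi>)"

text \<open>Functions on \<open>E\<close> with values in \<open>{0, 1}\<close> are extensional functions, i.e. \<^term>\<open>undefined\<close>
  off \<open>E\<close>, as in \<^const>\<open>product_topology\<close>.\<close>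

definition char_of :: "semilat set \<Rightarrow> semilat \<Rightarrow> nat" where
  "char_of \<xi> = restrict (indicator \<xi>) E"

definition cube_top :: "(semilat \<Rightarrow> nat) topology" where
  "cube_top = product_topology (\<lambda>_. discrete_topology {0, 1}) E"

definition E_tight :: "(semilat \<Rightarrow> nat) set" where
  "E_tight = (cube_top closure_of (char_of ` {\<xi>. is_ultrafilter \<xi>})) - {restrict (\<lambda>_. 0) E}"

definition tight_top :: "(semilat \<Rightarrow> nat) topology" where
  "tight_top = subtopology cube_top E_tight"

definition filter_of :: "(semilat \<Rightarrow> nat) \<Rightarrow> semilat set" where
  "filter_of \<phi> = {e \<in> E. \<phi> e = 1}"

definition stem :: "semilat set \<Rightarrow> letter list set set" where
  "stem \<xi> = {f \<in> Lambda. PE f \<in> \<xi>}"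

definition stem_limit :: "letter list set set \<Rightarrow> edge stream" where
  "stem_limit \<omega> = (THE \<gamma>. \<gamma> \<in> X_A \<and>
     (\<forall>k\<ge>1. cls (map (\<lambda>(i, j, n). LG i j n) (stake k \<gamma>)) \<in> \<omega>))"

definition Phi :: "(semilat \<Rightarrow> nat) \<Rightarrow> edge stream" where
  "Phi \<phi> = stem_limit (stem (filter_of \<phi>))"

text \<open>A tight character as a function on the idempotents of \<^term>\<open>S_AB\<close>.\<close>

definition ev :: "(semilat \<Rightarrow> nat) \<Rightarrow> (nat \<Rightarrow> falg) set \<Rightarrow> nat" where
  "ev \<phi> x = (THE b. \<exists>e\<in>E. img e = x \<and> \<phi> e = b)"

definition Theta_dom :: "(nat \<Rightarrow> falg) set \<Rightarrow> (semilat \<Rightarrow> nat) set" where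
  "Theta_dom s = {\<phi> \<in> E_tight. ev \<phi> (adjO s \<cdot> s) = 1}"

text \<open>The function \<open>x \<mapsto> \<phi> (s\<^sup>* x s)\<close>, pulled back to \<open>E\<close> along \<^term>\<open>img\<close>.\<close>

definition Theta :: "(nat \<Rightarrow> falg) set \<Rightarrow> (semilat \<Rightarrow> nat) \<Rightarrow> (semilat \<Rightarrow> nat)" where
  "Theta s \<phi> = restrict (\<lambda>e. ev \<phi> (adjO s \<cdot> img e \<cdot> s)) E"

end

end

theory Submission
  imports Defs
begin

text \<open>The words in the generators act on \<open>X_A\<close> by partial bijections, and the operator norm of the
  resulting representation on finitely supported functions is one of the C*-seminorms that define
  the algebra. So equality of two elements of the semigroup forces equality of their actions, and an
  idempotent acts as the restriction of the identity to a cylinder. Conversely the relations bring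
  every nonzero element of the semigroup into the form $s_I u_i^t s_J^*$; here the orthogonality of
  the range projections of distinct edges must be extracted from the fact that they sum up to a
  projection.

  An element of the semigroupoid is determined by a finite path and a power of u carried to its end,
  and divisibility compares first the paths and then the powers. Sending \<open>p_f\<close> to the cylinder of the
  path of \<open>f\<close> turns products in \<open>E\<close> into intersections. Hence the ultrafilters are
  the sets of all elements whose cylinder contains a given infinite path, and by row finiteness the
  set of their characters is already closed up to the zero function. On these characters $\Theta_s$
  becomes the partial bijection of \<open>X_A\<close> induced by \<open>s\<close>.\<close>

section \<open>The free *-algebra\<close>

text \<open>\<open>alpha\<close> and \<open>ev\<close> are definite descriptions over all standard
  forms, or all preimages, of an element, while equality of elements is equality in a completion.
  The division of labour is that the representation on paths supplies uniqueness and the relations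
  supply existence. For uniqueness one C*-seminorm that kills the relators is enough, since it is
  dominated by \<open>univ_norm\<close>.

  The norm is accessible only as a supremum of C*-seminorms on *-polynomials, so arguments about
  positive elements have to be phrased with norms. That projections whose sum is a projection are
  orthogonal becomes the extremality of the unit in the unit ball, which involves nothing but norms
  and the C*-identity. Orthogonality is what allows the adjoint of an edge to be multiplied into a
  standard form: it decides s_e^* s_f for distinct edges.

  Since u_i permutes the infinite paths starting at i, the power of u disappears from all cylinders.
  Hence many elements of \<open>E\<close> share a cylinder, and tight characters cannot tell them
  apart.\<close>

lemma falg_sum: "x = (\<Sum>w\<in>Poly_Mapping.keys x. Poly_Mapping.single w (Poly_Mapping.lookup x w))"
  by (rule poly_mapping_eqI)
    (auto simp: lookup_sum lookup_single when_def sum.delta' in_keys_iff)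

text \<open>The empty sum is covered by \<open>single\<close>: the zero polynomial is a monomial
  with coefficient 0.\<close>

lemma falg_induct [case_names single add]:
  fixes x :: "'a \<Rightarrow>\<^sub>0 'b::comm_monoid_add"
  assumes single: "\<And>w c. P (Poly_Mapping.single w c)" and add: "\<And>x y. P x \<Longrightarrow> P y \<Longrightarrow> P (x + y)"
  shows "P x"
proof -
  have "P (\<Sum>w\<in>K. Poly_Mapping.single w (Poly_Mapping.lookup x w))" if "finite K" for K
    using that by (induction K) (auto intro: add single simp: single[of undefined 0, simplified])
  then show ?thesis
    by (subst falg_sum) auto
qed

lemma letters_plus [simp]: "letters (v + w) = letters v @ letters w"
  by (simp add: plus_fword_def)

lemma word_star_plus: "word_star (v + w) = word_star w + word_star v"
  by (simp add: word_star_def plus_fword_def)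

lemma star_single [simp]: "star (Poly_Mapping.single w c) = Poly_Mapping.single (word_star w) (cnj c)"
  by (rule poly_mapping_eqI) (auto simp: star.rep_eq lookup_single when_def)

lemma star_zero [simp]: "star 0 = 0"
  by (rule poly_mapping_eqI) (simp add: star.rep_eq)

lemma star_add: "star (x + y) = star x + star y"
  by (rule poly_mapping_eqI) (simp add: star.rep_eq lookup_add)

lemma star_diff: "star (x - y) = star x - star y"
  by (rule poly_mapping_eqI) (simp add: star.rep_eq lookup_minus)

lemma star_star [simp]: "star (star x) = x"
  by (rule poly_mapping_eqI) (simp add: star.rep_eq)

lemma star_mult: "star (x * y) = star y * star x"
proof (induction x rule: falg_induct)
  case (single v c)
  show ?case
    by (induction y rule: falg_induct)
      (auto simp: mult_single word_star_plus star_add algebra_simps)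
qed (auto simp: star_add algebra_simps)

text \<open>\<open>Poly_Mapping.single 0 c\<close> is a constant term, as 0 is the empty word. For
  nonzero c it lies outside \<open>free_alg\<close>, but in the ambient ring it turns the laws for
  scalars into associativity and centrality.\<close>

lemma scale_conv_mult: "scale c x = Poly_Mapping.single 0 c * x"
  by (simp add: scale_def mult_map_scale_conv_mult)

lemma single_zero_commute: "Poly_Mapping.single 0 c * x = x * Poly_Mapping.single 0 (c::complex)"
  for x :: falg
  by (induction x rule: falg_induct) (auto simp: mult_single algebra_simps)

lemma lookup_scale [simp]: "Poly_Mapping.lookup (scale c x) w = c * Poly_Mapping.lookup x w"
  by (simp add: scale_def map.rep_eq when_def)

lemma scale_add: "scale c (x + y) = scale c x + scale c y"
  and scale_diff: "scale c (x - y) = scale c x - scale c y"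
  and scale_scale [simp]: "scale c (scale d x) = scale (c * d) x"
  and scale_one [simp]: "scale 1 x = x"
  and scale_zero [simp]: "scale 0 x = 0"
  and scale_zero_right [simp]: "scale c 0 = 0"
  and scale_minus_one: "scale (-1) x = - x"
  and scale_add_left: "scale (c + d) x = scale c x + scale d x"
  by (auto intro!: poly_mapping_eqI simp: lookup_add lookup_minus algebra_simps)

lemma scale_mult_left: "scale c x * y = scale c (x * y)"
  by (simp add: scale_conv_mult mult.assoc)

lemma scale_mult_right: "x * scale c y = scale c (x * y)"
  by (metis scale_conv_mult mult.assoc single_zero_commute)

lemma star_scale: "star (scale c x) = scale (cnj c) (star x)"
  by (rule poly_mapping_eqI) (simp add: star.rep_eq)

context katsura
begin

definition good_word :: "fword \<Rightarrow> bool" where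
  "good_word w \<longleftrightarrow> letters w \<noteq> [] \<and> fst ` set (letters w) \<subseteq> generators"

lemma free_alg_iff: "x \<in> free_alg \<longleftrightarrow> Poly_Mapping.keys x \<subseteq> {w. good_word w}"
  by (auto simp: free_alg_def good_word_def)

lemma good_word_plus: "good_word v \<Longrightarrow> good_word w \<Longrightarrow> good_word (v + w)"
  by (auto simp: good_word_def)

lemma good_word_star: "good_word (word_star w) \<longleftrightarrow> good_word w"
  by (auto simp: good_word_def word_star_def image_image case_prod_unfold)

lemma free_alg_zero [simp, intro]: "0 \<in> free_alg"
  by (simp add: free_alg_iff)

lemma free_alg_add [simp, intro]: "x \<in> free_alg \<Longrightarrow> y \<in> free_alg \<Longrightarrow> x + y \<in> free_alg"
  using keys_add[of x y] by (auto simp: free_alg_iff)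

lemma free_alg_mult [simp, intro]: "x \<in> free_alg \<Longrightarrow> y \<in> free_alg \<Longrightarrow> x * y \<in> free_alg"
  using keys_mult[of x y] by (fastforce simp: free_alg_iff intro: good_word_plus)

lemma free_alg_scale [simp, intro]: "x \<in> free_alg \<Longrightarrow> scale c x \<in> free_alg"
  by (auto simp: free_alg_iff in_keys_iff subset_iff)

lemma free_alg_minus [simp, intro]: "x \<in> free_alg \<Longrightarrow> - x \<in> free_alg"
  by (metis free_alg_scale scale_minus_one)

lemma free_alg_diff [simp, intro]: "x \<in> free_alg \<Longrightarrow> y \<in> free_alg \<Longrightarrow> x - y \<in> free_alg"
  by (metis free_alg_add free_alg_minus uminus_add_conv_diff add.commute)

lemma free_alg_star [simp, intro]: "x \<in> free_alg \<Longrightarrow> star x \<in> free_alg"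
  by (auto simp: free_alg_iff in_keys_iff subset_iff star.rep_eq)
    (metis good_word_star)

lemma free_alg_sum [simp, intro]: "(\<And>k. k \<in> K \<Longrightarrow> f k \<in> free_alg) \<Longrightarrow> sum f K \<in> free_alg"
  by (induction K rule: infinite_finite_induct) auto

lemma free_alg_single [simp]: "Poly_Mapping.single w c \<in> free_alg \<longleftrightarrow> c = 0 \<or> good_word w"
  by (auto simp: free_alg_iff)

lemma free_alg_gens [simp, intro]:
  "i \<in> V \<Longrightarrow> genq i \<in> free_alg" "i \<in> V \<Longrightarrow> genu i \<in> free_alg"
  "(i, j) \<in> Omega \<Longrightarrow> gens i j n \<in> free_alg"
  by (auto simp: genq_def genu_def gens_def good_word_def generators_def)

end


section \<open>C*-seminorms and the universal norm\<close>

locale katsura_seminorm = katsura +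
  fixes p :: "falg \<Rightarrow> real"
  assumes seminorm: "cstar_seminorm p"
begin

lemma nonneg: "x \<in> free_alg \<Longrightarrow> 0 \<le> p x"
  and triangle: "x \<in> free_alg \<Longrightarrow> y \<in> free_alg \<Longrightarrow> p (x + y) \<le> p x + p y"
  and submult: "x \<in> free_alg \<Longrightarrow> y \<in> free_alg \<Longrightarrow> p (x * y) \<le> p x * p y"
  and homogeneous: "x \<in> free_alg \<Longrightarrow> p (scale c x) = cmod c * p x"
  and cstar: "x \<in> free_alg \<Longrightarrow> p (star x * x) = (p x)\<^sup>2"
  using seminorm unfolding cstar_seminorm_def by blast+

lemma zero [simp]: "p 0 = 0"
  using homogeneous[of 0 0] by simp

lemma minus: "x \<in> free_alg \<Longrightarrow> p (- x) = p x"
  using homogeneous[of x "-1"] by (simp add: scale_minus_one)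

lemma diff_triangle: "x \<in> free_alg \<Longrightarrow> y \<in> free_alg \<Longrightarrow> p (x - y) \<le> p x + p y"
  using triangle[of x "- y"] minus[of y] by simp

lemma diff_commute: "x \<in> free_alg \<Longrightarrow> y \<in> free_alg \<Longrightarrow> p (x - y) = p (y - x)"
  using minus[of "x - y"] by simp

lemma sum_triangle:
  "(\<And>k. k \<in> K \<Longrightarrow> f k \<in> free_alg) \<Longrightarrow> p (sum f K) \<le> (\<Sum>k\<in>K. p (f k))"
proof (induction K rule: infinite_finite_induct)
  case (insert k K)
  then show ?case
    using triangle[of "f k" "sum f K"] by fastforce
qed auto

lemma star_le: "x \<in> free_alg \<Longrightarrow> p x \<le> p (star x)"
proof -
  assume x: "x \<in> free_alg"
  then have "p x * p x \<le> p (star x) * p x"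
    using cstar[of x] submult[of "star x" x] by (simp add: power2_eq_square)
  moreover have "0 \<le> p x" "0 \<le> p (star x)"
    using x nonneg by auto
  ultimately show ?thesis
    by (cases "p x = 0") (auto simp: mult_le_cancel_right)
qed

lemma star_eq: "x \<in> free_alg \<Longrightarrow> p (star x) = p x"
  using star_le[of x] star_le[of "star x"] by simp

lemma diff_null_eq:
  assumes "x \<in> free_alg" "y \<in> free_alg" "p (x - y) = 0"
  shows "p x = p y"
  using triangle[of "x - y" y] diff_triangle[of x "x - y"] assms by simp

end

locale katsura_rep_seminorm = katsura_seminorm +
  assumes relators: "\<And>r. r \<in> relators \<Longrightarrow> p r = 0"
begin

text \<open>Modulo the relators q^* q is q, so by the C*-identity the seminorm of q is its own
  square.\<close>

lemma proj_le_1: "i \<in> V \<Longrightarrow> p (genq i) \<le> 1"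
proof -
  assume i: "i \<in> V"
  have eq: "star (genq i) * genq i - genq i = (star (genq i) - genq i) * genq i + (genq i * genq i - genq i)"
    by (simp add: algebra_simps)
  have "p ((star (genq i) - genq i) * genq i) \<le> p (star (genq i) - genq i) * p (genq i)"
    using i by (intro submult) auto
  also have "\<dots> = 0"
    using relators[OF q_selfadj[OF i]] by simp
  finally have "p (star (genq i) * genq i - genq i) \<le> 0"
    unfolding eq using relators[OF q_idem[OF i]] triangle[of "(star (genq i) - genq i) * genq i" "genq i * genq i - genq i"] i
    by auto
  then have "p (star (genq i) * genq i) = p (genq i)"
    using i nonneg[of "star (genq i) * genq i - genq i"] by (intro diff_null_eq) auto
  then have "(p (genq i))\<^sup>2 = p (genq i)"
    using cstar[of "genq i"] i by simp
  then show ?thesis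
    by (auto simp add: power2_eq_square)
qed

lemma genu_le_1:
  assumes "i \<in> V"
  shows "p (genu i) \<le> 1"
proof -
  have "p (star (genu i) * genu i) = p (genq i)"
    using assms relators[OF u_source] by (intro diff_null_eq) auto
  then have "(p (genu i))\<^sup>2 \<le> 1\<^sup>2"
    using cstar[of "genu i"] proj_le_1 assms by simp
  then show ?thesis
    by (rule power2_le_imp_le) simp
qed

lemma gens_le_1:
  assumes "(i, j) \<in> Omega"
  shows "p (gens i j n) \<le> 1"
proof -
  have j: "j \<in> V"
    using assms by (auto simp: Omega_def)
  have "p (star (gens i j n) * gens i j n) = p (genq j)"
    using assms j relators[OF s_source] by (intro diff_null_eq) auto
  then have "(p (gens i j n))\<^sup>2 \<le> 1\<^sup>2"
    using cstar[of "gens i j n"] proj_le_1 assms j by simp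
  then show ?thesis
    by (rule power2_le_imp_le) simp
qed

lemma letter_le_1:
  assumes "g \<in> generators"
  shows "p (Poly_Mapping.single (FW [(g, b)]) 1) \<le> 1"
proof -
  have 1: "p (Poly_Mapping.single (FW [(g, False)]) 1) \<le> 1"
    using assms proj_le_1 genu_le_1 gens_le_1
    by (auto simp: generators_def genq_def genu_def gens_def)
  have "Poly_Mapping.single (FW [(g, True)]) 1 = star (Poly_Mapping.single (FW [(g, False)]) 1)"
    by (simp add: word_star_def)
  then have "p (Poly_Mapping.single (FW [(g, True)]) 1) \<le> 1"
    using star_eq[of "Poly_Mapping.single (FW [(g, False)]) 1"] 1 assms by (simp add: good_word_def)
  with 1 show ?thesis
    by (cases b) auto
qed

lemma word_le_1:
  assumes "l \<noteq> []" "fst ` set l \<subseteq> generators"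
  shows "p (Poly_Mapping.single (FW l) 1) \<le> 1"
  using assms
proof (induction l rule: list_nonempty_induct)
  case (single a)
  then show ?case
    using letter_le_1 by (cases a) auto
next
  case (cons a l)
  have g: "good_word (FW [a])" "good_word (FW l)"
    using cons by (auto simp: good_word_def)
  have "Poly_Mapping.single (FW (a # l)) 1
    = Poly_Mapping.single (FW [a]) (1::complex) * Poly_Mapping.single (FW l) 1"
    by (simp add: mult_single plus_fword_def)
  moreover have "p (Poly_Mapping.single (FW [a]) (1::complex) * Poly_Mapping.single (FW l) 1)
    \<le> p (Poly_Mapping.single (FW [a]) 1) * p (Poly_Mapping.single (FW l) 1)"
    using g by (intro submult) auto
  moreover have "\<dots> \<le> 1"
    using cons letter_le_1[of "fst a" "snd a"] g by (intro mult_le_one nonneg) auto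
  ultimately show ?case
    by simp
qed

text \<open>The bound is the same for every p, which makes the supremum in \<open>univ_norm\<close>
  finite.\<close>

lemma le_sum_coeffs:
  assumes "x \<in> free_alg"
  shows "p x \<le> (\<Sum>w\<in>Poly_Mapping.keys x. cmod (Poly_Mapping.lookup x w))"
proof -
  have good: "good_word w" if "w \<in> Poly_Mapping.keys x" for w
    using assms that by (auto simp: free_alg_iff)
  have le: "p (Poly_Mapping.single w c) \<le> cmod c" if "good_word w" for w c
  proof -
    have "p (Poly_Mapping.single w 1) \<le> 1"
      using word_le_1[of "letters w"] that by (simp add: good_word_def)
    moreover have "Poly_Mapping.single w c = scale c (Poly_Mapping.single w 1)"
      by (simp add: scale_conv_mult mult_single)
    ultimately show ?thesis
      using homogeneous[of "Poly_Mapping.single w 1" c] that by (simp add: mult_left_le)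
  qed
  have "p x \<le> (\<Sum>w\<in>Poly_Mapping.keys x. p (Poly_Mapping.single w (Poly_Mapping.lookup x w)))"
    by (subst falg_sum, rule sum_triangle) (use good in auto)
  also have "\<dots> \<le> (\<Sum>w\<in>Poly_Mapping.keys x. cmod (Poly_Mapping.lookup x w))"
    using good le by (intro sum_mono) auto
  finally show ?thesis .
qed

end

context katsura
begin

definition rep_seminorms :: "(falg \<Rightarrow> real) set" where
  "rep_seminorms = {p. cstar_seminorm p \<and> (\<forall>r\<in>relators. p r = 0)}"

lemma rep_seminorms_iff: "p \<in> rep_seminorms \<longleftrightarrow> katsura_rep_seminorm N A B p"
  by (auto simp: rep_seminorms_def katsura_rep_seminorm_def katsura_rep_seminorm_axioms_def
      katsura_seminorm_def)

text \<open>The zero seminorm makes \<open>univ_norm\<close> a supremum over a nonempty set and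
  bounds it below by 0.\<close>

lemma zero_rep_seminorm: "(\<lambda>_. 0) \<in> rep_seminorms"
  by (simp add: rep_seminorms_def cstar_seminorm_def)

lemma univ_norm_upper: "p \<in> rep_seminorms \<Longrightarrow> x \<in> free_alg \<Longrightarrow> p x \<le> univ_norm x"
  unfolding univ_norm_def rep_seminorms_def[symmetric]
  by (rule cSUP_upper) (auto intro!: bdd_aboveI2 katsura_rep_seminorm.le_sum_coeffs simp: rep_seminorms_iff)

lemma univ_norm_least: "(\<And>p. p \<in> rep_seminorms \<Longrightarrow> p x \<le> c) \<Longrightarrow> univ_norm x \<le> c"
  unfolding univ_norm_def rep_seminorms_def[symmetric]
  by (rule cSUP_least) (use zero_rep_seminorm in auto)

lemma univ_norm_nonneg: "x \<in> free_alg \<Longrightarrow> 0 \<le> univ_norm x"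
  using univ_norm_upper[OF zero_rep_seminorm] by simp

text \<open>Each axiom passes to the supremum. For the C*-identity one inequality bounds the square
  of each p x, the other takes the square root of p (x^* x) before passing to the supremum.\<close>

lemma cstar_seminorm_univ_norm: "cstar_seminorm univ_norm"
proof -
  have sn: "katsura_seminorm N A p" if "p \<in> rep_seminorms" for p
    using that by (simp add: rep_seminorms_iff katsura_rep_seminorm_def)
  have add: "univ_norm (x + y) \<le> univ_norm x + univ_norm y" if "x \<in> free_alg" "y \<in> free_alg" for x y
    using that katsura_seminorm.triangle[OF sn] univ_norm_upper
    by (intro univ_norm_least) (meson add_mono order_trans)
  have mult: "univ_norm (x * y) \<le> univ_norm x * univ_norm y" if "x \<in> free_alg" "y \<in> free_alg" for x y
    using that katsura_seminorm.submult[OF sn] univ_norm_upper katsura_seminorm.nonneg[OF sn] univ_norm_nonneg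
    by (intro univ_norm_least) (meson mult_mono order_trans)
  have scale_le: "univ_norm (scale c x) \<le> cmod c * univ_norm x" if "x \<in> free_alg" for x c
    using that katsura_seminorm.homogeneous[OF sn that] univ_norm_upper
    by (intro univ_norm_least) (metis mult_left_mono norm_ge_zero)
  have scale_eq: "univ_norm (scale c x) = cmod c * univ_norm x" if x: "x \<in> free_alg" for x c
  proof (cases "c = 0")
    case True
    then show ?thesis
      using scale_le[OF x, of 0] univ_norm_nonneg[of 0] by simp
  next
    case False
    \<comment> \<open>The reverse inequality is \<open>scale_le\<close> for the inverse
      scalar.\<close>
    then have "univ_norm x \<le> cmod (inverse c) * univ_norm (scale c x)"
      using scale_le[of "scale c x" "inverse c"] x by simp
    then have "cmod c * univ_norm x \<le> univ_norm (scale c x)"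
      using False by (simp add: norm_inverse norm_divide field_simps)
    then show ?thesis
      using scale_le[OF x, of c] by simp
  qed
  have star: "univ_norm (star x * x) = (univ_norm x)\<^sup>2" if x: "x \<in> free_alg" for x
  proof (rule antisym)
    have "p (star x * x) \<le> (univ_norm x)\<^sup>2" if p: "p \<in> rep_seminorms" for p
      unfolding katsura_seminorm.cstar[OF sn[OF p] x]
      by (rule power_mono[OF univ_norm_upper[OF p x] katsura_seminorm.nonneg[OF sn[OF p] x]])
    then show "univ_norm (star x * x) \<le> (univ_norm x)\<^sup>2"
      by (rule univ_norm_least)
    have "p x \<le> sqrt (univ_norm (star x * x))" if p: "p \<in> rep_seminorms" for p
      using univ_norm_upper[OF p, of "star x * x"] katsura_seminorm.cstar[OF sn[OF p] x] x
      by (simp add: real_le_rsqrt)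
    then have "univ_norm x \<le> sqrt (univ_norm (star x * x))"
      by (rule univ_norm_least)
    then have "(univ_norm x)\<^sup>2 \<le> (sqrt (univ_norm (star x * x)))\<^sup>2"
      using x univ_norm_nonneg by (intro power_mono) auto
    then show "(univ_norm x)\<^sup>2 \<le> univ_norm (star x * x)"
      using x univ_norm_nonneg[of "star x * x"] by simp
  qed
  show ?thesis
    unfolding cstar_seminorm_def
    by (intro conjI ballI allI add mult scale_eq star univ_norm_nonneg)
qed

lemma relators_subset: "relators \<subseteq> free_alg"
proof
  fix r
  assume "r \<in> relators"
  then show "r \<in> free_alg"
  proof cases
    case (q_sum i)
    then show ?thesis
      by (auto simp: Omega_at_def intro!: free_alg_diff free_alg_sum)
  qed (auto simp: Omega_def)
qed

lemma katsura_rep_seminorm_univ_norm: "katsura_rep_seminorm N A B univ_norm"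
proof -
  have "univ_norm r = 0" if "r \<in> relators" for r
    using that relators_subset
    by (intro antisym univ_norm_nonneg univ_norm_least) (auto simp: rep_seminorms_def)
  then show ?thesis
    unfolding rep_seminorms_iff[symmetric] rep_seminorms_def
    by (simp add: cstar_seminorm_univ_norm)
qed

end

sublocale katsura \<subseteq> un: katsura_rep_seminorm N A B "katsura.univ_norm N A B"
  by (rule katsura_rep_seminorm_univ_norm)

section \<open>Equality modulo a C*-seminorm\<close>

context katsura_seminorm
begin

text \<open>Membership of both sides is part of the relation because the seminorm axioms hold on
  \<open>free_alg\<close> only; thus chains of such equations carry their own side
  conditions.\<close>

definition eqv :: "falg \<Rightarrow> falg \<Rightarrow> bool" (infix \<open>\<doteq>\<close> 50) where
  "x \<doteq> y \<longleftrightarrow> x \<in> free_alg \<and> y \<in> free_alg \<and> p (x - y) = 0"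

lemma eqvD: "x \<doteq> y \<Longrightarrow> x \<in> free_alg" "x \<doteq> y \<Longrightarrow> y \<in> free_alg" "x \<doteq> y \<Longrightarrow> p (x - y) = 0"
  by (auto simp: eqv_def)

lemma eqv_refl [intro]: "x \<in> free_alg \<Longrightarrow> x \<doteq> x"
  by (simp add: eqv_def)

lemma eqv_sym: "x \<doteq> y \<Longrightarrow> y \<doteq> x"
  by (auto simp: eqv_def diff_commute)

lemma eqv_trans [trans]: "x \<doteq> y \<Longrightarrow> y \<doteq> z \<Longrightarrow> x \<doteq> z"
  unfolding eqv_def using triangle[of "x - y" "y - z"] nonneg[of "x - z"] by auto

lemma eqv_eq: "x \<doteq> y \<Longrightarrow> p x = p y"
  using diff_null_eq by (simp add: eqv_def)

lemma eqv_zero_iff: "x \<doteq> 0 \<longleftrightarrow> x \<in> free_alg \<and> p x = 0"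
  by (simp add: eqv_def)

lemma eqv_add: "x \<doteq> x' \<Longrightarrow> y \<doteq> y' \<Longrightarrow> x + y \<doteq> x' + y'"
  unfolding eqv_def using triangle[of "x - x'" "y - y'"] nonneg[of "(x - x') + (y - y')"]
  by (auto simp: algebra_simps)

lemma eqv_scale: "x \<doteq> x' \<Longrightarrow> scale c x \<doteq> scale c x'"
  unfolding eqv_def by (auto simp: scale_diff[symmetric] homogeneous)

lemma eqv_diff: "x \<doteq> x' \<Longrightarrow> y \<doteq> y' \<Longrightarrow> x - y \<doteq> x' - y'"
  using eqv_add[of x x' "scale (-1) y" "scale (-1) y'"] eqv_scale[of y y' "-1"]
  by (simp add: scale_minus_one)

lemma eqv_mult_right: "x \<doteq> x' \<Longrightarrow> y \<in> free_alg \<Longrightarrow> x * y \<doteq> x' * y"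
  unfolding eqv_def using submult[of "x - x'" y] nonneg[of "(x - x') * y"]
  by (auto simp: algebra_simps)

lemma eqv_mult_left: "x \<doteq> x' \<Longrightarrow> y \<in> free_alg \<Longrightarrow> y * x \<doteq> y * x'"
  unfolding eqv_def using submult[of y "x - x'"] nonneg[of "y * (x - x')"]
  by (auto simp: algebra_simps)

lemma eqv_mult: "x \<doteq> x' \<Longrightarrow> y \<doteq> y' \<Longrightarrow> x * y \<doteq> x' * y'"
  by (meson eqvD eqv_mult_left eqv_mult_right eqv_trans)

lemma eqv_star: "x \<doteq> x' \<Longrightarrow> star x \<doteq> star x'"
  unfolding eqv_def by (auto simp: star_diff[symmetric] star_eq)

lemma cstar_cancel: "x \<in> free_alg \<Longrightarrow> star x * x \<doteq> 0 \<Longrightarrow> x \<doteq> 0"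
  by (simp add: eqv_zero_iff cstar)

lemma cstar_cancel': "x \<in> free_alg \<Longrightarrow> x * star x \<doteq> 0 \<Longrightarrow> x \<doteq> 0"
  using cstar_cancel[of "star x"] eqv_star[of "star x" 0] by auto

lemma proj_norm_le_1:
  assumes "star e \<doteq> e" "e * e \<doteq> e"
  shows "p e \<le> 1"
proof -
  have e: "e \<in> free_alg"
    using assms eqvD by blast
  have "star e * e \<doteq> e"
    using eqv_trans[OF eqv_mult_right[OF assms(1) e] assms(2)] .
  then have "(p e)\<^sup>2 = p e"
    using cstar[OF e] eqv_eq by simp
  then show ?thesis
    by (auto simp: power2_eq_square)
qed

text \<open>An instance of the extremality of the unit in the unit ball of a C*-algebra. Since the squares
  of $e + zh$ and $e + izh$ have the mean $e + (1+i)zh$, the bounds on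
  $\|e \pm h\|$, $\|e \pm ih\|$ propagate to $\|e + (1+i)^n h\| \le 1$ for all $n$.\<close>

lemma unit_extreme:
  assumes e: "star e \<doteq> e" "e * e \<doteq> e" and h: "star h \<doteq> h" "e * h \<doteq> h" "h * e \<doteq> h"
    and le: "p (e + h) \<le> 1" "p (e - h) \<le> 1"
  shows "p h = 0"
proof -
  have F [simp]: "e \<in> free_alg" "h \<in> free_alg"
    using e h eqvD by blast+
  define D where "D z = e + scale z h" for z
  have D [simp]: "D z \<in> free_alg" for z
    by (simp add: D_def)
  have mult: "D z * D w \<doteq> e + scale (z + w) h + scale (z * w) (h * h)" for z w
  proof -
    have "D z * D w = e * e + scale w (e * h) + scale z (h * e) + scale (z * w) (h * h)"
      by (simp add: D_def algebra_simps scale_mult_left scale_mult_right scale_add)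
    moreover have "\<dots> \<doteq> e + scale w h + scale z h + scale (z * w) (h * h)"
      by (intro eqv_add eqv_scale e h eqv_refl) auto
    ultimately show ?thesis
      by (simp add: scale_add_left algebra_simps)
  qed
  have sq: "p (D z * D z) \<le> 1" if "p (D z) \<le> 1" for z
    using submult[of "D z" "D z"] mult_le_one[OF that _ that] nonneg[of "D z"] by simp
  have avg: "p x \<le> 1" if "scale 2 x \<doteq> y + z" "p y \<le> 1" "p z \<le> 1" "y \<in> free_alg" "z \<in> free_alg"
    "x \<in> free_alg" for x y z
    using eqv_eq[OF that(1)] triangle[of y z] homogeneous[of x 2] that by simp
  have D1: "p (D 1) \<le> 1" and Dm1: "p (D (-1)) \<le> 1"
    using le by (simp_all add: D_def scale_minus_one)
  \<comment> \<open>The mean of the squares of e + h and e - h is e + h^2.\<close>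
  have hh: "p (e + h * h) \<le> 1"
  proof (rule avg)
    have "D 1 * D 1 + D (-1) * D (-1)
      \<doteq> (e + scale (1 + 1) h + scale (1 * 1) (h * h)) + (e + scale (-1 + -1) h + scale (-1 * -1) (h * h))"
      by (intro eqv_add mult)
    also have "\<dots> = scale 2 (e + h * h)"
      by (rule poly_mapping_eqI) (simp add: lookup_add algebra_simps)
    finally show "scale 2 (e + h * h) \<doteq> D 1 * D 1 + D (-1) * D (-1)"
      by (rule eqv_sym)
  qed (use sq D1 Dm1 in auto)
  \<comment> \<open>For z = i or z = -i the adjoint of \<open>D z\<close> is \<open>D (- z)\<close>,
    and \<open>D (- z) * D z\<close> is e + h^2, so the C*-identity reduces the bound to
    \<open>hh\<close>.\<close>
  have imag: "p (D z) \<le> 1" if "cnj z = - z" "z * z = -1" for z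
  proof -
    have "star (D z) = star e + scale (- z) (star h)"
      by (simp add: D_def star_add star_scale that)
    also have "\<dots> \<doteq> D (- z)"
      unfolding D_def by (intro eqv_add eqv_scale e h)
    finally have "star (D z) * D z \<doteq> D (- z) * D z"
      by (intro eqv_mult_right) auto
    also have "\<dots> \<doteq> e + h * h"
      using mult[of "- z" z] that by simp
    finally have "(p (D z))\<^sup>2 \<le> 1\<^sup>2"
      using hh cstar[of "D z"] eqv_eq by simp
    then show ?thesis
      by (rule power2_le_imp_le) simp
  qed
  \<comment> \<open>The factor \<open>\<i> ^ k\<close> strengthens the induction, because the step
    uses the bound for z and for iz. For n = 0 only the values 1, -1, i, -i occur.\<close>
  have "p (D (\<i> ^ k * (1 + \<i>) ^ n)) \<le> 1" for k n
  proof (induction n arbitrary: k)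
    case 0
    have "\<i> ^ k \<in> {1, -1, \<i>, - \<i>}"
      by (induction k) auto
    then show ?case
      using D1 Dm1 imag[of \<i>] imag[of "- \<i>"] by auto
  next
    case (Suc n)
    define z where "z = \<i> ^ k * (1 + \<i>) ^ n"
    have z: "p (D z) \<le> 1" "p (D (\<i> * z)) \<le> 1"
      using Suc.IH[of k] Suc.IH[of "Suc k"] by (simp_all add: z_def mult_ac)
    have "p (D ((1 + \<i>) * z)) \<le> 1"
    proof (rule avg)
      have "D z * D z + D (\<i> * z) * D (\<i> * z)
        \<doteq> (e + scale (z + z) h + scale (z * z) (h * h))
          + (e + scale (\<i> * z + \<i> * z) h + scale ((\<i> * z) * (\<i> * z)) (h * h))"
        by (intro eqv_add mult)
      also have "\<dots> = scale 2 (D ((1 + \<i>) * z))"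
        by (rule poly_mapping_eqI) (simp add: D_def lookup_add algebra_simps)
      finally show "scale 2 (D ((1 + \<i>) * z)) \<doteq> D z * D z + D (\<i> * z) * D (\<i> * z)"
        by (rule eqv_sym)
    qed (use sq z in auto)
    then show ?case
      by (simp add: z_def mult_ac)
  qed
  from this[of 0] have Dn: "p (D ((1 + \<i>) ^ n)) \<le> 1" for n
    by simp
  have n2: "cmod (1 + \<i>) = sqrt 2"
    by (simp add: cmod_def)
  \<comment> \<open>The modulus of 1 + i is the square root of 2. As this exceeds 1, a nonzero h
    would have multiples of arbitrarily large norm that all stay below 2.\<close>
  have bound: "sqrt 2 ^ n * p h \<le> 2" for n
  proof -
    have "p (scale ((1 + \<i>) ^ n) h) = p (D ((1 + \<i>) ^ n) - e)"
      by (simp add: D_def)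
    also have "\<dots> \<le> 1 + 1"
      using diff_triangle[of "D ((1 + \<i>) ^ n)" e] Dn[of n] proj_norm_le_1[OF e] by auto
    also have "p (scale ((1 + \<i>) ^ n) h) = sqrt 2 ^ n * p h"
      using n2 by (simp add: homogeneous norm_power)
    finally show ?thesis
      by simp
  qed
  show ?thesis
  proof (rule ccontr)
    assume "p h \<noteq> 0"
    then have pos: "p h > 0"
      using nonneg[of h] by auto
    obtain n where "2 / p h < sqrt 2 ^ n"
      using real_arch_pow[of "sqrt 2" "2 / p h"] by auto
    then show False
      using bound[of n] pos by (simp add: field_simps)
  qed
qed

end

section \<open>Consequences of the relations, up to orthogonality of distinct edges\<close>

locale katsura_std = katsura +
  assumes finite_Omega_at: "\<And>i. i \<in> V \<Longrightarrow> finite (Omega_at i)"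
    and Omega_at_nonempty: "\<And>i. i \<in> V \<Longrightarrow> Omega_at i \<noteq> {}"
begin

notation un.eqv (infix \<open>\<doteq>\<close> 50)

lemma OmegaD: "(i, j) \<in> Omega \<Longrightarrow> i \<in> V" "(i, j) \<in> Omega \<Longrightarrow> j \<in> V" "(i, j) \<in> Omega \<Longrightarrow> A i j > 0"
  by (auto simp: Omega_def)

lemma eqv_relator: "x - y \<in> relators \<Longrightarrow> x \<in> free_alg \<Longrightarrow> y \<in> free_alg \<Longrightarrow> x \<doteq> y"
  by (simp add: un.eqv_def un.relators)

lemma genq_star: "i \<in> V \<Longrightarrow> star (genq i) \<doteq> genq i"
  and genq_idem: "i \<in> V \<Longrightarrow> genq i * genq i \<doteq> genq i"
  and genu_range: "i \<in> V \<Longrightarrow> genu i * star (genu i) \<doteq> genq i"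
  and genu_source: "i \<in> V \<Longrightarrow> star (genu i) * genu i \<doteq> genq i"
  by (auto intro!: eqv_relator relators.intros)

lemma genq_orth: "i \<in> V \<Longrightarrow> j \<in> V \<Longrightarrow> i \<noteq> j \<Longrightarrow> genq i * genq j \<doteq> 0"
  by (auto simp: un.eqv_def intro!: un.relators relators.intros)

lemma gens_pisom: "(i, j) \<in> Omega \<Longrightarrow> gens i j n * star (gens i j n) * gens i j n \<doteq> gens i j n"
  and gens_genu: "(i, j) \<in> Omega \<Longrightarrow> gens i j n * genu j \<doteq> gens i j (n + int (A i j))"
  and genu_gens: "(i, j) \<in> Omega \<Longrightarrow> genu i * gens i j n \<doteq> gens i j (n + B i j)"
  and gens_source: "(i, j) \<in> Omega \<Longrightarrow> star (gens i j n) * gens i j n \<doteq> genq j"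
  by (auto intro!: eqv_relator relators.intros dest: OmegaD)

lemma genq_sum: "i \<in> V \<Longrightarrow>
    genq i \<doteq> (\<Sum>j\<in>Omega_at i. \<Sum>n = 1..int (A i j). gens i j n * star (gens i j n))"
  by (auto simp: Omega_at_def intro!: eqv_relator free_alg_sum relators.intros[unfolded Omega_at_def])

text \<open>By the C*-identity it suffices that x x^* vanishes for x = ea - a, and expanding this
  product gives e - e - e + e.\<close>

lemma proj_absorb:
  assumes "star e \<doteq> e" "e * e \<doteq> e" "a * star a \<doteq> e" "a \<in> free_alg"
  shows "e * a \<doteq> a"
proof -
  have e: "e \<in> free_alg"
    using assms un.eqvD by blast
  have sa: "star (e * a - a) = star a * star e - star a"
    by (simp add: star_diff star_mult)
  have "(e * a - a) * star (e * a - a)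
    = e * (a * star a) * star e - e * (a * star a) - (a * star a) * star e + a * star a"
    unfolding sa by (simp add: algebra_simps)
  also have "\<dots> \<doteq> e * e * e - e * e - e * e + e"
    by (intro un.eqv_add un.eqv_diff un.eqv_mult assms un.eqv_refl e)
  also have "\<dots> \<doteq> e * e - e - e + e"
    by (intro un.eqv_add un.eqv_diff un.eqv_mult assms un.eqv_refl e)
  also have "\<dots> \<doteq> e - e - e + e"
    by (intro un.eqv_add un.eqv_diff un.eqv_mult assms un.eqv_refl e)
  finally have "(e * a - a) * star (e * a - a) \<doteq> 0"
    by simp
  then have "e * a - a \<doteq> 0"
    by (rule un.cstar_cancel'[rotated]) (simp add: e assms(4))
  then show ?thesis
    using e assms(4) by (simp add: un.eqv_def)
qed

lemma genq_genu: "i \<in> V \<Longrightarrow> genq i * genu i \<doteq> genu i"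
  by (rule proj_absorb) (auto intro: genq_star genq_idem genu_range)

text \<open>Here q_j is replaced by s^* s, and s s^* s = s.\<close>

lemma gens_genq: "(i, j) \<in> Omega \<Longrightarrow> gens i j n * genq j \<doteq> gens i j n"
  using un.eqv_trans[OF un.eqv_sym[OF un.eqv_mult_left[OF gens_source]] gens_pisom[unfolded mult.assoc]]
  by auto

text \<open>No relator states this. It holds because every \<open>gens i j n\<close> is
  \<open>genu i\<close> times another one, and \<open>genq i\<close> absorbs
  \<open>genu i\<close>.\<close>

lemma genq_gens:
  assumes ij: "(i, j) \<in> Omega"
  shows "genq i * gens i j n \<doteq> gens i j n"
proof -
  note i = OmegaD(1)[OF ij]
  have F: "genq i \<in> free_alg" "gens i j m \<in> free_alg" "genu i \<in> free_alg" for m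
    using ij i by auto
  have s: "genu i * gens i j (n - B i j) \<doteq> gens i j n"
    using genu_gens[OF ij, of "n - B i j"] by simp
  have "genq i * gens i j n \<doteq> genq i * (genu i * gens i j (n - B i j))"
    using un.eqv_mult_left[OF un.eqv_sym[OF s]] F by blast
  also have "\<dots> = (genq i * genu i) * gens i j (n - B i j)"
    by (simp add: mult.assoc)
  also have "\<dots> \<doteq> genu i * gens i j (n - B i j)"
    using un.eqv_mult_right[OF genq_genu[OF i]] F by blast
  also have "\<dots> \<doteq> gens i j n"
    by (rule s)
  finally show ?thesis .
qed

definition edges_at :: "nat \<Rightarrow> edge set" where
  "edges_at i = {e \<in> edges. esrc e = i}"

lemma edges_at_eq: "edges_at i = Pair i ` (SIGMA j:Omega_at i. {1..int (A i j)})"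
  by (auto simp: edges_at_def edges_def Omega_at_def)

lemma finite_edges_at: "i \<in> V \<Longrightarrow> finite (edges_at i)"
  unfolding edges_at_eq using finite_Omega_at by (intro finite_imageI finite_SigmaI) auto

definition gene :: "edge \<Rightarrow> falg" where
  "gene e = (case e of (i, j, n) \<Rightarrow> gens i j n)"

lemma gene_simp [simp]: "gene (i, j, n) = gens i j n"
  by (simp add: gene_def)

lemma sum_edges_at:
  "i \<in> V \<Longrightarrow> (\<Sum>j\<in>Omega_at i. \<Sum>n = 1..int (A i j). g (i, j, n)) = (\<Sum>e\<in>edges_at i. g e)"
  unfolding edges_at_eq using finite_Omega_at
  by (simp add: sum.reindex inj_on_def sum.Sigma case_prod_unfold)

lemma genq_sum': "i \<in> V \<Longrightarrow> genq i \<doteq> (\<Sum>e\<in>edges_at i. gene e * star (gene e))"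
  using genq_sum[of i] sum_edges_at[of i "\<lambda>e. gene e * star (gene e)"] by simp

text \<open>The range projections of the edges leaving a vertex sum up to a projection, and this forces
  them to be orthogonal. After conjugation with \<open>gene l\<close> the terms \<open>y k\<close> with \<open>k \<noteq> l\<close> are positive
  with sum zero, while \<open>e - y k\<close> has norm at most one.\<close>

lemma gene_orth:
  assumes k: "k \<in> edges_at i" and l: "l \<in> edges_at i" and ne: "k \<noteq> l"
  shows "star (gene k) * gene l \<doteq> 0"
proof -
  define j where "j = etgt l"
  have Om: "\<exists>j n. e = (i, j, n) \<and> (i, j) \<in> Omega" if "e \<in> edges_at i" for e
    using that by (cases e) (auto simp: edges_at_def edges_def)
  have i: "i \<in> V" and j: "j \<in> V"
    using Om[OF l] OmegaD by (auto simp: j_def)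
  have F: "gene e \<in> free_alg" if "e \<in> edges_at i" for e
    using Om[OF that] by auto
  note Fl = F[OF l]
  have q [simp]: "genq i \<in> free_alg" "genq j \<in> free_alg"
    using i j by auto
  have fin: "finite (edges_at i)"
    using finite_edges_at[OF i] .
  define P where "P k = gene k * star (gene k)" for k
  \<comment> \<open>The range projection of k compressed by \<open>gene l\<close>. By the
    C*-identity the claim amounts to the vanishing of \<open>y k\<close>.\<close>
  define y where "y k = star (star (gene k) * gene l) * (star (gene k) * gene l)" for k
  define c where "c k = genq j - y k" for k
  have y_eq: "y k = star (gene l) * P k * gene l" for k
    by (simp add: y_def P_def star_mult mult.assoc)
  have PF: "P k \<in> free_alg" and yF: "y k \<in> free_alg" and cF: "c k \<in> free_alg"
    if "k \<in> edges_at i" for k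
    using F[OF that] Fl by (auto simp: P_def y_def c_def)
  have ql: "genq i * gene l \<doteq> gene l" "star (gene l) * gene l \<doteq> genq j" "gene l * genq j \<doteq> gene l"
    using Om[OF l] genq_gens gens_source gens_genq by (auto simp: j_def)
  have y_l: "y l \<doteq> genq j"
  proof -
    have "y l = star (gene l) * gene l * (star (gene l) * gene l)"
      by (simp add: y_eq P_def mult.assoc)
    also have "\<dots> \<doteq> genq j * genq j"
      by (intro un.eqv_mult ql)
    also have "\<dots> \<doteq> genq j"
      by (rule genq_idem[OF j])
    finally show ?thesis .
  qed
  have y_sum: "(\<Sum>k\<in>edges_at i. y k) \<doteq> genq j"
  proof -
    have "(\<Sum>k\<in>edges_at i. y k) = star (gene l) * (\<Sum>k\<in>edges_at i. P k) * gene l"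
      by (simp add: y_eq sum_distrib_left sum_distrib_right)
    also have "\<dots> \<doteq> star (gene l) * genq i * gene l"
      by (intro un.eqv_mult_right un.eqv_mult_left un.eqv_sym[OF genq_sum'[OF i, folded P_def]])
        (use Fl in auto)
    also have "\<dots> = star (gene l) * (genq i * gene l)"
      by (simp add: mult.assoc)
    also have "\<dots> \<doteq> star (gene l) * gene l"
      by (intro un.eqv_mult_left ql) (use Fl in auto)
    also have "\<dots> \<doteq> genq j"
      by (rule ql)
    finally show ?thesis .
  qed
  \<comment> \<open>\<open>c k\<close> is the projection q_i - P k compressed by
    \<open>gene l\<close>, hence of the form x^* x with x of norm at most 1.\<close>
  have norm_c: "univ_norm (c k) \<le> 1" if k: "k \<in> edges_at i" for k
  proof -
    note Fk = F[OF k]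
    have Pk: "star (P k) = P k"
      by (simp add: P_def star_mult)
    have "P k * P k = gene k * (star (gene k) * gene k * star (gene k))"
      by (simp add: P_def mult.assoc)
    also have "\<dots> = gene k * star (gene k * star (gene k) * gene k)"
      by (simp add: star_mult mult.assoc)
    also have "\<dots> \<doteq> P k"
      unfolding P_def using Om[OF k] Fk gens_pisom by (intro un.eqv_mult_left un.eqv_star) auto
    finally have PP: "P k * P k \<doteq> P k" .
    have "genq i * P k = (genq i * gene k) * star (gene k)"
      by (simp add: P_def mult.assoc)
    also have "\<dots> \<doteq> P k"
      unfolding P_def using Om[OF k] Fk genq_gens by (intro un.eqv_mult_right) auto
    finally have qP: "genq i * P k \<doteq> P k" .
    have "P k * genq i \<doteq> P k * star (genq i)"
      using un.eqv_mult_left[OF un.eqv_sym[OF genq_star[OF i]] PF[OF k]] .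
    also have "\<dots> = star (genq i * P k)"
      by (simp add: star_mult Pk)
    also have "\<dots> \<doteq> star (P k)"
      by (rule un.eqv_star[OF qP])
    finally have Pq: "P k * genq i \<doteq> P k"
      by (simp add: Pk)
    define d where "d = genq i - P k"
    have dF: "d \<in> free_alg"
      using PF[OF k] by (simp add: d_def)
    have sd: "star d \<doteq> d"
      unfolding d_def star_diff Pk by (intro un.eqv_diff genq_star i un.eqv_refl PF k)
    have "d * d = genq i * genq i - genq i * P k - P k * genq i + P k * P k"
      by (simp add: d_def algebra_simps)
    also have "\<dots> \<doteq> genq i - P k - P k + P k"
      by (intro un.eqv_add un.eqv_diff genq_idem i PP Pq qP)
    finally have dd: "d * d \<doteq> d"
      by (simp add: d_def)
    have nd: "univ_norm d \<le> 1"
      by (rule un.proj_norm_le_1[OF sd dd])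
    have "star (d * gene l) * (d * gene l) = star (gene l) * (star d * d) * gene l"
      by (simp add: star_mult mult.assoc)
    also have "\<dots> \<doteq> star (gene l) * d * gene l"
      using un.eqv_trans[OF un.eqv_mult_right[OF sd dF] dd] Fl
      by (intro un.eqv_mult_left un.eqv_mult_right) auto
    also have "\<dots> = star (gene l) * (genq i * gene l) - y k"
      by (simp add: d_def y_eq algebra_simps)
    also have "\<dots> \<doteq> star (gene l) * gene l - y k"
      by (intro un.eqv_diff un.eqv_mult_left ql un.eqv_refl yF k) (use Fl in auto)
    also have "\<dots> \<doteq> c k"
      unfolding c_def by (intro un.eqv_diff ql un.eqv_refl yF k)
    finally have "univ_norm (c k) = (univ_norm (d * gene l))\<^sup>2"
      using un.cstar[of "d * gene l"] dF Fl un.eqv_eq by auto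
    moreover have "univ_norm (d * gene l) \<le> 1"
    proof -
      have "univ_norm (gene l) \<le> 1"
        using Om[OF l] un.gens_le_1 by auto
      then show ?thesis
        using un.submult[OF dF Fl] mult_le_one[OF nd _ \<open>univ_norm (gene l) \<le> 1\<close>] un.nonneg[OF Fl]
        by simp
    qed
    ultimately show ?thesis
      using dF Fl by (auto intro!: power_le_one un.nonneg)
  qed
  define K where "K = edges_at i - {l}"
  define m where "m = card K"
  have kK: "k \<in> K" "finite K"
    using k ne fin by (auto simp: K_def)
  then have m: "m > 0"
    by (auto simp: m_def card_gt_0_iff)
  \<comment> \<open>The term for l alone already accounts for the whole sum: both are q_j.\<close>
  have yK: "(\<Sum>k\<in>K. y k) \<doteq> 0"
  proof -
    have "(\<Sum>k\<in>K. y k) = (\<Sum>k\<in>edges_at i. y k) - y l"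
      using fin l by (simp add: K_def sum_diff1)
    also have "\<dots> \<doteq> genq j - genq j"
      by (intro un.eqv_diff y_sum y_l)
    finally show ?thesis
      by simp
  qed
  have scale_of_nat: "scale (of_nat n) x = of_nat n * x" for n x
    by (induction n) (auto simp: scale_add_left algebra_simps)
  have csum: "(\<Sum>k\<in>K'. c k) = scale (of_nat (card K')) (genq j) - (\<Sum>k\<in>K'. y k)" for K'
    by (simp add: c_def sum_subtractf scale_of_nat)
  \<comment> \<open>With the factor 1/m both signs are averages of m contractions: m (q_j - h) is (m
    - 1) q_j + \<open>c k\<close>, and m (q_j + h) is q_j plus the m - 1 terms \<open>c\<close> of
    the other edges in K, since the \<open>y\<close> over K sum to zero.\<close>
  define h where "h = scale (1 / of_nat m) (y k)"
  have hF: "h \<in> free_alg"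
    using yF[OF k] by (simp add: h_def)
  have cm: "cmod (1 / of_nat m) = 1 / real m"
    by (simp add: norm_divide)
  have pq: "univ_norm (genq j) \<le> 1"
    by (rule un.proj_le_1[OF j])
  have sum_c: "univ_norm (\<Sum>k\<in>K'. c k) \<le> card K'" if "K' \<subseteq> K" for K'
  proof -
    have K': "K' \<subseteq> edges_at i"
      using that by (auto simp: K_def)
    have "univ_norm (\<Sum>k\<in>K'. c k) \<le> (\<Sum>k\<in>K'. univ_norm (c k))"
      by (rule un.sum_triangle) (use K' cF in auto)
    also have "\<dots> \<le> (\<Sum>k\<in>K'. 1)"
      by (rule sum_mono) (use K' norm_c in auto)
    finally show ?thesis
      by simp
  qed
  have minus: "univ_norm (genq j - h) \<le> 1"
  proof -
    have "genq j - h = scale (1 / of_nat m) (scale (of_nat (m - 1)) (genq j) + c k)"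
      by (rule poly_mapping_eqI)
        (use m in \<open>simp add: h_def c_def lookup_add lookup_minus of_nat_diff field_simps\<close>)
    moreover have "univ_norm (scale (of_nat (m - 1)) (genq j) + c k) \<le> real (m - 1) * 1 + 1"
      using un.triangle[of "scale (of_nat (m - 1)) (genq j)" "c k"] cF[OF k]
        un.homogeneous[of "genq j" "of_nat (m - 1)"] mult_left_mono[OF pq, of "real (m - 1)"]
        norm_c[OF k] by simp
    ultimately show ?thesis
      using m cF[OF k] by (simp add: un.homogeneous norm_divide of_nat_diff)
  qed
  have plus: "univ_norm (genq j + h) \<le> 1"
  proof -
    define z where "z = (\<Sum>k\<in>K - {k}. c k) + genq j"
    have zF: "z \<in> free_alg"
      unfolding z_def K_def by (intro free_alg_add free_alg_sum cF) auto
    have "scale (of_nat m) (genq j + h) = scale (of_nat m) (genq j) - (0 - y k)"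
      by (rule poly_mapping_eqI) (use m in \<open>simp add: h_def lookup_add lookup_minus algebra_simps\<close>)
    also have "\<dots> \<doteq> scale (of_nat m) (genq j) - ((\<Sum>k\<in>K. y k) - y k)"
      by (intro un.eqv_diff un.eqv_refl un.eqv_sym[OF yK] yF k) auto
    also have "(\<Sum>k\<in>K. y k) - y k = (\<Sum>k\<in>K - {k}. y k)"
      using kK by (simp add: sum_diff1)
    also have "scale (of_nat m) (genq j) - (\<Sum>k\<in>K - {k}. y k) = z"
    proof -
      have "m = Suc (card (K - {k}))"
        unfolding m_def using kK by (metis card_Suc_Diff1)
      then have "scale (of_nat m) (genq j) = scale (of_nat (card (K - {k}))) (genq j) + genq j"
        by (simp add: scale_add_left)
      then show ?thesis
        unfolding z_def csum by (simp only: diff_add_eq)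
    qed
    finally have "univ_norm (scale (of_nat m) (genq j + h)) = univ_norm z"
      by (rule un.eqv_eq)
    also have "\<dots> \<le> (real m - 1) + 1"
    proof -
      have "univ_norm (\<Sum>k\<in>K - {k}. c k) \<le> real m - 1"
        using sum_c[of "K - {k}"] kK m by (auto simp: m_def of_nat_diff)
      moreover have "(\<Sum>k\<in>K - {k}. c k) \<in> free_alg"
        unfolding K_def by (intro free_alg_sum cF) auto
      ultimately show ?thesis
        unfolding z_def using un.triangle[of "\<Sum>k\<in>K - {k}. c k" "genq j"] pq by simp
    qed
    finally show ?thesis
      using m hF by (simp add: un.homogeneous field_simps)
  qed
  have qy: "genq j * y k \<doteq> y k" and yq: "y k * genq j \<doteq> y k"
  proof -
    have "y k * genq j = star (gene l) * P k * (gene l * genq j)"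
      by (simp add: y_eq mult.assoc)
    also have "\<dots> \<doteq> y k"
      unfolding y_eq using Fl PF[OF k] by (intro un.eqv_mult_left ql) auto
    finally show yq: "y k * genq j \<doteq> y k" .
    have sy: "star (y k) = y k"
      by (simp add: y_def star_mult)
    have "genq j * y k \<doteq> star (genq j) * y k"
      using un.eqv_mult_right[OF un.eqv_sym[OF genq_star[OF j]] yF[OF k]] .
    also have "\<dots> = star (y k * genq j)"
      by (simp add: star_mult sy)
    also have "\<dots> \<doteq> y k"
      using un.eqv_star[OF yq] sy by simp
    finally show "genq j * y k \<doteq> y k" .
  qed
  have "univ_norm h = 0"
  proof (rule un.unit_extreme[of "genq j"])
    have "star h = h"
      by (simp add: h_def star_scale y_def star_mult)
    then show "star h \<doteq> h"
      using hF by auto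
    show "genq j * h \<doteq> h"
      using un.eqv_scale[OF qy] by (simp add: h_def scale_mult_right)
    show "h * genq j \<doteq> h"
      using un.eqv_scale[OF yq] by (simp add: h_def scale_mult_left)
  qed (use genq_star genq_idem j plus minus in auto)
  then have "univ_norm (y k) = 0"
    using m yF[OF k] by (simp add: h_def un.homogeneous)
  then show ?thesis
    using F[OF k] Fl yF[OF k] by - (rule un.cstar_cancel, auto simp: un.eqv_zero_iff y_def)
qed

end

section \<open>The image of the free *-algebra in the completion\<close>

context katsura
begin

notation un.eqv (infix \<open>\<doteq>\<close> 50)

lemma null_rel_sym: "(x, y) \<in> null_rel \<Longrightarrow> (y, x) \<in> null_rel"
  by (auto simp: null_rel_def cauchy_seq_def un.diff_commute)

lemma null_rel_trans:
  assumes "(x, y) \<in> null_rel" "(y, z) \<in> null_rel"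
  shows "(x, z) \<in> null_rel"
proof -
  have F: "x n \<in> free_alg" "y n \<in> free_alg" "z n \<in> free_alg" for n
    using assms by (auto simp: null_rel_def cauchy_seq_def)
  have "(\<lambda>n. univ_norm (x n - z n)) \<longlonglongrightarrow> 0"
  proof (rule tendsto_sandwich[OF _ _ tendsto_const])
    show "(\<lambda>n. univ_norm (x n - y n) + univ_norm (y n - z n)) \<longlonglongrightarrow> 0"
      using tendsto_add[of "\<lambda>n. univ_norm (x n - y n)" 0 sequentially "\<lambda>n. univ_norm (y n - z n)" 0] assms
      by (simp add: null_rel_def)
    show "\<forall>\<^sub>F n in sequentially. univ_norm (x n - z n) \<le> univ_norm (x n - y n) + univ_norm (y n - z n)"
      using un.triangle[of "x n - y n" "y n - z n" for n] F by (intro always_eventually) auto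
  qed (use F in \<open>auto intro!: always_eventually un.nonneg\<close>)
  then show ?thesis
    using assms by (auto simp: null_rel_def)
qed

text \<open>The class of a constant sequence consists of the sequences converging to that constant;
  the Cauchy property is then automatic.\<close>

lemma emb_iff:
  assumes c: "c \<in> free_alg"
  shows "z \<in> emb c \<longleftrightarrow> (\<forall>n. z n \<in> free_alg) \<and> (\<lambda>n. univ_norm (z n - c)) \<longlonglongrightarrow> 0"
proof
  assume "z \<in> emb c"
  then have "\<forall>n. z n \<in> free_alg" "(\<lambda>n. univ_norm (c - z n)) \<longlonglongrightarrow> 0"
    by (auto simp: emb_def null_rel_def cauchy_seq_def)
  then show "(\<forall>n. z n \<in> free_alg) \<and> (\<lambda>n. univ_norm (z n - c)) \<longlonglongrightarrow> 0"
    using c un.diff_commute[of c] by simp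
next
  assume z: "(\<forall>n. z n \<in> free_alg) \<and> (\<lambda>n. univ_norm (z n - c)) \<longlonglongrightarrow> 0"
  have "\<exists>M. \<forall>m\<ge>M. \<forall>n\<ge>M. univ_norm (z m - z n) < e" if e: "e > 0" for e
  proof -
    obtain M where M: "\<And>n. n \<ge> M \<Longrightarrow> univ_norm (z n - c) < e / 2"
      using order_tendstoD(2)[of "\<lambda>n. univ_norm (z n - c)" 0 sequentially "e / 2"] z e
      by (auto simp: eventually_sequentially)
    have "univ_norm (z m - z n) < e" if "m \<ge> M" "n \<ge> M" for m n
      using un.diff_triangle[of "z m - c" "z n - c"] z c M[OF that(1)] M[OF that(2)] by auto
    then show ?thesis
      by blast
  qed
  then have "cauchy_seq z"
    using z by (auto simp: cauchy_seq_def)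
  moreover have "cauchy_seq (\<lambda>_. c)"
    using c by (simp add: cauchy_seq_def)
  moreover have "(\<lambda>n. univ_norm (c - z n)) \<longlonglongrightarrow> 0"
    using z c un.diff_commute[of c] by simp
  ultimately show "z \<in> emb c"
    by (simp add: emb_def null_rel_def)
qed

lemma emb_self: "c \<in> free_alg \<Longrightarrow> (\<lambda>_. c) \<in> emb c"
  by (simp add: emb_iff)

lemma emb_class:
  assumes "c \<in> free_alg" "z \<in> emb c"
  shows "null_rel `` {z} = emb c"
  using assms(2) unfolding emb_def by (auto intro: null_rel_trans null_rel_sym)

lemma emb_eq_iff:
  assumes "a \<in> free_alg" "b \<in> free_alg"
  shows "emb a = emb b \<longleftrightarrow> a \<doteq> b"
proof
  assume "emb a = emb b"
  then have "(\<lambda>_. a) \<in> emb b"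
    using emb_self[OF assms(1)] by simp
  then show "a \<doteq> b"
    using assms by (auto simp: emb_iff un.eqv_def LIMSEQ_const_iff)
next
  assume "a \<doteq> b"
  then have "(\<lambda>_. a) \<in> emb b"
    using assms by (auto simp: emb_iff un.eqv_def)
  then show "emb a = emb b"
    using emb_class[OF assms(2)] by (auto simp: emb_def)
qed

text \<open>The union in \<open>mulO\<close> runs over all representatives, so each pair of them
  must yield the same class.\<close>

lemma emb_mult:
  assumes a: "a \<in> free_alg" and b: "b \<in> free_alg"
  shows "emb a \<cdot> emb b = emb (a * b)"
proof -
  have "null_rel `` {\<lambda>n. x n * y n} = emb (a * b)" if "x \<in> emb a" "y \<in> emb b" for x y
  proof (rule emb_class)
    have F: "x n \<in> free_alg" "y n \<in> free_alg" for n
      using that a b by (auto simp: emb_iff)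
    have lim: "(\<lambda>n. univ_norm (x n - a)) \<longlonglongrightarrow> 0" "(\<lambda>n. univ_norm (y n - b)) \<longlonglongrightarrow> 0"
      using that a b by (auto simp: emb_iff)
    have "(\<lambda>n. univ_norm (x n * y n - a * b)) \<longlonglongrightarrow> 0"
    proof (rule tendsto_sandwich[OF _ _ tendsto_const])
      have "(\<lambda>n. (univ_norm (x n - a) + univ_norm a) * univ_norm (y n - b)
          + univ_norm (x n - a) * univ_norm b) \<longlonglongrightarrow> (0 + univ_norm a) * 0 + 0 * univ_norm b"
        by (intro tendsto_intros lim)
      then show "(\<lambda>n. (univ_norm (x n - a) + univ_norm a) * univ_norm (y n - b)
          + univ_norm (x n - a) * univ_norm b) \<longlonglongrightarrow> 0"
        by simp
      have "univ_norm (x n * y n - a * b)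
        \<le> (univ_norm (x n - a) + univ_norm a) * univ_norm (y n - b) + univ_norm (x n - a) * univ_norm b" for n
      proof -
        have "x n * y n - a * b = x n * (y n - b) + (x n - a) * b"
          by (simp add: algebra_simps)
        then have "univ_norm (x n * y n - a * b) \<le> univ_norm (x n * (y n - b)) + univ_norm ((x n - a) * b)"
          using un.triangle[of "x n * (y n - b)" "(x n - a) * b"] F a b by simp
        moreover have "univ_norm (x n * (y n - b)) \<le> univ_norm (x n) * univ_norm (y n - b)"
          "univ_norm ((x n - a) * b) \<le> univ_norm (x n - a) * univ_norm b"
          using F a b by (auto intro: un.submult)
        moreover have "univ_norm (x n) * univ_norm (y n - b)
          \<le> (univ_norm (x n - a) + univ_norm a) * univ_norm (y n - b)"
          using un.triangle[of "x n - a" a] F[of n] a b by (intro mult_right_mono) (auto intro: un.nonneg)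
        ultimately show ?thesis
          by linarith
      qed
      then show "\<forall>\<^sub>F n in sequentially. univ_norm (x n * y n - a * b)
        \<le> (univ_norm (x n - a) + univ_norm a) * univ_norm (y n - b) + univ_norm (x n - a) * univ_norm b"
        by simp
    qed (use F a b in \<open>auto intro!: always_eventually un.nonneg\<close>)
    then show "(\<lambda>n. x n * y n) \<in> emb (a * b)"
      using F a b by (auto simp: emb_iff)
  qed (use a b in auto)
  then show ?thesis
    unfolding mulO_def using emb_self[OF a] emb_self[OF b] by blast
qed

lemma emb_star:
  assumes a: "a \<in> free_alg"
  shows "adjO (emb a) = emb (star a)"
proof -
  have "null_rel `` {\<lambda>n. star (x n)} = emb (star a)" if x: "x \<in> emb a" for x
  proof (rule emb_class)
    have "univ_norm (star (x n) - star a) = univ_norm (x n - a)" for n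
      using x a un.star_eq[of "x n - a"] by (auto simp: emb_iff star_diff)
    then show "(\<lambda>n. star (x n)) \<in> emb (star a)"
      using x a by (auto simp: emb_iff)
  qed (use a in auto)
  then show ?thesis
    unfolding adjO_def using emb_self[OF a] by blast
qed

text \<open>All of \<open>S_AB\<close> consists of classes of constant sequences. On this carrier
  the semigroup laws are inherited from the *-algebra.\<close>

definition embs :: "(nat \<Rightarrow> falg) set set" where
  "embs = emb ` free_alg"

lemma embs_emb [simp]: "a \<in> free_alg \<Longrightarrow> emb a \<in> embs"
  by (simp add: embs_def)

lemma embs_mul [simp]: "x \<in> embs \<Longrightarrow> y \<in> embs \<Longrightarrow> x \<cdot> y \<in> embs"
  and embs_adj [simp]: "x \<in> embs \<Longrightarrow> adjO x \<in> embs"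
  and embs_zero [simp]: "zeroO \<in> embs"
  by (auto simp: embs_def emb_mult emb_star zeroO_def)

lemma mulO_assoc [simp]: "x \<in> embs \<Longrightarrow> y \<in> embs \<Longrightarrow> z \<in> embs \<Longrightarrow> x \<cdot> y \<cdot> z = x \<cdot> (y \<cdot> z)"
  by (auto simp: embs_def emb_mult mult.assoc)

lemma adjO_mul [simp]: "x \<in> embs \<Longrightarrow> y \<in> embs \<Longrightarrow> adjO (x \<cdot> y) = adjO y \<cdot> adjO x"
  by (auto simp: embs_def emb_mult emb_star star_mult)

lemma adjO_adjO [simp]: "x \<in> embs \<Longrightarrow> adjO (adjO x) = x"
  by (auto simp: embs_def emb_star)

lemma mulO_zero [simp]: "x \<in> embs \<Longrightarrow> x \<cdot> zeroO = zeroO" "x \<in> embs \<Longrightarrow> zeroO \<cdot> x = zeroO"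
  by (auto simp: embs_def emb_mult zeroO_def)

lemma adjO_zero [simp]: "adjO zeroO = zeroO"
  by (simp add: emb_star zeroO_def)

end


section \<open>Standard forms\<close>

context katsura_std
begin

lemma embs_gens [simp]: "i \<in> V \<Longrightarrow> qO i \<in> embs" "i \<in> V \<Longrightarrow> uO i \<in> embs"
    "(i, j) \<in> Omega \<Longrightarrow> sO i j n \<in> embs"
  by (simp_all add: qO_def uO_def sO_def)

lemma qO_adj [simp]: "i \<in> V \<Longrightarrow> adjO (qO i) = qO i"
  and qO_idem [simp]: "i \<in> V \<Longrightarrow> qO i \<cdot> qO i = qO i"
  and uO_range [simp]: "i \<in> V \<Longrightarrow> uO i \<cdot> adjO (uO i) = qO i"
  and uO_source [simp]: "i \<in> V \<Longrightarrow> adjO (uO i) \<cdot> uO i = qO i"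
  and qO_uO [simp]: "i \<in> V \<Longrightarrow> qO i \<cdot> uO i = uO i"
  by (simp_all add: qO_def uO_def emb_mult emb_star emb_eq_iff genq_star genq_idem genu_range
      genu_source genq_genu)

lemma qO_orth: "i \<in> V \<Longrightarrow> j \<in> V \<Longrightarrow> i \<noteq> j \<Longrightarrow> qO i \<cdot> qO j = zeroO"
  by (simp add: qO_def zeroO_def emb_mult emb_eq_iff genq_orth)

lemma qO_adj_uO [simp]: "i \<in> V \<Longrightarrow> qO i \<cdot> adjO (uO i) = adjO (uO i)"
  using proj_absorb[OF genq_star genq_idem, of i "star (genu i)"]
  by (simp add: qO_def uO_def emb_mult emb_star emb_eq_iff genu_source)

lemma uO_qO [simp]: "i \<in> V \<Longrightarrow> uO i \<cdot> qO i = uO i"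
  by (metis adjO_adjO adjO_mul embs_adj embs_gens(1,2) qO_adj qO_adj_uO)

lemma adj_uO_qO [simp]: "i \<in> V \<Longrightarrow> adjO (uO i) \<cdot> qO i = adjO (uO i)"
  by (metis adjO_mul embs_gens(1,2) qO_adj qO_uO)

lemma sO_uO: "(i, j) \<in> Omega \<Longrightarrow> sO i j n \<cdot> uO j = sO i j (n + int (A i j))"
  and uO_sO: "(i, j) \<in> Omega \<Longrightarrow> uO i \<cdot> sO i j n = sO i j (n + B i j)"
  and sO_source [simp]: "(i, j) \<in> Omega \<Longrightarrow> adjO (sO i j n) \<cdot> sO i j n = qO j"
  and sO_qO [simp]: "(i, j) \<in> Omega \<Longrightarrow> sO i j n \<cdot> qO j = sO i j n"
  and qO_sO [simp]: "(i, j) \<in> Omega \<Longrightarrow> qO i \<cdot> sO i j n = sO i j n"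
  by (simp_all add: qO_def uO_def sO_def emb_mult emb_star emb_eq_iff gens_genu genu_gens
      gens_source gens_genq genq_gens OmegaD)

lemma adj_sO_qO [simp]: "(i, j) \<in> Omega \<Longrightarrow> adjO (sO i j n) \<cdot> qO i = adjO (sO i j n)"
  and qO_adj_sO [simp]: "(i, j) \<in> Omega \<Longrightarrow> qO j \<cdot> adjO (sO i j n) = adjO (sO i j n)"
  using adjO_mul[of "qO i" "sO i j n"] adjO_mul[of "sO i j n" "qO j"] by (auto simp: OmegaD)

definition sE :: "edge \<Rightarrow> (nat \<Rightarrow> falg) set" where
  "sE e = (case e of (i, j, n) \<Rightarrow> sO i j n)"

lemma edgesD: "e \<in> edges \<Longrightarrow> (esrc e, etgt e) \<in> Omega"
    "e \<in> edges \<Longrightarrow> esrc e \<in> V" "e \<in> edges \<Longrightarrow> etgt e \<in> V"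
  by (auto simp: edges_def OmegaD)

lemma gene_free_alg: "e \<in> edges \<Longrightarrow> gene e \<in> free_alg"
  by (auto simp: gene_def edges_def)

lemma sE_eq_emb: "sE e = emb (gene e)"
  by (simp add: sE_def gene_def sO_def split: prod.split)

lemma sE_rules [simp]:
  assumes "e \<in> edges"
  shows "sE e \<in> embs" "adjO (sE e) \<cdot> sE e = qO (etgt e)" "sE e \<cdot> qO (etgt e) = sE e"
    "qO (esrc e) \<cdot> sE e = sE e" "adjO (sE e) \<cdot> qO (esrc e) = adjO (sE e)"
    "qO (etgt e) \<cdot> adjO (sE e) = adjO (sE e)"
  using edgesD(1)[OF assms] by (cases e; simp add: sE_def)+

text \<open>Products are normalized to the right; this applies a relation for x and y when a further
  factor follows.\<close>

lemma mulO_absorb: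
  assumes "x \<cdot> y = w" "x \<in> embs" "y \<in> embs" "z \<in> embs"
  shows "x \<cdot> (y \<cdot> z) = w \<cdot> z"
  using assms mulO_assoc[of x y z] by simp

text \<open>Inserting the vertex projections absorbed by x and y puts q_i q_j in the middle.\<close>

lemma orth_absorb:
  assumes "x \<cdot> qO i = x" "qO j \<cdot> y = y" "i \<noteq> j" "i \<in> V" "j \<in> V" "x \<in> embs" "y \<in> embs"
  shows "x \<cdot> y = zeroO"
proof -
  have "x \<cdot> y = x \<cdot> qO i \<cdot> (qO j \<cdot> y)"
    using assms by simp
  also have "\<dots> = x \<cdot> (qO i \<cdot> qO j \<cdot> y)"
    using assms(4-) by simp
  also have "\<dots> = zeroO"
    using assms by (simp add: qO_orth)
  finally show ?thesis .
qed

lemma sE_orth: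
  assumes "e \<in> edges" "f \<in> edges" "e \<noteq> f"
  shows "adjO (sE e) \<cdot> sE f = zeroO"
proof (cases "esrc e = esrc f")
  case True
  then have "star (gene e) * gene f \<doteq> 0"
    using assms by (intro gene_orth) (auto simp: edges_at_def)
  then show ?thesis
    using assms gene_free_alg by (simp add: sE_eq_emb emb_star emb_mult zeroO_def emb_eq_iff)
next
  case False
  then show ?thesis
    using assms by (intro orth_absorb[of _ "esrc e" "esrc f"]) (auto simp: edgesD)
qed

lemma prodO_Cons: "xs \<noteq> [] \<Longrightarrow> prodO (x # xs) = x \<cdot> prodO xs"
  by (cases xs) auto

lemma prodO_embs: "xs \<noteq> [] \<Longrightarrow> set xs \<subseteq> embs \<Longrightarrow> prodO xs \<in> embs"
  by (induction xs rule: prodO.induct) auto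

lemma upowO_embs [simp]: "i \<in> V \<Longrightarrow> upowO i t \<in> embs"
  by (auto simp: upowO_def intro!: prodO_embs)

lemma upowO_zero [simp]: "upowO i 0 = qO i"
  by (simp add: upowO_def)

lemma upowO_one: "upowO i 1 = uO i" and upowO_minus_one: "upowO i (-1) = adjO (uO i)"
  by (simp_all add: upowO_def)

lemma qO_upowO [simp]:
  assumes "i \<in> V"
  shows "qO i \<cdot> upowO i t = upowO i t"
proof -
  have "qO i \<cdot> prodO (replicate n x) = prodO (replicate n x)"
    if x: "n > 0" "qO i \<cdot> x = x" "x \<in> embs" for n x
  proof (cases "n = 1")
    case False
    then obtain m where "n = Suc m" "m > 0"
      using x(1) by (cases n) auto
    then show ?thesis
      using assms x mulO_absorb[OF x(2), of "prodO (replicate m x)"] prodO_embs[of "replicate m x"]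
      by (simp add: prodO_Cons)
  qed (use x in auto)
  then show ?thesis
    using assms by (auto simp: upowO_def)
qed

lemma qO_upowO_left [simp]:
  "i \<in> V \<Longrightarrow> z \<in> embs \<Longrightarrow> qO i \<cdot> (upowO i t \<cdot> z) = upowO i t \<cdot> z"
  by (rule mulO_absorb) auto

lemma uO_upowO:
  assumes i: "i \<in> V"
  shows "uO i \<cdot> upowO i t = upowO i (t + 1)"
proof -
  \<comment> \<open>The definition of \<open>upowO\<close> changes its form around t = 0. In the
    last case at least one factor is left after cancelling u against its adjoint.\<close>
  consider n where "t = int (Suc n)" | "t = 0" | "t = -1" | n where "t = - int (Suc (Suc n))"
    by (metis int_cases3 add.inverse_inverse gr0_implies_Suc of_nat_0_less_iff of_nat_1 One_nat_def not0_implies_Suc zero_less_Suc)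
  then show ?thesis
  proof cases
    case (1 n)
    then have "nat (t + 1) = Suc (Suc n)" "nat t = Suc n" "t > 0"
      by auto
    then show ?thesis
      by (simp add: upowO_def)
  next
    case (4 n)
    then have t: "upowO i t = adjO (uO i) \<cdot> prodO (replicate (Suc n) (adjO (uO i)))"
      by (simp add: upowO_def nat_add_distrib)
    have t1: "upowO i (t + 1) = prodO (replicate (Suc n) (adjO (uO i)))"
      using 4 by (simp add: upowO_def nat_add_distrib)
    have "uO i \<cdot> (adjO (uO i) \<cdot> upowO i (t + 1)) = qO i \<cdot> upowO i (t + 1)"
      using i by (intro mulO_absorb) auto
    then show ?thesis
      using i unfolding t t1 qO_upowO[OF i, of "t + 1", unfolded t1] by simp
  qed (use i in \<open>simp_all add: upowO_one upowO_minus_one\<close>)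
qed

lemma adj_uO_upowO:
  assumes i: "i \<in> V"
  shows "adjO (uO i) \<cdot> upowO i t = upowO i (t - 1)"
proof -
  have "adjO (uO i) \<cdot> (uO i \<cdot> upowO i (t - 1)) = qO i \<cdot> upowO i (t - 1)"
    using i by (intro mulO_absorb) auto
  then show ?thesis
    using i by (simp add: uO_upowO)
qed

lemma upowO_add:
  assumes i: "i \<in> V"
  shows "upowO i s \<cdot> upowO i t = upowO i (s + t)"
proof (induction s rule: int_induct[of _ 0])
  case (step1 s)
  have "upowO i (s + 1) \<cdot> upowO i t = uO i \<cdot> (upowO i s \<cdot> upowO i t)"
    using i by (simp add: uO_upowO[symmetric])
  then show ?case
    using i step1 by (simp add: uO_upowO algebra_simps)
next
  case (step2 s)
  have "upowO i (s - 1) \<cdot> upowO i t = adjO (uO i) \<cdot> (upowO i s \<cdot> upowO i t)"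
    using i by (simp add: adj_uO_upowO[symmetric])
  then show ?case
    using i step2 by (simp add: adj_uO_upowO algebra_simps)
qed (use i in simp)

lemma upowO_qO [simp]: "i \<in> V \<Longrightarrow> upowO i t \<cdot> qO i = upowO i t"
  using upowO_add[of i t 0] by simp

lemma adj_upowO [simp]:
  assumes i: "i \<in> V"
  shows "adjO (upowO i t) = upowO i (- t)"
proof (induction t rule: int_induct[of _ 0])
  case (step1 t)
  have "adjO (upowO i (t + 1)) = adjO (upowO i t) \<cdot> upowO i (-1)"
    using i by (simp add: uO_upowO[symmetric] upowO_minus_one)
  then show ?case
    using i step1 upowO_add[of i "- t" "-1"] by simp
next
  case (step2 t)
  have "adjO (upowO i (t - 1)) = adjO (upowO i t) \<cdot> upowO i 1"
    using i by (simp add: adj_uO_upowO[symmetric] upowO_one)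
  then show ?case
    using i step2 upowO_add[of i "- t" "1"] by simp
qed (use i in simp)

lemma upowO_sO:
  assumes ij: "(i, j) \<in> Omega"
  shows "upowO i t \<cdot> sO i j n = sO i j (n + t * B i j)"
proof -
  note i = OmegaD(1)[OF ij]
  \<comment> \<open>\<open>sO i j m\<close> is u_i times \<open>sO i j (m - B i j)\<close>, and
    u_i^* u_i is absorbed.\<close>
  have adj: "adjO (uO i) \<cdot> sO i j m = sO i j (m - B i j)" for m
    using mulO_absorb[of "adjO (uO i)" "uO i" "qO i" "sO i j (m - B i j)"] i ij by (simp add: uO_sO)
  show ?thesis
  proof (induction t rule: int_induct[of _ 0])
    case (step1 t)
    have "upowO i (t + 1) \<cdot> sO i j n = uO i \<cdot> (upowO i t \<cdot> sO i j n)"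
      using i ij by (simp add: uO_upowO[symmetric])
    then show ?case
      using ij step1 by (simp add: uO_sO algebra_simps)
  next
    case (step2 t)
    have "upowO i (t - 1) \<cdot> sO i j n = adjO (uO i) \<cdot> (upowO i t \<cdot> sO i j n)"
      using i ij by (simp add: adj_uO_upowO[symmetric])
    then show ?case
      using ij step2 by (simp add: adj algebra_simps)
  qed (use ij in simp)
qed

lemma sO_upowO:
  assumes ij: "(i, j) \<in> Omega"
  shows "sO i j n \<cdot> upowO j t = sO i j (n + t * int (A i j))"
proof -
  note j = OmegaD(2)[OF ij]
  have adj: "sO i j m \<cdot> adjO (uO j) = sO i j (m - int (A i j))" for m
    using mulO_assoc[of "sO i j (m - int (A i j))" "uO j" "adjO (uO j)"] j ij by (simp add: sO_uO)
  show ?thesis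
  proof (induction t arbitrary: n rule: int_induct[of _ 0])
    case (step1 t)
    have "sO i j n \<cdot> upowO j (t + 1) = (sO i j n \<cdot> uO j) \<cdot> upowO j t"
      using j ij by (simp add: uO_upowO)
    then show ?case
      using ij step1 by (simp add: sO_uO algebra_simps)
  next
    case (step2 t)
    have "sO i j n \<cdot> upowO j (t - 1) = (sO i j n \<cdot> adjO (uO j)) \<cdot> upowO j t"
      using j ij by (simp add: adj_uO_upowO)
    then show ?case
      using ij step2 by (simp add: adj algebra_simps)
  qed (use ij in simp)
qed

section \<open>Carrying a power of u along a finite path\<close>

text \<open>Uniqueness in the division by A with remainder between 1 and A: two such remainders
  differ by less than A, so they coincide if A divides their difference.\<close>

lemma carry_eqI:
  assumes "n + t * B i j = m + k * int (A i j)" "1 \<le> m" "m \<le> int (A i j)"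
  shows "carry t (i, j, n) = (m, k)"
  unfolding carry_def prod.case
proof (rule the_equality)
  show "case (m, k) of (m, k) \<Rightarrow> n + t * B i j = m + k * int (A i j) \<and> 1 \<le> m \<and> m \<le> int (A i j)"
    using assms by simp
next
  fix mk :: "int \<times> int"
  assume *: "case mk of (m, k) \<Rightarrow> n + t * B i j = m + k * int (A i j) \<and> 1 \<le> m \<and> m \<le> int (A i j)"
  obtain m' k' where mk: "mk = (m', k')"
    by (cases mk)
  have eq: "m' - m = (k - k') * int (A i j)" and le: "\<bar>m' - m\<bar> < int (A i j)"
    using * assms by (auto simp: mk algebra_simps)
  have "k = k'"
  proof (rule ccontr)
    assume "k \<noteq> k'"
    then have "\<bar>k - k'\<bar> \<ge> 1"
      by simp
    then have "\<bar>k - k'\<bar> * int (A i j) \<ge> 1 * int (A i j)"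
      by (intro mult_right_mono) auto
    then show False
      using le unfolding eq abs_mult by simp
  qed
  then show "mk = (m, k)"
    using eq mk by simp
qed

lemma carryE:
  assumes "(i, j) \<in> Omega"
  obtains m k where "carry t (i, j, n) = (m, k)" "n + t * B i j = m + k * int (A i j)"
    "1 \<le> m" "m \<le> int (A i j)" "(i, j, m) \<in> edges"
proof -
  define a where "a = int (A i j)"
  \<comment> \<open>Remainders run from 1 to A instead of from 0 to A - 1, hence the shift by one
    before applying \<open>div\<close> and \<open>mod\<close>.\<close>
  define z where "z = n + t * B i j - 1"
  have a: "a > 0"
    using OmegaD(3)[OF assms] by (simp add: a_def)
  have "z = z mod a + (z div a) * a"
    by simp
  then have eq: "n + t * B i j = (z mod a + 1) + (z div a) * int (A i j)"
    unfolding z_def[symmetric] a_def[symmetric] by (simp add: z_def)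
  have le: "1 \<le> z mod a + 1" "z mod a + 1 \<le> int (A i j)"
    using a pos_mod_bound[OF a, of z] pos_mod_sign[OF a, of z] unfolding a_def[symmetric] by (auto simp del: pos_mod_sign pos_mod_bound)
  show thesis
    using that[OF carry_eqI[OF eq le] eq le] le assms by (simp add: edges_def)
qed

lemma upowO_sO_carry:
  assumes "(i, j) \<in> Omega" "carry t (i, j, n) = (m, k)"
  shows "upowO i t \<cdot> sO i j n = sO i j m \<cdot> upowO j k"
proof -
  obtain m' k' where "carry t (i, j, n) = (m', k')" "n + t * B i j = m' + k' * int (A i j)"
    using carryE[OF assms(1)] by metis
  then show ?thesis
    using assms(2) by (simp add: upowO_sO[OF assms(1)] sO_upowO[OF assms(1)])
qed

text \<open>The action of a power of u on a finite path, with the power that is carried over.\<close>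

fun act_fin :: "int \<Rightarrow> edge list \<Rightarrow> edge list \<times> int" where
  "act_fin t [] = ([], t)"
| "act_fin t (e # J) = (let (m, k) = carry t e; (J', c) = act_fin k J in ((esrc e, etgt e, m) # J', c))"

text \<open>The vertex argument supplies the source of the path of length zero, which as a list does
  not know its vertex.\<close>

definition psrc :: "edge list \<Rightarrow> nat \<Rightarrow> nat" where
  "psrc I i = (if I = [] then i else esrc (hd I))"

lemma psrc_simps [simp]: "psrc [] i = i" "psrc (e # I) i = esrc e"
  by (simp_all add: psrc_def)

lemma path_to_Nil [simp]: "path_to [] i \<longleftrightarrow> i \<in> V"
  by (simp add: path_to_def)

lemma path_to_Cons: "path_to (e # I) i \<longleftrightarrow> e \<in> edges \<and> path_to I i \<and> etgt e = psrc I i"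
  by (cases I) (auto simp: path_to_def edgesD)

lemma path_to_append: "path_to (I @ K) i \<longleftrightarrow> path_to K i \<and> path_to I (psrc K i)"
proof -
  have "path_to K i \<Longrightarrow> psrc K i \<in> V"
    by (cases K) (auto simp: path_to_Cons edgesD)
  moreover have "psrc (I @ K) i = psrc I (psrc K i)" for I
    by (cases I) auto
  ultimately show ?thesis
    by (induction I) (auto simp: path_to_Cons)
qed

lemma psrc_append [simp]: "psrc (I @ K) i = psrc I (psrc K i)"
  by (cases I) auto

lemma path_toD: "path_to I i \<Longrightarrow> i \<in> V" "path_to I i \<Longrightarrow> psrc I i \<in> V"
  by (simp add: path_to_def, cases I) (auto simp: path_to_Cons edgesD)

lemma sprodO_Nil [simp]: "sprodO [] i = qO i"
  by (simp add: sprodO_def)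

lemma sprodO_Cons:
  assumes "path_to (e # I) i"
  shows "sprodO (e # I) i = sE e \<cdot> sprodO I i"
  using assms
  by (cases I) (auto simp: sprodO_def sE_def path_to_Cons edges_def)

lemma sprodO_embs [simp]: "path_to I i \<Longrightarrow> sprodO I i \<in> embs"
  by (induction I) (auto simp: sprodO_Cons path_to_Cons)

lemma sprodO_qO [simp]: "path_to I i \<Longrightarrow> sprodO I i \<cdot> qO i = sprodO I i"
proof (induction I)
  case (Cons e I)
  then show ?case
    using path_toD(1)[of I i] by (simp add: sprodO_Cons path_to_Cons)
qed auto

lemma qO_sprodO [simp]: "path_to I i \<Longrightarrow> qO (psrc I i) \<cdot> sprodO I i = sprodO I i"
proof (induction I)
  case (Cons e I)
  then show ?case
    by (simp add: sprodO_Cons path_to_Cons edgesD mulO_absorb)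
qed auto

lemma qO_adj_sprodO [simp]: "path_to I i \<Longrightarrow> qO i \<cdot> adjO (sprodO I i) = adjO (sprodO I i)"
  using adjO_mul[of "sprodO I i" "qO i"] by (simp add: path_toD)

lemma sprodO_source [simp]: "path_to I i \<Longrightarrow> adjO (sprodO I i) \<cdot> sprodO I i = qO i"
proof (induction I)
  case (Cons e I)
  then have e: "e \<in> edges" "path_to I i" "etgt e = psrc I i"
    by (auto simp: path_to_Cons)
  have "adjO (sprodO (e # I) i) \<cdot> sprodO (e # I) i
    = adjO (sprodO I i) \<cdot> (adjO (sE e) \<cdot> (sE e \<cdot> sprodO I i))"
    using e Cons.prems by (simp add: sprodO_Cons)
  also have "adjO (sE e) \<cdot> (sE e \<cdot> sprodO I i) = qO (etgt e) \<cdot> sprodO I i"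
    using e by (intro mulO_absorb) auto
  finally show ?case
    using e Cons.IH by simp
qed auto

lemma sprodO_append:
  assumes "path_to (I @ K) i"
  shows "sprodO (I @ K) i = sprodO I (psrc K i) \<cdot> sprodO K i"
  using assms
proof (induction I)
  case (Cons e I)
  then show ?case
    using sprodO_embs[of I "psrc K i"] sprodO_embs[of K i]
    by (auto simp: sprodO_Cons path_to_Cons path_to_append)
qed auto

text \<open>Each edge is passed by \<open>upowO_sO_carry\<close>; the carry becomes the power that
  acts on the rest of the path.\<close>

lemma act_fin_path:
  assumes "path_to I i" "act_fin t I = (I', c)"
  shows "path_to I' i" "psrc I' i = psrc I i"
    "upowO (psrc I i) t \<cdot> sprodO I i = sprodO I' i \<cdot> upowO i c"
proof -
  have "path_to I' i \<and> psrc I' i = psrc I i \<and>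
    upowO (psrc I i) t \<cdot> sprodO I i = sprodO I' i \<cdot> upowO i c"
    using assms
  proof (induction I arbitrary: t I' c)
    case (Cons e I)
    obtain a b n where e: "e = (a, b, n)"
      by (cases e)
    have path: "path_to I i" "psrc I i = b" "(a, b) \<in> Omega" and i: "i \<in> V" "b \<in> V" "a \<in> V"
      using Cons.prems(1) path_toD(1)[of I i] OmegaD by (auto simp: path_to_Cons edges_def e)
    obtain m k where mk: "carry t (a, b, n) = (m, k)" "(a, b, m) \<in> edges"
      using carryE[OF path(3)] by metis
    obtain J' where J': "act_fin k I = (J', c)" "I' = (a, b, m) # J'"
      using Cons.prems(2) mk by (auto simp: e split: prod.splits)
    from Cons.IH[OF path(1) J'(1)] path have IH: "path_to J' i" "psrc J' i = b"
      "upowO b k \<cdot> sprodO I i = sprodO J' i \<cdot> upowO i c"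
      by auto
    have I': "path_to I' i"
      using IH mk by (simp add: J' path_to_Cons)
    have "upowO a t \<cdot> (sO a b n \<cdot> sprodO I i) = (sO a b m \<cdot> upowO b k) \<cdot> sprodO I i"
      using i path upowO_sO_carry[OF path(3) mk(1)] by (intro mulO_absorb) auto
    also have "\<dots> = sO a b m \<cdot> (sprodO J' i \<cdot> upowO i c)"
      using path i IH by simp
    also have "\<dots> = sprodO I' i \<cdot> upowO i c"
      using I' path i IH by (simp add: sprodO_Cons J' sE_def)
    finally have "upowO a t \<cdot> (sO a b n \<cdot> sprodO I i) = sprodO I' i \<cdot> upowO i c" .
    then show ?case
      using I' Cons.prems(1) by (simp add: e sprodO_Cons J' sE_def)
  qed auto
  then show "path_to I' i" "psrc I' i = psrc I i"
    "upowO (psrc I i) t \<cdot> sprodO I i = sprodO I' i \<cdot> upowO i c"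
    by auto
qed

definition stdO :: "edge list \<Rightarrow> nat \<Rightarrow> int \<Rightarrow> edge list \<Rightarrow> (nat \<Rightarrow> falg) set" where
  "stdO I i t J = sprodO I i \<cdot> upowO i t \<cdot> adjO (sprodO J i)"

definition stds :: "(nat \<Rightarrow> falg) set set" where
  "stds = insert zeroO {stdO I i t J | I i t J. path_to I i \<and> path_to J i}"

lemma stdO_embs [simp]: "path_to I i \<Longrightarrow> path_to J i \<Longrightarrow> stdO I i t J \<in> embs"
  by (simp add: stdO_def path_toD)

lemma stdsI: "path_to I i \<Longrightarrow> path_to J i \<Longrightarrow> stdO I i t J \<in> stds"
  by (auto simp: stds_def)

lemma stds_embs [simp]: "x \<in> stds \<Longrightarrow> x \<in> embs"
  by (auto simp: stds_def)

text \<open>If the vertices match, the power moves through s_I and joins the one in the middle.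
  Otherwise two orthogonal vertex projections meet and the product is zero.\<close>

lemma upowO_stds:
  assumes k: "k \<in> V" and x: "x \<in> stds"
  shows "upowO k t \<cdot> x \<in> stds"
proof (cases "x = zeroO")
  case True
  then show ?thesis
    using k by (simp add: stds_def)
next
  case False
  then obtain I i r J where x: "x = stdO I i r J" "path_to I i" "path_to J i"
    using x by (auto simp: stds_def)
  have i: "i \<in> V"
    using x path_toD by blast
  have eq: "upowO k t \<cdot> x = upowO k t \<cdot> sprodO I i \<cdot> (upowO i r \<cdot> adjO (sprodO J i))"
    using x i k by (simp add: stdO_def)
  show ?thesis
  proof (cases "psrc I i = k")
    case True
    obtain I' c where I': "act_fin t I = (I', c)"
      by fastforce
    have "upowO k t \<cdot> x = sprodO I' i \<cdot> upowO i c \<cdot> (upowO i r \<cdot> adjO (sprodO J i))"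
      using eq act_fin_path[OF x(2) I'] True by simp
    also have "\<dots> = stdO I' i (c + r) J"
      using act_fin_path(1)[OF x(2) I'] x i by (simp add: stdO_def upowO_add[symmetric])
    finally show ?thesis
      using act_fin_path(1)[OF x(2) I'] x by (simp add: stdsI)
  next
    case False
    then have "upowO k t \<cdot> sprodO I i = zeroO"
      using x k by (intro orth_absorb[of _ k "psrc I i"]) (auto simp: path_toD)
    then show ?thesis
      using eq x i by (simp add: stds_def)
  qed
qed

lemma sE_stds:
  assumes e: "e \<in> edges" and x: "x \<in> stds"
  shows "sE e \<cdot> x \<in> stds"
proof (cases "x = zeroO")
  case True
  then show ?thesis
    using e by (simp add: stds_def)
next
  case False
  then obtain I i r J where x: "x = stdO I i r J" "path_to I i" "path_to J i"
    using x by (auto simp: stds_def)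
  have i: "i \<in> V"
    using x path_toD by blast
  have eq: "sE e \<cdot> x = sE e \<cdot> sprodO I i \<cdot> (upowO i r \<cdot> adjO (sprodO J i))"
    using x i e by (simp add: stdO_def)
  show ?thesis
  proof (cases "psrc I i = etgt e")
    case True
    then have "path_to (e # I) i"
      using x e by (simp add: path_to_Cons)
    moreover from this have "sE e \<cdot> x = stdO (e # I) i r J"
      using x i e by (simp add: stdO_def sprodO_Cons)
    ultimately show ?thesis
      using x by (simp add: stdsI)
  next
    case False
    then have "sE e \<cdot> sprodO I i = zeroO"
      using x e by (intro orth_absorb[of _ "etgt e" "psrc I i"]) (auto simp: path_toD edgesD)
    then show ?thesis
      using eq x i by (simp add: stds_def)
  qed
qed

lemma adj_sE_stds:
  assumes e: "e \<in> edges" and x: "x \<in> stds"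
  shows "adjO (sE e) \<cdot> x \<in> stds"
proof (cases "x = zeroO")
  case True
  then show ?thesis
    using e by (simp add: stds_def)
next
  case False
  then obtain I i t J where x: "x = stdO I i t J" "path_to I i" "path_to J i"
    using x by (auto simp: stds_def)
  have i: "i \<in> V"
    using x path_toD by blast
  have zero: ?thesis if "adjO (sE e) \<cdot> sprodO I i = zeroO"
  proof -
    have "adjO (sE e) \<cdot> x = adjO (sE e) \<cdot> sprodO I i \<cdot> (upowO i t \<cdot> adjO (sprodO J i))"
      using x i e by (simp add: stdO_def)
    then show ?thesis
      unfolding that using x i by (simp add: stds_def)
  qed
  show ?thesis
  \<comment> \<open>If I starts with an edge f, then s_e^* s_f is a vertex projection or zero by
    orthogonality. If I is empty, s_e^* meets the power of u directly.\<close>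
  proof (cases I)
    case (Cons f I1)
    then have f: "f \<in> edges" "path_to I1 i" "etgt f = psrc I1 i"
      using x by (auto simp: path_to_Cons)
    have I: "adjO (sE e) \<cdot> sprodO I i = (adjO (sE e) \<cdot> sE f) \<cdot> sprodO I1 i"
      using x e f by (simp add: Cons sprodO_Cons)
    show ?thesis
    proof (cases "e = f")
      case True
      then have "adjO (sE e) \<cdot> sprodO I i = sprodO I1 i"
        using I f by simp
      then have "adjO (sE e) \<cdot> x = stdO I1 i t J"
        using mulO_absorb[of "adjO (sE e)" "sprodO I i" "sprodO I1 i" "upowO i t \<cdot> adjO (sprodO J i)"]
          x i e f by (simp add: stdO_def)
      then show ?thesis
        using f x by (simp add: stdsI)
    next
      case False
      then show ?thesis
        using I e f by (intro zero) (simp add: sE_orth)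
    qed
  next
    case Nil
    show ?thesis
    proof (cases "esrc e = i")
      case True
      obtain b n where eb: "e = (i, b, n)" and ib: "(i, b) \<in> Omega"
        using e True by (cases e) (auto simp: edges_def)
      have b: "b \<in> V"
        using OmegaD[OF ib] by simp
      \<comment> \<open>s_e^* u^t is the adjoint of u^(-t) s_e, in which the power can be carried
        past the edge. The resulting edge f is then appended to J.\<close>
      obtain m k where mk: "carry (- t) (i, b, n) = (m, k)" "(i, b, m) \<in> edges"
        using carryE[OF ib] by metis
      define f where "f = (i, b, m)"
      have f: "f \<in> edges" "etgt f = b" "esrc f = i"
        using mk by (auto simp: f_def)
      have "adjO (sE e) \<cdot> upowO i t = adjO (upowO i (- t) \<cdot> sE e)"
        using i e by simp
      also have "\<dots> = adjO (sE f \<cdot> upowO b k)"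
        using upowO_sO_carry[OF ib mk(1)] by (simp add: f_def eb sE_def)
      also have "\<dots> = upowO b (- k) \<cdot> adjO (sE f)"
        using f b by simp
      finally have 1: "adjO (sE e) \<cdot> upowO i t = upowO b (- k) \<cdot> adjO (sE f)" .
      have J: "path_to (J @ [f]) b"
        using x f b by (simp add: path_to_append path_to_Cons)
      have "adjO (sE e) \<cdot> x = adjO (sE e) \<cdot> upowO i t \<cdot> adjO (sprodO J i)"
        using x e i by (simp add: stdO_def Nil)
      also have "\<dots> = upowO b (- k) \<cdot> (adjO (sE f) \<cdot> adjO (sprodO J i))"
        unfolding 1 using b f x by simp
      also have "adjO (sE f) \<cdot> adjO (sprodO J i) = adjO (sprodO (J @ [f]) b)"
        using J x f b sE_rules(3)[OF f(1)] by (simp add: sprodO_append sprodO_Cons path_to_Cons)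
      also have "upowO b (- k) \<cdot> adjO (sprodO (J @ [f]) b) = stdO [] b (- k) (J @ [f])"
        using J b by (simp add: stdO_def)
      finally show ?thesis
        using J b by (simp add: stdsI)
    next
      case False
      then show ?thesis
        using e i Nil by (intro zero orth_absorb[of _ "esrc e" i]) (auto simp: edgesD)
    qed
  qed
qed

text \<open>Reduces the index modulo A into the range of the edges; the quotient becomes a power of
  u.\<close>

lemma sO_eq:
  assumes "(i, j) \<in> Omega"
  obtains e k where "e \<in> edges" "esrc e = i" "etgt e = j" "sO i j n = sE e \<cdot> upowO j k"
proof -
  obtain m k where mk: "carry 0 (i, j, n) = (m, k)" "(i, j, m) \<in> edges"
    using carryE[OF assms] by metis
  then have "sO i j n = sE (i, j, m) \<cdot> upowO j k"
    using upowO_sO_carry[OF assms mk(1)] assms by (simp add: sE_def OmegaD)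
  then show thesis
    using that mk by force
qed

lemma qO_stds: "i \<in> V \<Longrightarrow> qO i \<in> stds"
  using stdsI[of "[]" i "[]" 0] by (simp add: stdO_def)

text \<open>Membership is proved together with stability of \<open>stds\<close> under left
  multiplication by x, which the product case needs for its left factor. For generators membership
  follows from stability, since x = x q_i and q_i lies in \<open>stds\<close>.\<close>

lemma S_AB_stds:
  assumes "x \<in> S_AB"
  shows "x \<in> stds" and "y \<in> stds \<Longrightarrow> x \<cdot> y \<in> stds"
proof -
  have base: "x \<in> stds \<and> (\<forall>y\<in>stds. x \<cdot> y \<in> stds)"
    if "\<And>y. y \<in> stds \<Longrightarrow> x \<cdot> y \<in> stds" "x \<cdot> qO i = x" "i \<in> V" for x i
    using that(1)[OF qO_stds[OF that(3)]] that by auto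
  have "x \<in> stds \<and> (\<forall>y\<in>stds. x \<cdot> y \<in> stds)"
    using assms
  proof induction
    case 1
    then show ?case
      by (auto simp: stds_def)
  next
    case (2 i)
    show ?case
      using upowO_stds[of i _ 1] 2 by (intro base[of _ i]) (auto simp: upowO_one)
  next
    case (3 i)
    show ?case
      using upowO_stds[of i _ "-1"] 3 by (intro base[of _ i]) (auto simp: upowO_minus_one)
  next
    case (4 i j n)
    then obtain e k where e: "e \<in> edges" "etgt e = j" "sO i j n = sE e \<cdot> upowO j k"
      by (rule sO_eq)
    show ?case
    proof (rule base[of _ j])
      fix y
      assume "y \<in> stds"
      then show "sO i j n \<cdot> y \<in> stds"
        using e sE_stds upowO_stds[of j y k] OmegaD(2)[OF 4] by simp
    qed (use 4 OmegaD in auto)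
  next
    case (5 i j n)
    then obtain e k where e: "e \<in> edges" "etgt e = j" "sO i j n = sE e \<cdot> upowO j k"
      by (rule sO_eq)
    show ?case
    proof (rule base[of _ i])
      fix y
      assume "y \<in> stds"
      then show "adjO (sO i j n) \<cdot> y \<in> stds"
        using e adj_sE_stds[of e y] upowO_stds[of j _ "- k"] OmegaD(2)[OF 5] by simp
    qed (use 5 OmegaD in auto)
  next
    case (6 x y)
    then have "x \<in> embs" "y \<in> embs"
      by auto
    then show ?case
      using 6 by auto
  qed
  then show "x \<in> stds" "y \<in> stds \<Longrightarrow> x \<cdot> y \<in> stds"
    by auto
qed

lemma S_AB_embs [simp]: "x \<in> S_AB \<Longrightarrow> x \<in> embs"
  by (intro stds_embs S_AB_stds)

lemma S_AB_adj: "x \<in> S_AB \<Longrightarrow> adjO x \<in> S_AB"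
  by (induction rule: S_AB.induct) (auto intro: S_AB.intros simp: OmegaD)

lemma S_AB_sprodO: "path_to I i \<Longrightarrow> sprodO I i \<in> S_AB"
proof (induction I)
  case Nil
  then show ?case
    using S_AB.intros(6)[OF S_AB.intros(2,3), of i i] by simp
next
  case (Cons e I)
  then show ?case
    by (auto simp: sprodO_Cons path_to_Cons edges_def sE_def intro!: S_AB.intros)
qed

section \<open>Source projections and conjugates of range projections\<close>

text \<open>The elements at which \<open>ev\<close> is evaluated: the image of \<open>E\<close>
  under \<open>img\<close>, which is seen to contain s^* s and s^* x s.\<close>

definition projs :: "(nat \<Rightarrow> falg) set set" where
  "projs = insert zeroO {sprodO K k \<cdot> adjO (sprodO K k) | K k. path_to K k}"

lemma stdO_source:
  assumes "path_to I i" "path_to J i"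
  shows "adjO (stdO I i t J) \<cdot> stdO I i t J = sprodO J i \<cdot> adjO (sprodO J i)"
proof -
  have i: "i \<in> V"
    using assms path_toD by blast
  have "adjO (stdO I i t J) \<cdot> stdO I i t J
    = sprodO J i \<cdot> (upowO i (- t) \<cdot> ((adjO (sprodO I i) \<cdot> sprodO I i) \<cdot> (upowO i t \<cdot> adjO (sprodO J i))))"
    using assms i by (simp add: stdO_def del: sprodO_source)
  also have "\<dots> = sprodO J i \<cdot> (upowO i (- t) \<cdot> (qO i \<cdot> upowO i t \<cdot> adjO (sprodO J i)))"
    using assms i by simp
  also have "\<dots> = sprodO J i \<cdot> (upowO i (- t) \<cdot> upowO i t \<cdot> adjO (sprodO J i))"
    using assms i by simp
  also have "\<dots> = sprodO J i \<cdot> adjO (sprodO J i)"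
    using assms by (simp only: upowO_add[OF i] upowO_zero left_minus qO_adj_sprodO)
  finally show ?thesis .
qed

lemma projs_source:
  assumes "x \<in> S_AB"
  shows "adjO x \<cdot> x \<in> projs"
  using S_AB_stds(1)[OF assms] stdO_source by (fastforce simp: stds_def projs_def)

text \<open>For a = s_K s_K^* the conjugate is y^* y with y = s_K^* x, hence again a source
  projection.\<close>

lemma projs_conj:
  assumes x: "x \<in> S_AB" and a: "a \<in> projs"
  shows "adjO x \<cdot> a \<cdot> x \<in> projs"
proof (cases "a = zeroO")
  case True
  then show ?thesis
    using x by (simp add: projs_def)
next
  case False
  then obtain K k where K: "path_to K k" "a = sprodO K k \<cdot> adjO (sprodO K k)"
    using a by (auto simp: projs_def)
  define y where "y = adjO (sprodO K k) \<cdot> x"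
  have "y \<in> S_AB"
    unfolding y_def using x K by (intro S_AB.intros(6) S_AB_adj S_AB_sprodO)
  moreover have "adjO x \<cdot> a \<cdot> x = adjO y \<cdot> y"
    using x K by (simp add: y_def)
  ultimately show ?thesis
    using projs_source by simp
qed

end

section \<open>Seminorms from partial bijections\<close>

text \<open>The finitely supported vectors form a dense subspace of the l2 space; operator norms can
  be computed on it with finite sums only.\<close>

definition fin_supp :: "('x \<Rightarrow> complex) \<Rightarrow> bool" where
  "fin_supp f \<longleftrightarrow> finite {\<gamma>. f \<gamma> \<noteq> 0}"

definition l2norm :: "('x \<Rightarrow> complex) \<Rightarrow> real" where
  "l2norm f = L2_set (\<lambda>\<gamma>. cmod (f \<gamma>)) {\<gamma>. f \<gamma> \<noteq> 0}"

definition l2inner :: "('x \<Rightarrow> complex) \<Rightarrow> ('x \<Rightarrow> complex) \<Rightarrow> complex" where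
  "l2inner f g = (\<Sum>\<gamma> | f \<gamma> \<noteq> 0. f \<gamma> * cnj (g \<gamma>))"

lemma l2norm_eq:
  assumes "finite S" "{\<gamma>. f \<gamma> \<noteq> 0} \<subseteq> S"
  shows "l2norm f = L2_set (\<lambda>\<gamma>. cmod (f \<gamma>)) S"
  unfolding l2norm_def L2_set_def
  using assms by (intro arg_cong[where f = sqrt] sum.mono_neutral_left) auto

lemma l2inner_eq:
  assumes "finite S" "{\<gamma>. f \<gamma> \<noteq> 0} \<subseteq> S"
  shows "l2inner f g = (\<Sum>\<gamma>\<in>S. f \<gamma> * cnj (g \<gamma>))"
  unfolding l2inner_def using assms by (intro sum.mono_neutral_left) auto

lemma fin_supp_zero [simp]: "fin_supp (\<lambda>_. 0)"
  by (simp add: fin_supp_def)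

lemma fin_supp_add: "fin_supp f \<Longrightarrow> fin_supp g \<Longrightarrow> fin_supp (\<lambda>\<gamma>. f \<gamma> + g \<gamma>)"
  unfolding fin_supp_def
  by (rule finite_subset[of _ "{\<gamma>. f \<gamma> \<noteq> 0} \<union> {\<gamma>. g \<gamma> \<noteq> 0}"]) auto

lemma fin_supp_scale: "fin_supp f \<Longrightarrow> fin_supp (\<lambda>\<gamma>. c * f \<gamma>)"
  unfolding fin_supp_def by (rule finite_subset[of _ "{\<gamma>. f \<gamma> \<noteq> 0}"]) auto

lemma l2norm_nonneg [simp]: "0 \<le> l2norm f"
  by (simp add: l2norm_def L2_set_nonneg)

lemma l2norm_zero [simp]: "l2norm (\<lambda>_. 0) = 0"
  by (simp add: l2norm_def)

lemma l2norm_eq_0: "fin_supp f \<Longrightarrow> l2norm f = 0 \<Longrightarrow> f = (\<lambda>_. 0)"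
  by (auto simp: l2norm_def fin_supp_def L2_set_eq_0_iff)

lemma l2norm_add:
  assumes "fin_supp f" "fin_supp g"
  shows "l2norm (\<lambda>\<gamma>. f \<gamma> + g \<gamma>) \<le> l2norm f + l2norm g"
proof -
  define S where "S = {\<gamma>. f \<gamma> \<noteq> 0} \<union> {\<gamma>. g \<gamma> \<noteq> 0}"
  have S: "finite S" "{\<gamma>. f \<gamma> \<noteq> 0} \<subseteq> S" "{\<gamma>. g \<gamma> \<noteq> 0} \<subseteq> S" "{\<gamma>. f \<gamma> + g \<gamma> \<noteq> 0} \<subseteq> S"
    using assms by (auto simp: S_def fin_supp_def)
  have "L2_set (\<lambda>\<gamma>. cmod (f \<gamma> + g \<gamma>)) S \<le> L2_set (\<lambda>\<gamma>. cmod (f \<gamma>) + cmod (g \<gamma>)) S"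
    by (intro L2_set_mono norm_triangle_ineq) auto
  also have "\<dots> \<le> L2_set (\<lambda>\<gamma>. cmod (f \<gamma>)) S + L2_set (\<lambda>\<gamma>. cmod (g \<gamma>)) S"
    by (rule L2_set_triangle_ineq)
  finally show ?thesis
    using S by (simp add: l2norm_eq[of S])
qed

lemma l2norm_scale:
  assumes "fin_supp f"
  shows "l2norm (\<lambda>\<gamma>. c * f \<gamma>) = cmod c * l2norm f"
proof -
  have S: "finite {\<gamma>. f \<gamma> \<noteq> 0}" "{\<gamma>. c * f \<gamma> \<noteq> 0} \<subseteq> {\<gamma>. f \<gamma> \<noteq> 0}"
    using assms by (auto simp: fin_supp_def)
  show ?thesis
    unfolding l2norm_eq[OF S] by (simp add: norm_mult l2norm_def L2_set_right_distrib)
qed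

lemma l2inner_self: "fin_supp f \<Longrightarrow> l2inner f f = of_real ((l2norm f)\<^sup>2)"
  by (simp add: l2inner_def l2norm_def L2_set_def sum_nonneg flip: complex_norm_square)

lemma l2inner_le:
  assumes "fin_supp f" "fin_supp g"
  shows "cmod (l2inner f g) \<le> l2norm f * l2norm g"
proof -
  define S where "S = {\<gamma>. f \<gamma> \<noteq> 0} \<union> {\<gamma>. g \<gamma> \<noteq> 0}"
  have S: "finite S" "{\<gamma>. f \<gamma> \<noteq> 0} \<subseteq> S" "{\<gamma>. g \<gamma> \<noteq> 0} \<subseteq> S"
    using assms by (auto simp: S_def fin_supp_def)
  have "cmod (l2inner f g) \<le> (\<Sum>\<gamma>\<in>S. \<bar>cmod (f \<gamma>)\<bar> * \<bar>cmod (g \<gamma>)\<bar>)"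
    unfolding l2inner_eq[OF S(1,2)] by (rule order_trans[OF norm_sum]) (simp add: norm_mult)
  also have "\<dots> \<le> L2_set (\<lambda>\<gamma>. cmod (f \<gamma>)) S * L2_set (\<lambda>\<gamma>. cmod (g \<gamma>)) S"
    by (rule L2_set_mult_ineq)
  finally show ?thesis
    using S by (simp add: l2norm_eq[of S])
qed

lemma l2inner_add_left:
  assumes "fin_supp f" "fin_supp f'"
  shows "l2inner (\<lambda>\<gamma>. f \<gamma> + f' \<gamma>) g = l2inner f g + l2inner f' g"
proof -
  define S where "S = {\<gamma>. f \<gamma> \<noteq> 0} \<union> {\<gamma>. f' \<gamma> \<noteq> 0}"
  have S: "finite S" "{\<gamma>. f \<gamma> \<noteq> 0} \<subseteq> S" "{\<gamma>. f' \<gamma> \<noteq> 0} \<subseteq> S" "{\<gamma>. f \<gamma> + f' \<gamma> \<noteq> 0} \<subseteq> S"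
    using assms by (auto simp: S_def fin_supp_def)
  then show ?thesis
    by (simp add: l2inner_eq[of S] sum.distrib algebra_simps)
qed

lemma l2inner_add_right: "l2inner f (\<lambda>\<gamma>. g \<gamma> + g' \<gamma>) = l2inner f g + l2inner f g'"
  by (simp add: l2inner_def sum.distrib algebra_simps)

text \<open>\<open>None\<close> means undefined. The second axiom says that the adjoint word acts as
  the inverse partial map, so every word acts injectively.\<close>

locale partial_rep =
  fixes act :: "fword \<Rightarrow> 'x \<Rightarrow> 'x option"
  assumes act_plus: "act (v + w) \<gamma> = Option.bind (act w \<gamma>) (act v)"
    and act_star: "act (word_star w) \<delta> = Some \<gamma> \<longleftrightarrow> act w \<gamma> = Some \<delta>"
begin

text \<open>The operator that sends the point mass at \<gamma> to the one at w\<gamma>, or to 0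
  where w is undefined; on functions this is composition with the inverse of w.\<close>

definition pull :: "fword \<Rightarrow> ('x \<Rightarrow> complex) \<Rightarrow> 'x \<Rightarrow> complex" where
  "pull w f \<delta> = (case act (word_star w) \<delta> of None \<Rightarrow> 0 | Some \<gamma> \<Rightarrow> f \<gamma>)"

definition rep :: "falg \<Rightarrow> ('x \<Rightarrow> complex) \<Rightarrow> 'x \<Rightarrow> complex" where
  "rep x f \<delta> = (\<Sum>w\<in>Poly_Mapping.keys x. Poly_Mapping.lookup x w * pull w f \<delta>)"

lemma rep_eq:
  assumes "finite K" "Poly_Mapping.keys x \<subseteq> K"
  shows "rep x f \<delta> = (\<Sum>w\<in>K. Poly_Mapping.lookup x w * pull w f \<delta>)"
  unfolding rep_def using assms by (intro sum.mono_neutral_left) (auto simp: in_keys_iff)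

lemma rep_single [simp]: "rep (Poly_Mapping.single w c) f \<delta> = c * pull w f \<delta>"
  by (simp add: rep_eq[of "{w}"])

lemma rep_zero [simp]: "rep 0 f \<delta> = 0"
  by (simp add: rep_def)

lemma rep_add: "rep (x + y) f \<delta> = rep x f \<delta> + rep y f \<delta>"
proof -
  have "finite (Poly_Mapping.keys x \<union> Poly_Mapping.keys y)"
    by simp
  then show ?thesis
    using keys_add[of x y]
    by (simp add: rep_eq[of "Poly_Mapping.keys x \<union> Poly_Mapping.keys y"] lookup_add
        sum.distrib algebra_simps)
qed

lemma rep_scale: "rep (scale c x) f \<delta> = c * rep x f \<delta>"
proof -
  have "Poly_Mapping.keys (scale c x) \<subseteq> Poly_Mapping.keys x"
    by (auto simp: in_keys_iff)
  then show ?thesis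
    by (simp add: rep_eq[of "Poly_Mapping.keys x"] sum_distrib_left algebra_simps)
qed

lemma rep_diff: "rep (x - y) f \<delta> = rep x f \<delta> - rep y f \<delta>"
  using rep_add[of "x - y" y f \<delta>] by simp

lemma rep_sum: "rep (sum g K) f \<delta> = (\<Sum>k\<in>K. rep (g k) f \<delta>)"
  by (induction K rule: infinite_finite_induct) (auto simp: rep_add)

lemma pull_add: "pull w (\<lambda>\<gamma>. f \<gamma> + g \<gamma>) \<delta> = pull w f \<delta> + pull w g \<delta>"
  and pull_scale: "pull w (\<lambda>\<gamma>. c * f \<gamma>) \<delta> = c * pull w f \<delta>"
  by (auto simp: pull_def split: option.split)

lemma pull_plus: "pull (v + w) f = pull v (pull w f)"
proof
  fix \<delta>
  show "pull (v + w) f \<delta> = pull v (pull w f) \<delta>"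
    by (cases "act (word_star v) \<delta>") (auto simp: pull_def word_star_plus act_plus)
qed

lemma rep_vec_add: "rep x (\<lambda>\<gamma>. f \<gamma> + g \<gamma>) \<delta> = rep x f \<delta> + rep x g \<delta>"
  and rep_vec_scale: "rep x (\<lambda>\<gamma>. c * f \<gamma>) \<delta> = c * rep x f \<delta>"
  by (simp_all add: rep_def pull_add pull_scale sum.distrib sum_distrib_left algebra_simps)

lemma rep_mult: "rep (x * y) f = rep x (rep y f)"
proof (induction x rule: falg_induct)
  case (single v c)
  show ?case
  proof (induction y rule: falg_induct)
    case (single w d)
    have "rep (Poly_Mapping.single w d) f = (\<lambda>\<gamma>. d * pull w f \<gamma>)"
      by (rule ext) simp
    then show ?case
      by (intro ext) (simp add: mult_single pull_plus pull_scale mult_ac)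
  next
    case (add y z)
    have "rep (y + z) f = (\<lambda>\<gamma>. rep y f \<gamma> + rep z f \<gamma>)"
      by (rule ext) (simp add: rep_add)
    then show ?case
      using add by (intro ext) (simp add: distrib_left rep_add rep_vec_add pull_add fun_eq_iff)
  qed
next
  case (add x z)
  then show ?case
    by (intro ext) (simp add: distrib_right rep_add fun_eq_iff)
qed

lemma pull_bound:
  assumes "fin_supp f"
  shows "fin_supp (pull w f)" "l2norm (pull w f) \<le> l2norm f"
proof -
  define T where "T = {\<delta>. pull w f \<delta> \<noteq> 0}"
  define g where "g \<delta> = the (act (word_star w) \<delta>)" for \<delta>
  have g: "act (word_star w) \<delta> = Some (g \<delta>)" "pull w f \<delta> = f (g \<delta>)" if "\<delta> \<in> T" for \<delta>
    using that by (auto simp: T_def pull_def g_def split: option.splits)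
  have inj: "inj_on g T"
    using g(1) act_star by (intro inj_onI) (metis option.inject)
  have sub: "g ` T \<subseteq> {\<gamma>. f \<gamma> \<noteq> 0}"
    using g(2) by (auto simp: T_def)
  show fin: "fin_supp (pull w f)"
    using finite_subset[OF sub] assms inj finite_imageD by (auto simp: fin_supp_def T_def)
  have "(\<Sum>\<delta>\<in>T. (cmod (pull w f \<delta>))\<^sup>2) = (\<Sum>\<gamma>\<in>g ` T. (cmod (f \<gamma>))\<^sup>2)"
    using inj g(2) by (simp add: sum.reindex)
  also have "\<dots> \<le> (\<Sum>\<gamma> | f \<gamma> \<noteq> 0. (cmod (f \<gamma>))\<^sup>2)"
    using sub assms by (intro sum_mono2) (auto simp: fin_supp_def)
  finally show "l2norm (pull w f) \<le> l2norm f"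
    by (simp add: l2norm_def L2_set_def T_def)
qed

lemma rep_bound_ex:
  "\<exists>C\<ge>0. \<forall>f. fin_supp f \<longrightarrow> fin_supp (rep x f) \<and> l2norm (rep x f) \<le> C * l2norm f"
proof (induction x rule: falg_induct)
  case (single w c)
  have "rep (Poly_Mapping.single w c) f = (\<lambda>\<gamma>. c * pull w f \<gamma>)" for f
    by (rule ext) simp
  then show ?case
    using pull_bound by (intro exI[of _ "cmod c"]) (auto simp: l2norm_scale fin_supp_scale intro: mult_left_mono)
next
  case (add x y)
  then obtain C D where CD: "C \<ge> 0" "D \<ge> 0"
    "\<And>f. fin_supp f \<Longrightarrow> fin_supp (rep x f) \<and> l2norm (rep x f) \<le> C * l2norm f"
    "\<And>f. fin_supp f \<Longrightarrow> fin_supp (rep y f) \<and> l2norm (rep y f) \<le> D * l2norm f"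
    by blast
  have eq: "rep (x + y) f = (\<lambda>\<gamma>. rep x f \<gamma> + rep y f \<gamma>)" for f
    by (rule ext) (rule rep_add)
  show ?case
  proof (intro exI[of _ "C + D"] conjI allI impI)
    fix f :: "'x \<Rightarrow> complex"
    assume f: "fin_supp f"
    then show "fin_supp (rep (x + y) f)"
      unfolding eq using CD by (intro fin_supp_add) auto
    have "l2norm (rep (x + y) f) \<le> l2norm (rep x f) + l2norm (rep y f)"
      unfolding eq using CD f by (intro l2norm_add) auto
    also have "\<dots> \<le> (C + D) * l2norm f"
      using CD(3,4)[OF f] by (simp add: algebra_simps)
    finally show "l2norm (rep (x + y) f) \<le> (C + D) * l2norm f" .
  qed (use CD in simp)
qed

lemma fin_supp_rep: "fin_supp f \<Longrightarrow> fin_supp (rep x f)"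
  using rep_bound_ex by blast

definition opnorm :: "falg \<Rightarrow> real" where
  "opnorm x = (SUP f \<in> {f. fin_supp f \<and> l2norm f \<le> 1}. l2norm (rep x f))"

lemma opnorm_upper:
  assumes "fin_supp f"
  shows "l2norm (rep x f) \<le> opnorm x * l2norm f"
proof (cases "l2norm f = 0")
  case True
  then have "f = (\<lambda>_. 0)"
    using assms by (rule l2norm_eq_0[rotated])
  then have "rep x f = (\<lambda>_. 0)"
    by (auto intro!: ext sum.neutral simp: rep_def pull_def split: option.split)
  then show ?thesis
    using True by simp
next
  case False
  obtain C where C: "C \<ge> 0" "\<And>f. fin_supp f \<Longrightarrow> l2norm (rep x f) \<le> C * l2norm f"
    using rep_bound_ex by blast
  have "bdd_above ((\<lambda>f. l2norm (rep x f)) ` {f. fin_supp f \<and> l2norm f \<le> 1})"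
  proof (rule bdd_aboveI2)
    fix f :: "'x \<Rightarrow> complex"
    assume "f \<in> {f. fin_supp f \<and> l2norm f \<le> 1}"
    then show "l2norm (rep x f) \<le> C"
      using C(2)[of f] mult_left_mono[of "l2norm f" 1 C] C(1) by auto
  qed
  then have upper: "l2norm (rep x g) \<le> opnorm x" if "fin_supp g" "l2norm g \<le> 1" for g
    unfolding opnorm_def using that by (intro cSUP_upper) auto
  define c where "c = complex_of_real (1 / l2norm f)"
  have c: "cmod c = 1 / l2norm f"
    by (simp add: c_def norm_divide)
  have "l2norm (rep x (\<lambda>\<gamma>. c * f \<gamma>)) \<le> opnorm x"
    using assms False by (intro upper fin_supp_scale) (auto simp: l2norm_scale c)
  moreover have "rep x (\<lambda>\<gamma>. c * f \<gamma>) = (\<lambda>\<gamma>. c * rep x f \<gamma>)"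
    by (rule ext) (rule rep_vec_scale)
  ultimately have "l2norm (rep x f) / l2norm f \<le> opnorm x"
    using assms by (simp add: l2norm_scale fin_supp_rep c)
  then show ?thesis
    using False by (simp add: divide_le_eq less_le)
qed

lemma opnorm_least:
  assumes "\<And>f. fin_supp f \<Longrightarrow> l2norm f \<le> 1 \<Longrightarrow> l2norm (rep x f) \<le> c"
  shows "opnorm x \<le> c"
proof -
  have "(\<lambda>_. 0) \<in> {f :: 'x \<Rightarrow> complex. fin_supp f \<and> l2norm f \<le> 1}"
    by simp
  then show ?thesis
    unfolding opnorm_def using assms by (intro cSUP_least) blast+
qed

lemma opnorm_nonneg: "0 \<le> opnorm x"
proof -
  have "0 \<le> opnorm x * l2norm f" if "fin_supp f" for f :: "'x \<Rightarrow> complex"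
    using opnorm_upper[OF that, of x] l2norm_nonneg[of "rep x f"] by linarith
  \<comment> \<open>A point mass has norm 1, so the inequality can be divided by its norm.\<close>
  moreover define f :: "'x \<Rightarrow> complex" where "f = indicator {undefined}"
  have "{\<gamma>. f \<gamma> \<noteq> 0} = {undefined}"
    by (auto simp: f_def indicator_def)
  then have "fin_supp f" "l2norm f = 1"
    by (auto simp: fin_supp_def l2norm_def f_def)
  ultimately show ?thesis
    by fastforce
qed

lemma opnorm_upper_1: "fin_supp f \<Longrightarrow> l2norm f \<le> 1 \<Longrightarrow> l2norm (rep x f) \<le> opnorm x"
  using opnorm_upper[of f x] mult_left_mono[of "l2norm f" 1 "opnorm x"] opnorm_nonneg[of x] by simp

lemma opnorm_add: "opnorm (x + y) \<le> opnorm x + opnorm y"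
proof (rule opnorm_least)
  fix f :: "'x \<Rightarrow> complex"
  assume f: "fin_supp f" "l2norm f \<le> 1"
  have "rep (x + y) f = (\<lambda>\<gamma>. rep x f \<gamma> + rep y f \<gamma>)"
    by (rule ext) (rule rep_add)
  then show "l2norm (rep (x + y) f) \<le> opnorm x + opnorm y"
    using l2norm_add[OF fin_supp_rep fin_supp_rep, OF f(1) f(1), of x y]
      opnorm_upper_1[OF f, of x] opnorm_upper_1[OF f, of y] by simp
qed

lemma opnorm_mult: "opnorm (x * y) \<le> opnorm x * opnorm y"
proof (rule opnorm_least)
  fix f :: "'x \<Rightarrow> complex"
  assume f: "fin_supp f" "l2norm f \<le> 1"
  have "l2norm (rep (x * y) f) \<le> opnorm x * l2norm (rep y f)"
    unfolding rep_mult by (intro opnorm_upper fin_supp_rep f)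
  also have "\<dots> \<le> opnorm x * opnorm y"
    by (intro mult_left_mono opnorm_upper_1 f opnorm_nonneg)
  finally show "l2norm (rep (x * y) f) \<le> opnorm x * opnorm y" .
qed

lemma opnorm_scale: "opnorm (scale c x) = cmod c * opnorm x"
proof -
  have eq: "rep (scale c x) f = (\<lambda>\<gamma>. c * rep x f \<gamma>)" for c x f
    by (rule ext) (rule rep_scale)
  have le: "opnorm (scale c x) \<le> cmod c * opnorm x" for c x
    by (rule opnorm_least) (auto simp: eq l2norm_scale fin_supp_rep intro: mult_left_mono opnorm_upper_1)
  show ?thesis
  proof (cases "c = 0")
    case True
    then show ?thesis
      using le[of 0 x] opnorm_nonneg[of 0] by simp
  next
    case False
    then have "opnorm x \<le> cmod (inverse c) * opnorm (scale c x)"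
      using le[of "inverse c" "scale c x"] by simp
    then show ?thesis
      using le[of c x] False by (simp add: norm_inverse norm_divide field_simps)
  qed
qed

text \<open>For a single word both sides are the sum of f \<gamma> times the conjugate of g \<delta>
  over the pairs with w\<gamma> = \<delta>, once indexed by \<delta> and once by \<gamma>.\<close>

lemma rep_adjoint:
  assumes f: "fin_supp f" and g: "fin_supp g"
  shows "l2inner (rep x f) g = l2inner f (rep (star x) g)"
proof (induction x rule: falg_induct)
  case (single w c)
  have "l2inner (pull w f) g = l2inner f (pull (word_star w) g)"
  proof -
    define S where "S = {\<delta>. pull w f \<delta> \<noteq> 0}"
    define T where "T = {\<gamma>. f \<gamma> \<noteq> 0}"
    have fin: "finite S" "finite T"
      using pull_bound[OF f] f by (auto simp: S_def T_def fin_supp_def)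
    show ?thesis
      unfolding l2inner_def S_def[symmetric] T_def[symmetric]
    proof (rule sum.reindex_bij_witness_not_neutral[where S' = "{\<delta> \<in> S. g \<delta> = 0}"
          and T' = "{\<gamma> \<in> T. pull (word_star w) g \<gamma> = 0}"
          and i = "\<lambda>\<gamma>. the (act w \<gamma>)" and j = "\<lambda>\<delta>. the (act (word_star w) \<delta>)"])
      fix \<delta>
      assume "\<delta> \<in> S - {\<delta> \<in> S. g \<delta> = 0}"
      then have \<delta>: "pull w f \<delta> \<noteq> 0" "g \<delta> \<noteq> 0"
        by (auto simp: S_def)
      then obtain \<gamma> where \<gamma>: "act (word_star w) \<delta> = Some \<gamma>"
        by (auto simp: pull_def split: option.splits)
      then have w: "act w \<gamma> = Some \<delta>"
        by (simp add: act_star)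
      show "the (act w (the (act (word_star w) \<delta>))) = \<delta>"
        by (simp add: \<gamma> w)
      show "the (act (word_star w) \<delta>) \<in> T - {\<gamma> \<in> T. pull (word_star w) g \<gamma> = 0}"
        using \<delta> \<gamma> w by (auto simp: T_def pull_def)
    next
      fix \<delta>
      assume "\<delta> \<in> S"
      then obtain \<gamma> where \<gamma>: "act (word_star w) \<delta> = Some \<gamma>"
        by (auto simp: S_def pull_def split: option.splits)
      then have "act w \<gamma> = Some \<delta>"
        by (simp add: act_star)
      with \<gamma> show "f (the (act (word_star w) \<delta>)) * cnj (pull (word_star w) g (the (act (word_star w) \<delta>)))
        = pull w f \<delta> * cnj (g \<delta>)"
        by (simp add: pull_def)
    next
      fix \<gamma>
      assume "\<gamma> \<in> T - {\<gamma> \<in> T. pull (word_star w) g \<gamma> = 0}"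
      then have \<gamma>: "f \<gamma> \<noteq> 0" "pull (word_star w) g \<gamma> \<noteq> 0"
        by (auto simp: T_def)
      then obtain \<delta> where \<delta>: "act w \<gamma> = Some \<delta>"
        by (auto simp: pull_def split: option.splits)
      then have w: "act (word_star w) \<delta> = Some \<gamma>"
        by (simp add: act_star)
      show "the (act (word_star w) (the (act w \<gamma>))) = \<gamma>"
        by (simp add: \<delta> w)
      show "the (act w \<gamma>) \<in> S - {\<delta> \<in> S. g \<delta> = 0}"
        using \<gamma> \<delta> w by (auto simp: S_def pull_def)
    qed (use fin in auto)
  qed
  moreover have "rep (Poly_Mapping.single w c) f = (\<lambda>\<delta>. c * pull w f \<delta>)"
    "rep (star (Poly_Mapping.single w c)) g = (\<lambda>\<delta>. cnj c * pull (word_star w) g \<delta>)"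
    by (auto intro!: ext)
  moreover have "l2inner (\<lambda>\<delta>. c * pull w f \<delta>) g = c * l2inner (pull w f) g"
    using pull_bound(1)[OF f, of w] unfolding fin_supp_def
    by (subst l2inner_eq[of "{\<delta>. pull w f \<delta> \<noteq> 0}"]) (auto simp: l2inner_def sum_distrib_left mult.assoc)
  moreover have "l2inner f (\<lambda>\<delta>. cnj c * pull (word_star w) g \<delta>) = c * l2inner f (pull (word_star w) g)"
    by (simp add: l2inner_def sum_distrib_left mult_ac)
  ultimately show ?case
    by simp
next
  case (add x y)
  have "rep (x + y) f = (\<lambda>\<delta>. rep x f \<delta> + rep y f \<delta>)"
    "rep (star (x + y)) g = (\<lambda>\<delta>. rep (star x) g \<delta> + rep (star y) g \<delta>)"
    by (auto intro!: ext simp: rep_add star_add)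
  then show ?case
    using add f by (simp add: l2inner_add_left l2inner_add_right fin_supp_rep)
qed

lemma opnorm_sq_le: "(opnorm x)\<^sup>2 \<le> opnorm (star x * x)"
proof -
  have "l2norm (rep x f) \<le> sqrt (opnorm (star x * x))" if f: "fin_supp f" "l2norm f \<le> 1" for f
  proof -
    have "(l2norm (rep x f))\<^sup>2 = cmod (l2inner (rep x f) (rep x f))"
      by (simp only: l2inner_self[OF fin_supp_rep[OF f(1)]] norm_of_real) simp
    also have "\<dots> = cmod (l2inner f (rep (star x * x) f))"
      by (simp add: rep_adjoint f fin_supp_rep rep_mult)
    also have "\<dots> \<le> l2norm f * l2norm (rep (star x * x) f)"
      by (intro l2inner_le f fin_supp_rep)
    also have "\<dots> \<le> 1 * opnorm (star x * x)"
      by (intro mult_mono f opnorm_upper_1) auto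
    finally show ?thesis
      by (simp add: real_le_rsqrt)
  qed
  then have "opnorm x \<le> sqrt (opnorm (star x * x))"
    by (rule opnorm_least)
  then have "(opnorm x)\<^sup>2 \<le> (sqrt (opnorm (star x * x)))\<^sup>2"
    by (intro power_mono opnorm_nonneg)
  then show ?thesis
    by (simp add: opnorm_nonneg)
qed

lemma opnorm_star_le: "opnorm x \<le> opnorm (star x)"
proof (cases "opnorm x = 0")
  case False
  then have "opnorm x > 0"
    using opnorm_nonneg[of x] by linarith
  moreover have "opnorm x * opnorm x \<le> opnorm (star x) * opnorm x"
    using opnorm_sq_le[of x] opnorm_mult[of "star x" x] by (simp add: power2_eq_square)
  ultimately show ?thesis
    by simp
qed (use opnorm_nonneg in simp)

lemma opnorm_cstar: "opnorm (star x * x) = (opnorm x)\<^sup>2"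
  using opnorm_sq_le[of x] opnorm_mult[of "star x" x] opnorm_star_le[of x] opnorm_star_le[of "star x"]
  by (simp add: power2_eq_square)

lemma cstar_seminorm_opnorm: "katsura.cstar_seminorm N A opnorm"
  by (simp add: katsura.cstar_seminorm_def opnorm_nonneg opnorm_add opnorm_mult opnorm_scale opnorm_cstar)

lemma opnorm_eq_0_iff: "opnorm x = 0 \<longleftrightarrow> (\<forall>f. fin_supp f \<longrightarrow> rep x f = (\<lambda>_. 0))"
proof
  assume "opnorm x = 0"
  then show "\<forall>f. fin_supp f \<longrightarrow> rep x f = (\<lambda>_. 0)"
    using opnorm_upper[of _ x] by (auto intro!: l2norm_eq_0 fin_supp_rep order_antisym[of "l2norm _"])
next
  assume "\<forall>f. fin_supp f \<longrightarrow> rep x f = (\<lambda>_. 0)"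
  then show "opnorm x = 0"
    by (intro antisym opnorm_least opnorm_nonneg) auto
qed

text \<open>Applied to the point mass at \<gamma>, the operator of a word returns the point mass at
  its image, so the operator determines the partial map.\<close>

lemma act_eq_of_opnorm:
  assumes "opnorm (Poly_Mapping.single v 1 - Poly_Mapping.single w 1) = 0"
  shows "act v = act w"
proof
  fix \<gamma>
  define f :: "'x \<Rightarrow> complex" where "f = indicator {\<gamma>}"
  have f: "fin_supp f"
    by (auto simp: fin_supp_def f_def indicator_def)
  have eq: "pull w f \<delta> = of_bool (act w \<gamma> = Some \<delta>)" for w \<delta>
    using act_star[of w \<delta>] by (cases "act (word_star w) \<delta>") (auto simp: pull_def f_def indicator_def)
  have zero: "rep (Poly_Mapping.single v 1 - Poly_Mapping.single w 1) f \<delta> = 0" for \<delta>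
    using assms f by (auto simp: opnorm_eq_0_iff)
  have "(act v \<gamma> = Some \<delta>) = (act w \<gamma> = Some \<delta>)" for \<delta>
    using zero[of \<delta>] by (simp add: rep_diff eq of_bool_def split: if_splits)
  then show "act v \<gamma> = act w \<gamma>"
    by (metis option.exhaust)
qed

lemma act_None_of_opnorm:
  assumes "opnorm (Poly_Mapping.single v 1) = 0"
  shows "act v \<gamma> = None"
proof (rule ccontr)
  assume "act v \<gamma> \<noteq> None"
  then obtain \<delta> where "act v \<gamma> = Some \<delta>"
    by auto
  then have "act (word_star v) \<delta> = Some \<gamma>"
    by (simp add: act_star)
  then have "rep (Poly_Mapping.single v 1) (indicator {\<gamma>}) \<delta> = 1"
    by (simp add: pull_def)
  moreover have "fin_supp (indicator {\<gamma>})"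
    by (auto simp: fin_supp_def indicator_def)
  ultimately show False
    using assms by (auto simp: opnorm_eq_0_iff fun_eq_iff)
qed

end

section \<open>The action on infinite paths\<close>

lemma stream_nth_eqI: "(\<And>n. s !! n = t !! n) \<Longrightarrow> s = t"
proof -
  assume "\<And>n. s !! n = t !! n"
  then have "snth s = snth t"
    by (rule ext)
  then show ?thesis
    by (metis stream_smap_nats)
qed

context katsura_std
begin

definition X_at :: "nat \<Rightarrow> edge stream set" where
  "X_at i = {\<gamma> \<in> X_A. esrc (shd \<gamma>) = i}"

lemma X_A_iff: "\<gamma> \<in> X_A \<longleftrightarrow> shd \<gamma> \<in> edges \<and> stl \<gamma> \<in> X_at (etgt (shd \<gamma>))"
proof -
  have "(\<forall>k. P k) \<longleftrightarrow> P 0 \<and> (\<forall>k. P (Suc k))" for P :: "nat \<Rightarrow> bool"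
    by (metis not0_implies_Suc)
  from this[of "\<lambda>k. \<gamma> !! k \<in> edges \<and> etgt (\<gamma> !! k) = esrc (\<gamma> !! Suc k)"] show ?thesis
    by (auto simp: X_A_def X_at_def)
qed

lemma X_at_Cons: "e ## \<gamma> \<in> X_at i \<longleftrightarrow> e \<in> edges \<and> esrc e = i \<and> \<gamma> \<in> X_at (etgt e)"
  by (auto simp: X_at_def X_A_iff[of "e ## \<gamma>"])

lemma X_at_V: "\<gamma> \<in> X_at i \<Longrightarrow> i \<in> V"
  using X_A_iff[of \<gamma>] by (auto simp: X_at_def edgesD)

lemma X_at_cases:
  assumes "\<gamma> \<in> X_at i"
  obtains e \<gamma>' where "\<gamma> = e ## \<gamma>'" "e \<in> edges" "esrc e = i" "\<gamma>' \<in> X_at (etgt e)"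
proof (rule that)
  show \<gamma>: "\<gamma> = shd \<gamma> ## stl \<gamma>"
    by simp
  show "shd \<gamma> \<in> edges" "esrc (shd \<gamma>) = i" "stl \<gamma> \<in> X_at (etgt (shd \<gamma>))"
    using assms X_at_Cons[of "shd \<gamma>" "stl \<gamma>" i] by simp_all
qed

lemma X_at_split:
  assumes "\<gamma> \<in> X_at i"
  obtains j n \<gamma>' where "\<gamma> = (i, j, n) ## \<gamma>'" "(i, j, n) \<in> edges" "(i, j) \<in> Omega" "\<gamma>' \<in> X_at j"
proof -
  obtain e \<gamma>' where e: "\<gamma> = e ## \<gamma>'" "e \<in> edges" "esrc e = i" "\<gamma>' \<in> X_at (etgt e)"
    using assms by (rule X_at_cases)
  obtain a j n where "e = (a, j, n)"
    by (cases e)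
  then show thesis
    using that[of j n \<gamma>'] e edgesD(1)[OF e(2)] by simp
qed

lemma X_at_shift: "I @- \<gamma> \<in> X_at k \<longleftrightarrow> (\<exists>i. \<gamma> \<in> X_at i \<and> path_to I i \<and> psrc I i = k)"
proof (induction I arbitrary: k)
  case Nil
  then show ?case
    using X_at_V by (auto simp: X_at_def)
next
  case (Cons e I)
  then show ?case
    by (auto simp: X_at_Cons path_to_Cons)
qed

lemma cylinder_eq: "cylinder I i = {I @- \<gamma> | \<gamma>. \<gamma> \<in> X_at i}"
  by (auto simp: cylinder_def X_at_def)

lemma cylinder_subset: "path_to I i \<Longrightarrow> cylinder I i \<subseteq> X_at (psrc I i)"
  by (auto simp: cylinder_eq X_at_shift)

lemma edges_at_nonempty:
  assumes "i \<in> V"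
  shows "\<exists>e\<in>edges. esrc e = i"
proof -
  obtain j where "(i, j) \<in> Omega"
    using Omega_at_nonempty[OF assms] by (auto simp: Omega_at_def)
  then have "(i, j, 1) \<in> edges" "esrc (i, j, 1) = i"
    by (auto simp: edges_def Omega_def)
  then show ?thesis
    by blast
qed

text \<open>Outgoing edges are chosen forever. As a consequence no cylinder is empty, which
  separates the nonzero elements of \<open>E\<close> from zero.\<close>

lemma X_at_nonempty:
  assumes "i \<in> V"
  shows "X_at i \<noteq> {}"
proof -
  define nxt where "nxt i = (SOME e. e \<in> edges \<and> esrc e = i)" for i
  have nxt: "nxt i \<in> edges \<and> esrc (nxt i) = i" if "i \<in> V" for i
    unfolding nxt_def by (rule someI_ex) (use edges_at_nonempty[OF that] in blast)
  define \<gamma> where "\<gamma> = siterate (\<lambda>e. nxt (etgt e)) (nxt i)"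
  have step: "\<gamma> !! Suc k = nxt (etgt (\<gamma> !! k))" for k
    by (simp only: \<gamma>_def snth_siterate funpow.simps comp_def)
  have "\<gamma> !! k \<in> edges" for k
    by (induction k) (use nxt assms edgesD step in \<open>auto simp: \<gamma>_def\<close>)
  then have "\<gamma> \<in> X_at i"
    using nxt assms edgesD step by (auto simp: X_at_def X_A_def \<gamma>_def)
  then show ?thesis
    by blast
qed

lemma cylinder_nonempty: "path_to I i \<Longrightarrow> cylinder I i \<noteq> {}"
  using X_at_nonempty path_toD by (auto simp: cylinder_eq)

lemma carry_edge: "(i, j, n) \<in> edges \<Longrightarrow> carry 0 (i, j, n) = (n, 0)"
  by (rule carry_eqI) (auto simp: edges_def)

text \<open>The cocycle identity behind the action: adding the two division equations gives the one
  for s + t, with quotient k + k'.\<close>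

lemma carry_add:
  assumes "(i, j) \<in> Omega" "carry t (i, j, n) = (m, k)" "carry s (i, j, m) = (m', k')"
  shows "carry (s + t) (i, j, n) = (m', k + k')"
proof -
  have "n + t * B i j = m + k * int (A i j)"
    using carryE[OF assms(1), of t n] assms(2) by (metis prod.inject)
  moreover have "m + s * B i j = m' + k' * int (A i j)" "1 \<le> m'" "m' \<le> int (A i j)"
    using carryE[OF assms(1), of s m] assms(3) by (metis prod.inject)+
  ultimately show ?thesis
    by (intro carry_eqI) (auto simp: algebra_simps)
qed

text \<open>The index and the multiple of B enter \<open>carry\<close> only through their
  sum.\<close>

lemma carry_shift_B: "carry t (i, j, n + B i j) = carry (t + 1) (i, j, n)"
  by (simp add: carry_def algebra_simps)

lemma carry_shift_A:
  assumes "(i, j) \<in> Omega" "carry t (i, j, n) = (m, k)"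
  shows "carry t (i, j, n + int (A i j)) = (m, k + 1)"
proof -
  have "n + t * B i j = m + k * int (A i j)" "1 \<le> m" "m \<le> int (A i j)"
    using carryE[OF assms(1), of t n] assms(2) by (metis prod.inject)+
  then show ?thesis
    by (intro carry_eqI) (auto simp: algebra_simps)
qed

lemma u_act_Cons:
  "carry t (i, j, n) = (m, k) \<Longrightarrow> u_act t ((i, j, n) ## \<gamma>) = (i, j, m) ## u_act k \<gamma>"
  by (subst u_act.ctr) simp

text \<open>The action alters the indices of the edges, never the vertices passed.\<close>

lemma u_act_X_at:
  assumes "\<gamma> \<in> X_at i"
  shows "u_act t \<gamma> \<in> X_at i"
proof -
  have nth: "u_act t \<gamma> !! n \<in> edges \<and> esrc (u_act t \<gamma> !! n) = esrc (\<gamma> !! n) \<and>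
      etgt (u_act t \<gamma> !! n) = etgt (\<gamma> !! n)" if "\<gamma> \<in> X_at i" for \<gamma> i t n
    using that
  proof (induction n arbitrary: \<gamma> i t)
    case (0 \<gamma> i t)
    then obtain e \<gamma>' where \<gamma>: "\<gamma> = e ## \<gamma>'" "e \<in> edges"
      by (auto elim: X_at_cases)
    obtain a b n where e: "e = (a, b, n)" "(a, b) \<in> Omega"
      using \<gamma>(2) by (cases e) (auto simp: edges_def)
    obtain m k where "carry t (a, b, n) = (m, k)" "(a, b, m) \<in> edges"
      using carryE[OF e(2)] by metis
    then show ?case
      by (simp add: \<gamma>(1) e(1) u_act_Cons)
  next
    case (Suc n \<gamma> i t)
    then obtain e \<gamma>' where "\<gamma> = e ## \<gamma>'" "\<gamma>' \<in> X_at (etgt e)"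
      by (auto elim: X_at_cases)
    then show ?case
      using Suc.IH[of \<gamma>'] by simp
  qed
  have \<gamma>: "etgt (\<gamma> !! k) = esrc (\<gamma> !! Suc k)" "esrc (\<gamma> !! 0) = i" for k
    using assms by (auto simp: X_at_def X_A_def)
  have "u_act t \<gamma> !! k \<in> edges \<and> etgt (u_act t \<gamma> !! k) = esrc (u_act t \<gamma> !! Suc k)" for k
    using nth[OF assms, of t k] nth[OF assms, of t "Suc k"] \<gamma>(1)[of k] by metis
  moreover have "esrc (shd (u_act t \<gamma>)) = i"
    using nth[OF assms, of t 0] \<gamma>(2) by (metis snth.simps(1))
  ultimately show ?thesis
    unfolding X_at_def X_A_def mem_Collect_eq by blast
qed

lemma u_act_add:
  assumes "\<gamma> \<in> X_at i"
  shows "u_act s (u_act t \<gamma>) = u_act (s + t) \<gamma>"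
proof (rule stream_nth_eqI)
  fix n
  show "u_act s (u_act t \<gamma>) !! n = u_act (s + t) \<gamma> !! n"
    using assms
  \<comment> \<open>The exponents are generalized because every coordinate hands on its own
    carries.\<close>
  proof (induction n arbitrary: \<gamma> i s t)
    case (0 \<gamma> i s t)
    from \<open>\<gamma> \<in> X_at i\<close> obtain b n \<gamma>' where \<gamma>: "\<gamma> = (i, b, n) ## \<gamma>'" "(i, b) \<in> Omega"
      by (rule X_at_split)
    obtain m k where mk: "carry t (i, b, n) = (m, k)"
      by fastforce
    obtain m' k' where mk': "carry s (i, b, m) = (m', k')"
      by fastforce
    show ?case
      unfolding \<gamma>(1) u_act_Cons[OF mk] u_act_Cons[OF mk'] u_act_Cons[OF carry_add[OF \<gamma>(2) mk mk']]
      by simp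
  next
    case (Suc p \<gamma> i s t)
    from \<open>\<gamma> \<in> X_at i\<close> obtain b n \<gamma>' where \<gamma>: "\<gamma> = (i, b, n) ## \<gamma>'" "(i, b) \<in> Omega" "\<gamma>' \<in> X_at b"
      by (rule X_at_split)
    obtain m k where mk: "carry t (i, b, n) = (m, k)"
      by fastforce
    obtain m' k' where mk': "carry s (i, b, m) = (m', k')"
      by fastforce
    show ?case
      unfolding \<gamma>(1) u_act_Cons[OF mk] u_act_Cons[OF mk'] u_act_Cons[OF carry_add[OF \<gamma>(2) mk mk']]
      using Suc.IH[OF \<gamma>(3), of k' k] by (simp add: add.commute)
  qed
qed

lemma u_act_zero:
  assumes "\<gamma> \<in> X_at i"
  shows "u_act 0 \<gamma> = \<gamma>"
proof (rule stream_nth_eqI)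
  fix n
  show "u_act 0 \<gamma> !! n = \<gamma> !! n"
    using assms
  proof (induction n arbitrary: \<gamma> i)
    case (0 \<gamma> i)
    from \<open>\<gamma> \<in> X_at i\<close> obtain b n \<gamma>' where \<gamma>: "\<gamma> = (i, b, n) ## \<gamma>'" "(i, b, n) \<in> edges"
      by (rule X_at_split)
    then show ?case
      using u_act_Cons[OF carry_edge[OF \<gamma>(2)]] by simp
  next
    case (Suc p \<gamma> i)
    from \<open>\<gamma> \<in> X_at i\<close> obtain b n \<gamma>' where \<gamma>: "\<gamma> = (i, b, n) ## \<gamma>'" "(i, b, n) \<in> edges" "\<gamma>' \<in> X_at b"
      by (rule X_at_split)
    then show ?case
      using u_act_Cons[OF carry_edge[OF \<gamma>(2)]] Suc.IH[OF \<gamma>(3)] by simp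
  qed
qed

text \<open>\<open>carry 0\<close> splits n into m + k A with (i, j, m) an edge, so s_{i,j,n} acts
  as u^k followed by prepending that edge, and its adjoint removes the edge and applies
  u^(-k).\<close>

fun letter_act :: "gen \<times> bool \<Rightarrow> edge stream \<Rightarrow> edge stream option" where
  "letter_act (GenQ i, b) \<gamma> = (if \<gamma> \<in> X_at i then Some \<gamma> else None)"
| "letter_act (GenU i, b) \<gamma> = (if \<gamma> \<in> X_at i then Some (u_act (if b then - 1 else 1) \<gamma>) else None)"
| "letter_act (GenS i j n, False) \<gamma> = (if (i, j) \<in> Omega \<and> \<gamma> \<in> X_at j
    then Some ((i, j, fst (carry 0 (i, j, n))) ## u_act (snd (carry 0 (i, j, n))) \<gamma>) else None)"
| "letter_act (GenS i j n, True) \<gamma> = (if \<gamma> \<in> X_at i \<and> shd \<gamma> = (i, j, fst (carry 0 (i, j, n)))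
    then Some (u_act (- snd (carry 0 (i, j, n))) (stl \<gamma>)) else None)"

text \<open>One implication, proved for both values of the flag, gives the equivalence because
  switching the flag is an involution.\<close>

lemma letter_act_converse: "letter_act (g, \<not> b) \<delta> = Some \<gamma> \<longleftrightarrow> letter_act (g, b) \<gamma> = Some \<delta>"
proof -
  have imp: "letter_act (g, \<not> b) \<delta> = Some \<gamma>" if "letter_act (g, b) \<gamma> = Some \<delta>" for b \<gamma> \<delta>
  proof (cases g)
    case (GenQ i)
    then show ?thesis
      using that by (auto split: if_splits)
  next
    case (GenU i)
    then show ?thesis
      using that by (auto simp: u_act_X_at u_act_add u_act_zero split: if_splits)
  next
    case (GenS i j n)
    obtain m k where mk: "carry 0 (i, j, n) = (m, k)"
      by fastforce
    show ?thesis
    proof (cases b)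
      case False
      then have "(i, j) \<in> Omega" "\<gamma> \<in> X_at j" "\<delta> = (i, j, m) ## u_act k \<gamma>"
        using that GenS mk by (auto split: if_splits)
      moreover from this have "(i, j, m) \<in> edges"
        using carryE[of i j 0 n] mk by (metis prod.inject)
      ultimately show ?thesis
        using False GenS mk by (simp add: X_at_Cons u_act_X_at u_act_add u_act_zero)
    next
      case True
      then have *: "\<gamma> \<in> X_at i" "shd \<gamma> = (i, j, m)" "\<delta> = u_act (- k) (stl \<gamma>)"
        using that GenS mk by (auto split: if_splits)
      then have "stl \<gamma> \<in> X_at j" "(i, j) \<in> Omega"
        by (cases \<gamma>; force simp: X_at_Cons edges_def)+
      then show ?thesis
        using True GenS mk * by (cases \<gamma>) (simp add: u_act_X_at u_act_add u_act_zero)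
    qed
  qed
  from imp[of b \<gamma> \<delta>] imp[of "\<not> b" \<delta> \<gamma>] show ?thesis
    by auto
qed

fun word_act :: "(gen \<times> bool) list \<Rightarrow> edge stream \<Rightarrow> edge stream option" where
  "word_act [] \<gamma> = Some \<gamma>"
| "word_act (l # w) \<gamma> = Option.bind (word_act w \<gamma>) (letter_act l)"

lemma word_act_append: "word_act (v @ w) \<gamma> = Option.bind (word_act w \<gamma>) (word_act v)"
  by (induction v) (auto simp: bind_assoc)

lemma word_act_converse:
  "word_act (rev (map (\<lambda>(a, b). (a, \<not> b)) w)) \<delta> = Some \<gamma> \<longleftrightarrow> word_act w \<gamma> = Some \<delta>"
proof (induction w arbitrary: \<delta>)
  case (Cons l w)
  obtain g b where l: "l = (g, b)"
    by (cases l)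
  show ?case
    using Cons.IH letter_act_converse[of g b]
    by (auto simp: l word_act_append bind_eq_Some_conv)
qed auto

definition wact :: "fword \<Rightarrow> edge stream \<Rightarrow> edge stream option" where
  "wact w = word_act (letters w)"

sublocale pr: partial_rep wact
proof
  show "wact (v + w) \<gamma> = Option.bind (wact w \<gamma>) (wact v)" for v w \<gamma>
    by (simp add: wact_def[abs_def] word_act_append)
  show "wact (word_star w) \<delta> = Some \<gamma> \<longleftrightarrow> wact w \<gamma> = Some \<delta>" for w \<gamma> \<delta>
    by (simp add: wact_def word_star_def word_act_converse)
qed

end

section \<open>The relators act as zero\<close>

lemma option_eqI: "(\<And>y. a = Some y \<longleftrightarrow> b = Some y) \<Longrightarrow> a = b"
  by (cases a; cases b) auto

context katsura_std
begin

lemma opnorm_diff_eq_0: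
  assumes "\<And>f \<delta>. pr.rep x f \<delta> = pr.rep y f \<delta>"
  shows "pr.opnorm (x - y) = 0"
  using assms by (auto simp: pr.opnorm_eq_0_iff pr.rep_diff)

lemma pull_eq:
  assumes "wact v = wact w"
  shows "pr.pull v f = pr.pull w f"
proof -
  have "wact (word_star v) \<delta> = Some \<gamma> \<longleftrightarrow> wact (word_star w) \<delta> = Some \<gamma>" for \<delta> \<gamma>
    unfolding pr.act_star assms ..
  then have "wact (word_star v) \<delta> = wact (word_star w) \<delta>" for \<delta>
    by (intro option_eqI)
  then show ?thesis
    by (intro ext) (simp only: pr.pull_def)
qed

lemma opnorm_words_eq_0:
  "wact v = wact w \<Longrightarrow> pr.opnorm (Poly_Mapping.single v 1 - Poly_Mapping.single w 1) = 0"
  by (rule opnorm_diff_eq_0) (simp only: pull_eq[of v w] pr.rep_single)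

lemma opnorm_word_eq_0:
  assumes "\<And>\<gamma>. wact w \<gamma> = None"
  shows "pr.opnorm (Poly_Mapping.single w 1) = 0"
proof -
  have "wact (word_star w) \<delta> \<noteq> Some \<gamma>" for \<delta> \<gamma>
    unfolding pr.act_star using assms by simp
  then have "wact (word_star w) \<delta> = None" for \<delta>
    by (cases "wact (word_star w) \<delta>") auto
  then show ?thesis
    by (auto simp: pr.opnorm_eq_0_iff pr.pull_def)
qed

lemma wact_FW [simp]: "wact (FW l) = word_act l"
  by (simp add: wact_def)

lemmas gen_words = genq_def genu_def gens_def mult_single plus_fword_def word_star_def

lemma letter_act_sE:
  assumes "e \<in> edges"
  shows "letter_act (GenS (esrc e) (etgt e) (snd (snd e)), False) \<gamma> =
    (if \<gamma> \<in> X_at (etgt e) then Some (e ## \<gamma>) else None)"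
  using assms edgesD(1)[OF assms]
  by (cases e) (auto simp: carry_edge u_act_zero)

lemma letter_act_back:
  "letter_act (g, False) \<gamma> = Some \<delta> \<Longrightarrow> letter_act (g, True) \<delta> = Some \<gamma>"
  using letter_act_converse[of g False] by simp

text \<open>At a path \<delta> starting in i exactly one summand contributes, the one of the first
  edge of \<delta>.\<close>

lemma opnorm_sum_relator:
  assumes i: "i \<in> V"
  shows "pr.opnorm (genq i - (\<Sum>e\<in>edges_at i. gene e * star (gene e))) = 0"
proof (rule opnorm_diff_eq_0)
  fix f \<delta>
  have e: "pr.rep (gene e * star (gene e)) f \<delta> = (if e = shd \<delta> then if \<delta> \<in> X_at i then f \<delta> else 0 else 0)"
    if e: "e \<in> edges_at i" for e
  proof -
    obtain j n where en: "e = (i, j, n)" "(i, j, n) \<in> edges"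
      using e by (cases e) (auto simp: edges_at_def)
    then have ij: "(i, j) \<in> Omega"
      using edgesD(1) by force
    have "word_act [(GenS i j n, False), (GenS i j n, True)] \<delta>
      = (if \<delta> \<in> X_at i \<and> shd \<delta> = e then Some \<delta> else None)"
    proof (cases "\<delta> \<in> X_at i \<and> shd \<delta> = e")
      case True
      then obtain \<gamma> where "\<delta> = e ## \<gamma>" "\<gamma> \<in> X_at j"
        by (cases \<delta>) (auto simp: X_at_Cons en)
      then show ?thesis
        using True ij en by (simp add: carry_edge u_act_zero)
    qed (auto simp: en carry_edge)
    then show ?thesis
      using en by (auto simp: gen_words gene_def pr.pull_def)
  qed
  have "pr.rep (\<Sum>e\<in>edges_at i. gene e * star (gene e)) f \<delta>
    = (\<Sum>e\<in>edges_at i. if e = shd \<delta> then if \<delta> \<in> X_at i then f \<delta> else 0 else 0)"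
    unfolding pr.rep_sum by (rule sum.cong) (auto simp: e)
  also have "\<dots> = (if \<delta> \<in> X_at i then f \<delta> else 0)"
  proof -
    have "\<delta> \<in> X_at i \<Longrightarrow> shd \<delta> \<in> edges_at i"
      by (erule X_at_cases) (auto simp: edges_at_def)
    then show ?thesis
      using finite_edges_at[OF i] by (auto simp: sum.delta')
  qed
  also have "\<dots> = pr.rep (genq i) f \<delta>"
    by (simp add: gen_words pr.pull_def)
  finally show "pr.rep (genq i) f \<delta> = pr.rep (\<Sum>e\<in>edges_at i. gene e * star (gene e)) f \<delta>" ..
qed

text \<open>Apart from the orthogonality and the sum relation, every relator is a difference of two
  words with the same partial action. The relations between s and u are the two rules for shifting
  the index in \<open>carry\<close>.\<close>

lemma opnorm_relators: "r \<in> relators \<Longrightarrow> pr.opnorm r = 0"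
proof (induction rule: relators.induct)
  case (q_selfadj i)
  show ?case
    unfolding gen_words star_single by (simp, rule opnorm_words_eq_0) auto
next
  case (q_idem i)
  show ?case
    unfolding gen_words by (simp, rule opnorm_words_eq_0) auto
next
  case (q_orth i j)
  then show ?case
    unfolding gen_words by (simp, intro opnorm_word_eq_0) (auto simp: X_at_def)
next
  case (u_range i)
  show ?case
    unfolding gen_words star_single
    by (simp, rule opnorm_words_eq_0) (auto simp: u_act_X_at u_act_add u_act_zero)
next
  case (u_source i)
  show ?case
    unfolding gen_words star_single
    by (simp, rule opnorm_words_eq_0) (auto simp: u_act_X_at u_act_add u_act_zero)
next
  case (s_pisom i j n)
  have "word_act [(GenS i j n, False), (GenS i j n, True), (GenS i j n, False)] \<gamma>
      = word_act [(GenS i j n, False)] \<gamma>" for \<gamma>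
    using letter_act_back[of "GenS i j n" \<gamma>]
    by (cases "letter_act (GenS i j n, False) \<gamma>") (auto simp del: letter_act.simps)
  then show ?case
    unfolding gen_words star_single by (simp del: letter_act.simps, intro opnorm_words_eq_0) auto
next
  case (s_u i j n)
  note ij = \<open>(i, j) \<in> Omega\<close>
  obtain m k where mk: "carry 0 (i, j, n) = (m, k)"
    by fastforce
  have "word_act [(GenS i j n, False), (GenU j, False)] \<gamma>
      = word_act [(GenS i j (n + int (A i j)), False)] \<gamma>" for \<gamma>
    using ij mk carry_shift_A[OF ij mk] by (auto simp: u_act_X_at u_act_add)
  then show ?case
    unfolding gen_words by (simp del: word_act.simps, intro opnorm_words_eq_0) auto
next
  case (u_s i j n)
  note ij = \<open>(i, j) \<in> Omega\<close>
  obtain m k where mk: "(i, j, m) \<in> edges" "carry 0 (i, j, n) = (m, k)"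
    using carryE[OF ij] by metis
  obtain m' k' where mk': "carry 1 (i, j, m) = (m', k')"
    by fastforce
  have c: "carry 0 (i, j, n + B i j) = (m', k + k')"
    using carry_add[OF ij mk(2) mk'] by (simp add: carry_shift_B)
  have "word_act [(GenU i, False), (GenS i j n, False)] \<gamma>
      = word_act [(GenS i j (n + B i j), False)] \<gamma>" for \<gamma>
    using ij mk c by (auto simp: X_at_Cons u_act_X_at u_act_Cons[OF mk'] u_act_add add.commute)
  then show ?case
    unfolding gen_words by (simp del: word_act.simps, intro opnorm_words_eq_0) auto
next
  case (s_source i j n)
  note ij = \<open>(i, j) \<in> Omega\<close>
  have "word_act [(GenS i j n, True), (GenS i j n, False)] \<gamma> = word_act [(GenQ j, False)] \<gamma>" for \<gamma>
  proof (cases "letter_act (GenS i j n, False) \<gamma>")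
    case None
    then show ?thesis
      using ij by (auto split: if_splits)
  next
    case (Some \<delta>)
    then have "\<gamma> \<in> X_at j"
      by (auto split: if_splits)
    then show ?thesis
      using Some letter_act_back[OF Some] by (simp del: letter_act.simps(3,4))
  qed
  then show ?case
    unfolding gen_words star_single by (simp del: word_act.simps, intro opnorm_words_eq_0) auto
next
  case (q_sum i)
  then show ?case
    using opnorm_sum_relator[of i] sum_edges_at[of i "\<lambda>e. gene e * star (gene e)"] by simp
qed

section \<open>The partial action of elements of the algebra\<close>

lemma opnorm_eq_0_of_univ_norm:
  assumes "x \<in> free_alg" "univ_norm x = 0"
  shows "pr.opnorm x = 0"
proof -
  have "pr.opnorm \<in> rep_seminorms"
    unfolding rep_seminorms_def by (simp add: pr.cstar_seminorm_opnorm opnorm_relators)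
  then show ?thesis
    using univ_norm_upper[of pr.opnorm x] assms pr.opnorm_nonneg[of x] by simp
qed

lemma wact_eq_of_emb:
  assumes "good_word v" "good_word w"
    "emb (Poly_Mapping.single v 1) = emb (Poly_Mapping.single w 1)"
  shows "wact v = wact w"
  using assms by (intro pr.act_eq_of_opnorm opnorm_eq_0_of_univ_norm) (auto simp: emb_eq_iff un.eqv_def)

lemma wact_None_of_emb:
  assumes "good_word v" "emb (Poly_Mapping.single v 1) = zeroO"
  shows "wact v \<gamma> = None"
  using assms by (intro pr.act_None_of_opnorm opnorm_eq_0_of_univ_norm)
    (auto simp: emb_eq_iff un.eqv_zero_iff zeroO_def)

text \<open>The choice of the word is immaterial, since words that agree in the algebra act alike on \<open>X_A\<close>.\<close>

definition pact :: "(nat \<Rightarrow> falg) set \<Rightarrow> edge stream \<Rightarrow> edge stream option" where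
  "pact x = (if \<exists>w. good_word w \<and> x = emb (Poly_Mapping.single w 1)
     then wact (SOME w. good_word w \<and> x = emb (Poly_Mapping.single w 1)) else Map.empty)"

text \<open>Zero is adjoined because it need not be the class of a word. \<open>pact\<close> is
  empty on it in either case.\<close>

definition monomials :: "(nat \<Rightarrow> falg) set set" where
  "monomials = insert zeroO {emb (Poly_Mapping.single w 1) | w. good_word w}"

lemma pact_word: "good_word w \<Longrightarrow> pact (emb (Poly_Mapping.single w 1)) = wact w"
  unfolding pact_def
  by (smt (verit, best) someI_ex wact_eq_of_emb)

lemma pact_zero [simp]: "pact zeroO \<gamma> = None"
proof (cases "\<exists>w. good_word w \<and> zeroO = emb (Poly_Mapping.single w 1)")
  case True
  then obtain w where w: "good_word w" "zeroO = emb (Poly_Mapping.single w 1)"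
    by blast
  then show ?thesis
    using pact_word[OF w(1)] wact_None_of_emb[OF w(1)] by simp
next
  case False
  then show ?thesis
    unfolding pact_def if_not_P[OF False] by simp
qed

lemma monomials_cases [consumes 1, case_names zero word]:
  assumes "x \<in> monomials" "x = zeroO \<Longrightarrow> P" "\<And>w. good_word w \<Longrightarrow> x = emb (Poly_Mapping.single w 1) \<Longrightarrow> P"
  shows P
  using assms by (auto simp: monomials_def)

lemma monomials_word: "good_word w \<Longrightarrow> emb (Poly_Mapping.single w 1) \<in> monomials"
  by (auto simp: monomials_def)

lemma monomials_zero [simp]: "zeroO \<in> monomials"
  by (simp add: monomials_def)

lemma monomials_embs: "x \<in> monomials \<Longrightarrow> x \<in> embs"
  by (auto simp: monomials_def)

lemma pact_mul:
  assumes "x \<in> monomials" "y \<in> monomials"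
  shows "x \<cdot> y \<in> monomials" "pact (x \<cdot> y) \<gamma> = Option.bind (pact y \<gamma>) (pact x)"
proof -
  have "x \<cdot> y \<in> monomials \<and> pact (x \<cdot> y) \<gamma> = Option.bind (pact y \<gamma>) (pact x)"
    using assms(1)
  proof (cases rule: monomials_cases)
    case zero
    then have "x \<cdot> y = zeroO"
      using monomials_embs[OF assms(2)] by simp
    then show ?thesis
      using zero by (cases "pact y \<gamma>") (auto simp: monomials_def)
  next
    case x: (word v)
    show ?thesis
      using assms(2)
    proof (cases rule: monomials_cases)
      case zero
      then show ?thesis
        using monomials_embs[OF assms(1)] by (simp add: monomials_def)
    next
      case y: (word w)
      have "x \<cdot> y = emb (Poly_Mapping.single (v + w) 1)"
        using x y by (simp add: emb_mult mult_single)
      then show ?thesis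
        using x y by (simp add: pact_word good_word_plus monomials_word pr.act_plus)
    qed
  qed
  then show "x \<cdot> y \<in> monomials" "pact (x \<cdot> y) \<gamma> = Option.bind (pact y \<gamma>) (pact x)"
    by auto
qed

lemma pact_adj:
  assumes "x \<in> monomials"
  shows "adjO x \<in> monomials" "pact (adjO x) \<delta> = Some \<gamma> \<longleftrightarrow> pact x \<gamma> = Some \<delta>"
proof -
  have "adjO x \<in> monomials \<and> (pact (adjO x) \<delta> = Some \<gamma> \<longleftrightarrow> pact x \<gamma> = Some \<delta>)"
    using assms
  proof (cases rule: monomials_cases)
    case zero
    then show ?thesis
      by (simp add: monomials_def)
  next
    case (word w)
    then have "adjO x = emb (Poly_Mapping.single (word_star w) 1)"
      by (simp add: emb_star)
    then show ?thesis
      using word by (simp add: pact_word good_word_star monomials_word pr.act_star)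
  qed
  then show "adjO x \<in> monomials" "pact (adjO x) \<delta> = Some \<gamma> \<longleftrightarrow> pact x \<gamma> = Some \<delta>"
    by auto
qed

lemma pact_gens:
  "i \<in> V \<Longrightarrow> qO i \<in> monomials" "i \<in> V \<Longrightarrow> pact (qO i) = letter_act (GenQ i, False)"
  "i \<in> V \<Longrightarrow> uO i \<in> monomials" "i \<in> V \<Longrightarrow> pact (uO i) = letter_act (GenU i, False)"
  "(i, j) \<in> Omega \<Longrightarrow> sO i j n \<in> monomials"
  "(i, j) \<in> Omega \<Longrightarrow> pact (sO i j n) = letter_act (GenS i j n, False)"
  by (auto simp: qO_def uO_def sO_def gen_words good_word_def generators_def pact_word fun_eq_iff
      intro!: monomials_word)

lemma S_AB_monomials: "x \<in> S_AB \<Longrightarrow> x \<in> monomials"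
  by (induction rule: S_AB.induct) (auto simp: pact_mul pact_adj pact_gens)

lemma pact_qO: "i \<in> V \<Longrightarrow> pact (qO i) \<gamma> = (if \<gamma> \<in> X_at i then Some \<gamma> else None)"
  by (simp add: pact_gens)

lemma pact_adj_uO:
  assumes "i \<in> V"
  shows "pact (adjO (uO i)) \<gamma> = (if \<gamma> \<in> X_at i then Some (u_act (- 1) \<gamma>) else None)"
proof -
  have "pact (adjO (uO i)) \<gamma> = Some \<delta> \<longleftrightarrow> letter_act (GenU i, True) \<gamma> = Some \<delta>" for \<delta>
    using pact_adj(2)[of "uO i" \<gamma> \<delta>] letter_act_converse[of "GenU i" False \<gamma> \<delta>] assms
    by (simp add: pact_gens del: letter_act.simps)
  then have "pact (adjO (uO i)) \<gamma> = letter_act (GenU i, True) \<gamma>"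
    by (rule option_eqI)
  then show ?thesis
    by simp
qed

lemma pact_upowO:
  assumes i: "i \<in> V"
  shows "upowO i t \<in> monomials" "pact (upowO i t) \<gamma> = (if \<gamma> \<in> X_at i then Some (u_act t \<gamma>) else None)"
proof -
  have "upowO i t \<in> monomials \<and> (\<forall>\<gamma>. pact (upowO i t) \<gamma> = (if \<gamma> \<in> X_at i then Some (u_act t \<gamma>) else None))"
  proof (induction t rule: int_induct[of _ 0])
    case base
    then show ?case
      using i by (simp add: pact_gens u_act_zero)
  next
    case (step1 t)
    then show ?case
      using i pact_mul[of "uO i" "upowO i t"]
      by (simp add: uO_upowO pact_gens u_act_X_at u_act_add add.commute[of 1 t])
  next
    case (step2 t)
    then show ?case
      using i pact_mul[of "adjO (uO i)" "upowO i t"] pact_adj(1)[of "uO i"]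
      by (simp add: adj_uO_upowO pact_gens(3) pact_adj_uO u_act_X_at u_act_add)
  qed
  then show "upowO i t \<in> monomials" "pact (upowO i t) \<gamma> = (if \<gamma> \<in> X_at i then Some (u_act t \<gamma>) else None)"
    by auto
qed

lemma pact_sE:
  assumes "e \<in> edges"
  shows "sE e \<in> monomials" "pact (sE e) \<gamma> = (if \<gamma> \<in> X_at (etgt e) then Some (e ## \<gamma>) else None)"
  using letter_act_sE[OF assms, of \<gamma>] edgesD(1)[OF assms]
  by (cases e; simp add: sE_def pact_gens del: letter_act.simps)+

lemma pact_sprodO:
  assumes "path_to I i"
  shows "sprodO I i \<in> monomials" "pact (sprodO I i) \<gamma> = (if \<gamma> \<in> X_at i then Some (I @- \<gamma>) else None)"
proof -
  have "sprodO I i \<in> monomials \<and> (\<forall>\<gamma>. pact (sprodO I i) \<gamma> = (if \<gamma> \<in> X_at i then Some (I @- \<gamma>) else None))"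
    using assms
  proof (induction I)
    case Nil
    then show ?case
      by (simp add: pact_gens)
  next
    case (Cons e I)
    then have e: "e \<in> edges" "path_to I i" "etgt e = psrc I i"
      by (auto simp: path_to_Cons)
    show ?case
      using Cons.IH[OF e(2)] pact_mul[of "sE e" "sprodO I i"] pact_sE[OF e(1)] e Cons.prems
      by (auto simp: sprodO_Cons X_at_shift)
  qed
  then show "sprodO I i \<in> monomials" "pact (sprodO I i) \<gamma> = (if \<gamma> \<in> X_at i then Some (I @- \<gamma>) else None)"
    by auto
qed

lemma pact_adj_sprodO:
  assumes "path_to I i"
  shows "pact (adjO (sprodO I i)) \<delta> = Some \<gamma> \<longleftrightarrow> \<gamma> \<in> X_at i \<and> \<delta> = I @- \<gamma>"
  using pact_adj(2)[OF pact_sprodO(1)[OF assms], of \<delta> \<gamma>] pact_sprodO(2)[OF assms, of \<gamma>] by auto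

lemma pact_stdO:
  assumes I: "path_to I i" and J: "path_to J i"
  shows "pact (stdO I i t J) \<gamma> = Some \<delta> \<longleftrightarrow>
    (\<exists>\<gamma>'\<in>X_at i. \<gamma> = J @- \<gamma>' \<and> \<delta> = I @- u_act t \<gamma>')"
proof -
  have i: "i \<in> V"
    using I path_toD by blast
  note m = pact_sprodO(1)[OF I] pact_upowO(1)[OF i] pact_adj(1)[OF pact_sprodO(1)[OF J]]
  have "pact (sprodO I i \<cdot> upowO i t) = (\<lambda>y. Option.bind (pact (upowO i t) y) (pact (sprodO I i)))"
    by (rule ext) (rule pact_mul(2)[OF m(1,2)])
  then have "pact (stdO I i t J) \<gamma> = Option.bind (Option.bind (pact (adjO (sprodO J i)) \<gamma>)
      (pact (upowO i t))) (pact (sprodO I i))"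
    unfolding stdO_def using m pact_mul by (simp add: bind_assoc)
  then show ?thesis
    using pact_adj_sprodO[OF J, of \<gamma>] pact_sprodO(2)[OF I] pact_upowO(2)[OF i]
    by (auto simp: bind_eq_Some_conv u_act_X_at split: if_splits)
qed

lemma pact_proj:
  assumes K: "path_to K k"
  shows "pact (sprodO K k \<cdot> adjO (sprodO K k)) \<gamma> = (if \<gamma> \<in> cylinder K k then Some \<gamma> else None)"
proof -
  have k: "k \<in> V"
    using K path_toD by blast
  have "sprodO K k \<cdot> adjO (sprodO K k) = stdO K k 0 K"
    using K k by (simp add: stdO_def)
  then have "pact (sprodO K k \<cdot> adjO (sprodO K k)) \<gamma> = Some \<delta> \<longleftrightarrow> \<gamma> \<in> cylinder K k \<and> \<delta> = \<gamma>" for \<delta>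
    using pact_stdO[OF K K, of 0 \<gamma> \<delta>] by (auto simp: cylinder_eq u_act_zero)
  then show ?thesis
    by (cases "pact (sprodO K k \<cdot> adjO (sprodO K k)) \<gamma>") auto
qed

section \<open>Domain and values of the left multiplication by s\<close>

lemma std_form_iff: "std_form s I i t J \<longleftrightarrow> path_to I i \<and> path_to J i \<and> s = stdO I i t J"
  by (simp add: std_form_def stdO_def)

lemma X_dom_eq:
  assumes "s \<in> S_AB"
  shows "X_dom s = {\<gamma>. pact s \<gamma> \<noteq> None}"
proof (intro set_eqI iffI)
  fix \<gamma>
  assume "\<gamma> \<in> X_dom s"
  then obtain I i t J \<gamma>' where "path_to I i" "path_to J i" "s = stdO I i t J" "\<gamma> = J @- \<gamma>'" "\<gamma>' \<in> X_at i"
    by (auto simp: X_dom_def std_form_iff cylinder_eq)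
  then show "\<gamma> \<in> {\<gamma>. pact s \<gamma> \<noteq> None}"
    using pact_stdO[of I i J t \<gamma> "I @- u_act t \<gamma>'"] by auto
next
  fix \<gamma>
  assume "\<gamma> \<in> {\<gamma>. pact s \<gamma> \<noteq> None}"
  then obtain \<delta> where \<delta>: "pact s \<gamma> = Some \<delta>"
    by auto
  then have "s \<noteq> zeroO"
    by auto
  then obtain I i t J where s: "path_to I i" "path_to J i" "s = stdO I i t J"
    using S_AB_stds(1)[OF assms] by (auto simp: stds_def)
  then have "\<gamma> \<in> cylinder J i"
    using \<delta> pact_stdO[OF s(1,2), of t \<gamma> \<delta>] by (auto simp: cylinder_eq)
  then show "\<gamma> \<in> X_dom s"
    using s unfolding X_dom_def std_form_iff by blast
qed

text \<open>\<open>pact s\<close> does not refer to a standard form, so all standard forms of s send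
  \<gamma> to the same point. One exists because an element that acts somewhere is nonzero.\<close>

lemma alpha_eq:
  assumes s: "s \<in> S_AB" and \<delta>: "pact s \<gamma> = Some \<delta>"
  shows "alpha s \<gamma> = \<delta>"
proof -
  have "(\<exists>I i t J \<gamma>'. std_form s I i t J \<and> \<gamma>' \<in> X_A \<and> esrc (shd \<gamma>') = i \<and>
     \<gamma> = J @- \<gamma>' \<and> \<delta>' = I @- u_act t \<gamma>') \<longleftrightarrow> \<delta>' = \<delta>" (is "?P \<longleftrightarrow> _") for \<delta>'
  proof
    assume ?P
    then obtain I t J \<gamma>' i where "std_form s I i t J" "\<gamma>' \<in> X_at i" "\<gamma> = J @- \<gamma>'" "\<delta>' = I @- u_act t \<gamma>'"
      by (auto simp: X_at_def)
    then have "pact s \<gamma> = Some \<delta>'"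
      using pact_stdO[of I i J t \<gamma> \<delta>'] by (auto simp: std_form_iff)
    then show "\<delta>' = \<delta>"
      using \<delta> by simp
  next
    assume eq: "\<delta>' = \<delta>"
    have "s \<noteq> zeroO"
      using \<delta> by auto
    then obtain I i t J where s': "path_to I i" "path_to J i" "s = stdO I i t J"
      using S_AB_stds(1)[OF s] by (auto simp: stds_def)
    then obtain \<gamma>' where "\<gamma>' \<in> X_at i" "\<gamma> = J @- \<gamma>'" "\<delta> = I @- u_act t \<gamma>'"
      using \<delta> pact_stdO[OF s'(1,2), of t \<gamma> \<delta>] by auto
    then show ?P
      using s' unfolding eq std_form_iff X_at_def by blast
  qed
  then show ?thesis
    unfolding alpha_def by simp
qed

end

section \<open>Normal forms in the semigroupoid\<close>

fun lsrc :: "letter \<Rightarrow> nat" where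
  "lsrc (LH i) = i"
| "lsrc (LG i j n) = i"

fun ltgt :: "letter \<Rightarrow> nat" where
  "ltgt (LH i) = i"
| "ltgt (LG i j n) = j"

text \<open>The four kinds of admissible pairs are the composable ones once h_i is viewed as a loop
  at i.\<close>

lemma adm_pair_iff: "adm_pair l l' \<longleftrightarrow> ltgt l = lsrc l'"
  by (cases l; cases l') auto

definition wsrc :: "letter list \<Rightarrow> nat" where "wsrc w = lsrc (hd w)"
definition wtgt :: "letter list \<Rightarrow> nat" where "wtgt w = ltgt (last w)"

lemma wsrc_append [simp]: "v \<noteq> [] \<Longrightarrow> wsrc (v @ w) = wsrc v"
  and wtgt_append [simp]: "w \<noteq> [] \<Longrightarrow> wtgt (v @ w) = wtgt w"
  and wsrc_Cons [simp]: "wsrc (l # w) = lsrc l"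
  and wtgt_single [simp]: "wtgt [l] = ltgt l"
  and wtgt_Cons [simp]: "w \<noteq> [] \<Longrightarrow> wtgt (l # w) = wtgt w"
  by (auto simp: wsrc_def wtgt_def)

definition edge_letter :: "edge \<Rightarrow> letter" where
  "edge_letter e = (case e of (i, j, n) \<Rightarrow> LG i j n)"

lemma edge_letter_simps [simp]: "edge_letter (i, j, n) = LG i j n"
    "lsrc (edge_letter e) = esrc e" "ltgt (edge_letter e) = etgt e"
  by (cases e; simp add: edge_letter_def)+

lemma edge_letter_eq: "edge_letter = (\<lambda>(i, j, n). LG i j n)"
  by (auto simp: edge_letter_def)

context katsura_std
begin

lemma wds_append:
  assumes "v \<noteq> []" "w \<noteq> []"
  shows "v @ w \<in> wds \<longleftrightarrow> v \<in> wds \<and> w \<in> wds \<and> wtgt v = wsrc w"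
  using assms by (auto simp: wds_def successively_append_iff adm_pair_iff wsrc_def wtgt_def)

lemma wds_Cons: "w \<noteq> [] \<Longrightarrow> l # w \<in> wds \<longleftrightarrow> l \<in> alphabet \<and> w \<in> wds \<and> ltgt l = wsrc w"
  using wds_append[of "[l]" w] by (auto simp: wds_def)

lemma wds_single [simp]: "[l] \<in> wds \<longleftrightarrow> l \<in> alphabet"
  by (auto simp: wds_def)

lemma alphabet_simps [simp]: "LH i \<in> alphabet \<longleftrightarrow> i \<in> V" "LG i j n \<in> alphabet \<longleftrightarrow> (i, j) \<in> Omega"
  by (auto simp: alphabet_def)

lemma wds_nonempty: "w \<in> wds \<Longrightarrow> w \<noteq> []"
  by (simp add: wds_def)

lemma alphabet_V: "l \<in> alphabet \<Longrightarrow> lsrc l \<in> V" "l \<in> alphabet \<Longrightarrow> ltgt l \<in> V"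
  by (auto simp: alphabet_def OmegaD)

lemma wds_V: "w \<in> wds \<Longrightarrow> wsrc w \<in> V" "w \<in> wds \<Longrightarrow> wtgt w \<in> V"
  using alphabet_V by (auto simp: wds_def wsrc_def wtgt_def subset_iff)

lemma wds_replace:
  assumes "a @ v @ b \<in> wds" "v \<in> wds" "w \<in> wds" "wsrc v = wsrc w" "wtgt v = wtgt w"
  shows "a @ w @ b \<in> wds"
  using assms wds_nonempty[OF assms(2)] wds_nonempty[OF assms(3)]
  by (cases "a = []"; cases "b = []") (auto simp: wds_append)

lemma rewr_props:
  assumes "rewr v w"
  shows "v \<in> wds" "w \<in> wds" "wsrc v = wsrc w" "wtgt v = wtgt w"
proof -
  have "v \<in> wds \<and> w \<in> wds \<and> wsrc v = wsrc w \<and> wtgt v = wtgt w"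
    using assms
  proof cases
    case (1 a i j n b)
    have m: "[LG i j n, LH j] \<in> wds"
      using 1(3) by (cases "a = []"; cases "b = []") (auto simp: wds_append wds_Cons)
    have "a @ [LG i j (n + int (A i j))] @ b \<in> wds"
      by (rule wds_replace[OF _ m]) (use 1(3) m in \<open>auto simp: wds_Cons\<close>)
    then show ?thesis
      using 1 by (cases "a = []"; cases "b = []") auto
  next
    case (2 a i j n b)
    have m: "[LH i, LG i j n] \<in> wds"
      using 2(3) by (cases "a = []"; cases "b = []") (auto simp: wds_append wds_Cons)
    have "a @ [LG i j (n + B i j)] @ b \<in> wds"
      by (rule wds_replace[OF _ m]) (use 2(3) m in \<open>auto simp: wds_Cons\<close>)
    then show ?thesis
      using 2 by (cases "a = []"; cases "b = []") auto
  qed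
  then show "v \<in> wds" "w \<in> wds" "wsrc v = wsrc w" "wtgt v = wtgt w"
    by auto
qed

lemma rewr_context:
  assumes "rewr v w" "a @ v @ b \<in> wds"
  shows "rewr (a @ v @ b) (a @ w @ b)"
  using assms(1)
proof cases
  case (1 c i j n d)
  then show ?thesis
    using rewr.intros(1)[of "a @ c" i j n "d @ b"] assms(2) by simp
next
  case (2 c i j n d)
  then show ?thesis
    using rewr.intros(2)[of "a @ c" i j n "d @ b"] assms(2) by simp
qed

definition weq :: "letter list \<Rightarrow> letter list \<Rightarrow> bool" where
  "weq v w \<longleftrightarrow> v \<in> wds \<and> w \<in> wds \<and> equivclp rewr v w"

lemma weq_refl [simp]: "weq w w \<longleftrightarrow> w \<in> wds"
  by (simp add: weq_def)

lemma weq_sym: "weq v w \<Longrightarrow> weq w v"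
  by (auto simp: weq_def intro: equivclp_sym)

lemma weq_trans [trans]: "weq u v \<Longrightarrow> weq v w \<Longrightarrow> weq u w"
  by (auto simp: weq_def intro: equivclp_trans)

lemma weq_wds: "weq v w \<Longrightarrow> v \<in> wds" "weq v w \<Longrightarrow> w \<in> wds"
  by (auto simp: weq_def)

lemma rewr_weq: "rewr v w \<Longrightarrow> weq v w"
  using rewr_props by (auto simp: weq_def)

text \<open>Serves to transport the endpoints and the normal form of a word to its class.\<close>

lemma weq_invariant:
  assumes "weq v w" "\<And>v w. rewr v w \<Longrightarrow> f v = f w"
  shows "f v = f w"
proof -
  have "equivclp rewr v w"
    using assms(1) by (simp add: weq_def)
  then show ?thesis
    by induction (use assms(2) in auto)
qed

lemma weq_ends: "weq v w \<Longrightarrow> wsrc v = wsrc w" "weq v w \<Longrightarrow> wtgt v = wtgt w"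
  using weq_invariant[of v w] rewr_props by blast+

lemma weq_context:
  assumes "weq v w" "a @ v @ b \<in> wds"
  shows "weq (a @ v @ b) (a @ w @ b)"
proof -
  have "equivclp rewr v w"
    using assms(1) by (simp add: weq_def)
  then show ?thesis
  proof induction
    case base
    then show ?case
      using assms(2) by simp
  next
    case (step y z)
    have "a @ y @ b \<in> wds"
      using step.IH by (rule weq_wds)
    show ?case
      using step.hyps(2)
    proof
      assume "rewr y z"
      then show ?thesis
        using step.IH rewr_weq[OF rewr_context] \<open>a @ y @ b \<in> wds\<close> by (blast intro: weq_trans)
    next
      assume r: "rewr z y"
      \<comment> \<open>In a backward step it has to be shown first that z fits into the context;
        its endpoints are those of y.\<close>
      then have "a @ z @ b \<in> wds"
        using wds_replace[OF \<open>a @ y @ b \<in> wds\<close>] rewr_props[OF r] by simp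
      then show ?thesis
        using step.IH rewr_weq[OF rewr_context[OF r]] by (blast intro: weq_trans weq_sym)
    qed
  qed
qed

lemma in_cls_iff: "x \<in> cls w \<longleftrightarrow> weq w x"
  by (auto simp: cls_def wcong_def weq_def)

lemma cls_eq_iff:
  assumes "v \<in> wds"
  shows "cls v = cls w \<longleftrightarrow> weq v w"
proof
  assume eq: "cls v = cls w"
  have "v \<in> cls v"
    using assms by (simp add: in_cls_iff)
  then have "v \<in> cls w"
    using eq by simp
  then show "weq v w"
    by (simp add: in_cls_iff weq_sym)
next
  assume "weq v w"
  then show "cls v = cls w"
    by (intro set_eqI) (metis in_cls_iff weq_sym weq_trans)
qed

lemma Lambda_eq: "Lambda = cls ` wds"
  by (auto simp: Lambda_def quotient_def cls_def)

lemma cls_Lambda [simp]: "w \<in> wds \<Longrightarrow> cls w \<in> Lambda"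
  by (simp add: Lambda_eq)


subsection \<open>The normal form\<close>

text \<open>The letters g_{i,j,n} with arbitrary integer n, before the index is reduced.\<close>

definition raw_edges :: "edge set" where
  "raw_edges = {(i, j, n). (i, j) \<in> Omega}"

lemma edges_raw: "edges \<subseteq> raw_edges"
  by (auto simp: edges_def raw_edges_def)

lemma act_fin_append:
  "act_fin t (I @ J) = (let (I', k) = act_fin t I; (J', c) = act_fin k J in (I' @ J', c))"
  by (induction I arbitrary: t) (auto split: prod.splits)

text \<open>The carry moves every index into the range 1 to A, so unreduced letters come out as
  edges; this is how \<open>act_fin 0\<close> normalizes.\<close>

lemma act_fin_edges:
  assumes "set J \<subseteq> raw_edges"
  shows "set (fst (act_fin t J)) \<subseteq> edges"
  using assms
proof (induction J arbitrary: t)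
  case (Cons e J)
  obtain i j n where e: "e = (i, j, n)" "(i, j) \<in> Omega"
    using Cons.prems by (cases e) (auto simp: raw_edges_def)
  obtain m k where mk: "carry t (i, j, n) = (m, k)" "(i, j, m) \<in> edges"
    using carryE[OF e(2)] by metis
  obtain J' c where J': "act_fin k J = (J', c)"
    by fastforce
  then have "set J' \<subseteq> edges"
    using Cons.IH[of k] Cons.prems by simp
  then show ?case
    by (simp add: e mk J')
qed simp

text \<open>The cocycle identity \<open>carry_add\<close>, propagated along a finite path.\<close>

lemma act_fin_add:
  assumes "set J \<subseteq> raw_edges" "act_fin t J = (J', c)" "act_fin s J' = (J'', c')"
  shows "act_fin (s + t) J = (J'', c + c')"
  using assms
proof (induction J arbitrary: s t J' J'' c c')
  case (Cons e J)
  obtain i j n where e: "e = (i, j, n)" "(i, j) \<in> Omega"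
    using Cons.prems by (cases e) (auto simp: raw_edges_def)
  obtain m k where mk: "carry t (i, j, n) = (m, k)"
    by fastforce
  obtain m' k' where mk': "carry s (i, j, m) = (m', k')"
    by fastforce
  obtain K where K: "act_fin k J = (K, c)" "J' = (i, j, m) # K"
    using Cons.prems(2) by (auto simp: e mk split: prod.splits)
  obtain L where L: "act_fin k' K = (L, c')" "J'' = (i, j, m') # L"
    using Cons.prems(3) by (auto simp: K mk' split: prod.splits)
  have "act_fin (k' + k) J = (L, c + c')"
    using Cons.IH[OF _ K(1) L(1)] Cons.prems(1) by simp
  then show ?case
    by (simp add: e carry_add[OF e(2) mk mk'] L add.commute)
qed auto

lemma act_fin_zero: "set J \<subseteq> edges \<Longrightarrow> act_fin 0 J = (J, 0)"
proof (induction J)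
  case (Cons e J)
  then show ?case
    by (cases e) (auto simp: carry_edge)
qed simp

text \<open>A pair (J, k) stands for s_J u^k. Each letter multiplies it from the left, and
  \<open>act_fin\<close> brings the result back into this form.\<close>

fun run :: "letter list \<Rightarrow> edge list \<times> int \<Rightarrow> edge list \<times> int" where
  "run [] p = p"
| "run (l # w) p = (let (J, k) = run w p;
     (J', c) = (case l of LH i \<Rightarrow> act_fin 1 J | LG i j n \<Rightarrow> act_fin 0 ((i, j, n) # J)) in (J', c + k))"

definition nf :: "letter list \<Rightarrow> edge list \<times> int" where
  "nf w = run w ([], 0)"

lemma run_append: "run (v @ w) p = run v (run w p)"
  by (induction v) auto

lemma run_edges:
  assumes "set w \<subseteq> alphabet" "set (fst p) \<subseteq> edges"
  shows "set (fst (run w p)) \<subseteq> edges"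
  using assms(1)
proof (induction w)
  case (Cons l w)
  then have IH: "set (fst (run w p)) \<subseteq> edges"
    by simp
  show ?case
  proof (cases l)
    case (LH i)
    have "set (fst (run w p)) \<subseteq> raw_edges"
      using IH edges_raw by (rule subset_trans)
    then show ?thesis
      using act_fin_edges[of "fst (run w p)" 1] LH by (simp add: case_prod_unfold Let_def)
  next
    case (LG i j n)
    then have "set ((i, j, n) # fst (run w p)) \<subseteq> raw_edges"
      using Cons.prems IH edges_raw by (auto simp: raw_edges_def)
    then show ?thesis
      using act_fin_edges[of "(i, j, n) # fst (run w p)" 0] LG
      by (auto split: prod.splits simp del: act_fin.simps)
  qed
qed (use assms(2) in simp)

lemma nf_edges: "w \<in> wds \<Longrightarrow> nf w = (I, k) \<Longrightarrow> set I \<subseteq> edges"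
  using run_edges[of w "([], 0)"] by (auto simp: nf_def wds_def)

text \<open>The product rule for normal forms: in s_I u^k s_J u^l the inner power is moved through J
  and its carry is added to l.\<close>

lemma run_eq:
  assumes "set v \<subseteq> alphabet" "set J \<subseteq> edges" "nf v = (I, k)" "act_fin k J = (J', c)"
  shows "run v (J, l) = (I @ J', c + l)"
  using assms(1,3,4)
proof (induction v arbitrary: I k J' c)
  case Nil
  then show ?case
    using act_fin_zero[OF assms(2)] by (simp add: nf_def)
next
  case (Cons x v)
  obtain I0 k0 where I0: "nf v = (I0, k0)"
    by fastforce
  obtain J0 c0 where J0: "act_fin k0 J = (J0, c0)"
    by fastforce
  have IH: "run v (J, l) = (I0 @ J0, c0 + l)"
    using Cons.IH[OF _ I0 J0] Cons.prems by simp
  have J: "set J \<subseteq> raw_edges"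
    using assms(2) edges_raw by auto
  \<comment> \<open>Treats both kinds of letters at once: h_i applies the power 1 and prepends
    nothing, g applies the power 0 after prepending itself.\<close>
  obtain t E where x: "(case x of LH i \<Rightarrow> act_fin 1 K | LG i j n \<Rightarrow> act_fin 0 ((i, j, n) # K)) = act_fin t (E @ K)" for K
  proof (cases x)
    case (LH i)
    then show thesis
      using that[of 1 "[]"] by simp
  next
    case (LG i j n)
    then show thesis
      using that[of 0 "[(i, j, n)]"] by simp
  qed
  obtain I1 k1 where I1: "act_fin t (E @ I0) = (I1, k1)"
    by fastforce
  have I: "I = I1" "k = k1 + k0"
    using Cons.prems(2) I0 I1 by (auto simp: nf_def x)
  obtain J1 c1 where J1: "act_fin k1 J0 = (J1, c1)"
    by fastforce
  have J': "J' = J1" "c = c0 + c1"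
    using act_fin_add[OF J J0 J1] Cons.prems(3) I by auto
  have "act_fin t (E @ I0 @ J0) = (I1 @ J1, c1)"
    using act_fin_append[of t "E @ I0" J0] I1 J1 by simp
  then show ?case
    using IH I J' by (simp add: x)
qed

text \<open>The two generating relations correspond to \<open>carry_shift_A\<close> and
  \<open>carry_shift_B\<close>; the context is handled by composition of runs.\<close>

lemma rewr_nf:
  assumes "rewr v w"
  shows "nf v = nf w"
  using assms
proof cases
  case (1 a i j n b)
  have ij: "(i, j) \<in> Omega" and b: "set b \<subseteq> alphabet"
    using 1(3) by (auto simp: wds_def)
  obtain J l where J: "nf b = (J, l)"
    by fastforce
  have Je: "set J \<subseteq> raw_edges"
    using run_edges[OF b, of "([], 0)"] J edges_raw by (auto simp: nf_def)
  obtain J1 c1 where J1: "act_fin 1 J = (J1, c1)"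
    by fastforce
  obtain m k where mk: "carry 0 (i, j, n) = (m, k)"
    by fastforce
  obtain J2 c2 where J2: "act_fin k J1 = (J2, c2)"
    by fastforce
  have "run [LG i j n, LH j] (J, l) = run [LG i j (n + int (A i j))] (J, l)"
    using act_fin_add[OF Je J1 J2] by (simp add: J1 mk J2 carry_shift_A[OF ij mk])
  then show ?thesis
    unfolding 1(1,2) nf_def run_append J[unfolded nf_def] by (rule arg_cong)
next
  case (2 a i j n b)
  have ij: "(i, j) \<in> Omega" and b: "set b \<subseteq> alphabet"
    using 2(3) by (auto simp: wds_def)
  obtain J l where J: "nf b = (J, l)"
    by fastforce
  have Je: "set ((i, j, n) # J) \<subseteq> raw_edges"
    using run_edges[OF b, of "([], 0)"] J edges_raw ij by (auto simp: nf_def raw_edges_def)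
  obtain J1 c1 where J1: "act_fin 0 ((i, j, n) # J) = (J1, c1)"
    by fastforce
  obtain J2 c2 where J2: "act_fin 1 J1 = (J2, c2)"
    by fastforce
  have "act_fin 0 ((i, j, n + B i j) # J) = act_fin 1 ((i, j, n) # J)"
    by (simp add: carry_shift_B)
  then have "run [LH i, LG i j n] (J, l) = run [LG i j (n + B i j)] (J, l)"
    using act_fin_add[OF Je J1 J2] by (simp add: J1 J2 del: act_fin.simps)
  then show ?thesis
    unfolding 2(1,2) nf_def run_append J[unfolded nf_def] by (rule arg_cong)
qed

lemma weq_nf: "weq v w \<Longrightarrow> nf v = nf w"
  by (erule weq_invariant) (rule rewr_nf)

text \<open>The last clause records that the semigroupoid has no units: an element without edges is
  a positive power of some h_i.\<close>

lemma nf_path: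
  assumes "w \<in> wds" "nf w = (I, k)"
  shows "path_to I (wtgt w)" "psrc I (wtgt w) = wsrc w" "I = [] \<Longrightarrow> k \<ge> 1"
proof -
  have "path_to I (wtgt w) \<and> psrc I (wtgt w) = wsrc w \<and> (I = [] \<longrightarrow> k \<ge> 1)"
    using wds_nonempty[OF assms(1)] assms
  proof (induction w arbitrary: I k rule: list_nonempty_induct)
    case (single l)
    show ?case
    proof (cases l)
      case (LH i)
      then show ?thesis
        using single by (auto simp: nf_def)
    next
      case (LG i j n)
      then have ij: "(i, j) \<in> Omega"
        using single by simp
      obtain m k' where mk: "carry 0 (i, j, n) = (m, k')" "(i, j, m) \<in> edges"
        using carryE[OF ij] by metis
      then show ?thesis
        using single LG ij by (auto simp: nf_def path_to_Cons OmegaD)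
    qed
  next
    case (cons l w)
    have w: "l \<in> alphabet" "w \<in> wds" "ltgt l = wsrc w"
      using cons by (auto simp: wds_Cons)
    obtain J r where J: "nf w = (J, r)"
      by fastforce
    note IH = cons.IH[OF w(2) J]
    show ?case
    proof (cases l)
      case (LH i)
      obtain J' c where J': "act_fin 1 J = (J', c)"
        by fastforce
      then have "I = J'" "k = c + r"
        using cons.prems(2) J LH by (auto simp: nf_def)
      moreover have "J' = [] \<Longrightarrow> J = [] \<and> c = 1"
        using J' by (cases J) (auto split: prod.splits)
      ultimately show ?thesis
        using IH act_fin_path(1,2)[OF _ J', of "wtgt w"] w cons.hyps LH by auto
    next
      case (LG i j n)
      then have ij: "(i, j) \<in> Omega"
        using w by simp
      obtain m k' where mk: "carry 0 (i, j, n) = (m, k')" "(i, j, m) \<in> edges"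
        using carryE[OF ij] by metis
      obtain J' c where J': "act_fin k' J = (J', c)"
        by fastforce
      then have "I = (i, j, m) # J'"
        using cons.prems(2) J LG mk by (auto simp: nf_def)
      then show ?thesis
        using IH act_fin_path(1,2)[OF _ J', of "wtgt w"] w cons.hyps LG mk by (auto simp: path_to_Cons)
    qed
  qed
  then show "path_to I (wtgt w)" "psrc I (wtgt w) = wsrc w" "I = [] \<Longrightarrow> k \<ge> 1"
    by auto
qed

lemma nf_replicate: "nf (replicate k (LH i)) = ([], int k)"
  by (induction k) (auto simp: nf_def)

lemma nf_map_edge:
  assumes "set L \<subseteq> raw_edges"
  shows "nf (map edge_letter L) = act_fin 0 L"
  using assms
proof (induction L)
  case (Cons e L)
  obtain i j n where e: "e = (i, j, n)" "(i, j) \<in> Omega"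
    using Cons.prems by (cases e) (auto simp: raw_edges_def)
  obtain m k where mk: "carry 0 (i, j, n) = (m, k)"
    by fastforce
  obtain J l where J: "act_fin 0 L = (J, l)"
    by fastforce
  obtain J' c where J': "act_fin k J = (J', c)"
    by fastforce
  have "act_fin k L = (J', l + c)"
    using act_fin_add[OF _ J J'] Cons.prems by simp
  then show ?case
    using Cons J J' by (simp add: nf_def e mk)
qed (simp add: nf_def)

text \<open>The power of u is moved into the last edge.\<close>

fun canon :: "nat \<Rightarrow> edge list \<Rightarrow> int \<Rightarrow> letter list" where
  "canon i [] k = replicate (nat k) (LH i)"
| "canon i [(a, b, n)] k = [LG a b (n + k * int (A a b))]"
| "canon i (e # f # I) k = edge_letter e # canon i (f # I) k"

lemma canon_nonempty: "I \<noteq> [] \<Longrightarrow> canon i I k \<noteq> []"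
  by (induction i I k rule: canon.induct) auto

lemma wds_replicate: "i \<in> V \<Longrightarrow> k \<noteq> 0 \<Longrightarrow> replicate k (LH i) \<in> wds \<and>
    wsrc (replicate k (LH i)) = i \<and> wtgt (replicate k (LH i)) = i"
proof (induction k)
  case (Suc k)
  then show ?case
    by (cases "k = 0") (auto simp: wds_Cons)
qed simp

text \<open>Every pair allowed by \<open>nf_path\<close> is a normal form. The multiple of A added
  to the last index is split off again by \<open>carry\<close>, which returns k as the
  quotient.\<close>

lemma canon_props:
  assumes "path_to I i" "I = [] \<Longrightarrow> k \<ge> 1"
  shows "canon i I k \<in> wds" "nf (canon i I k) = (I, k)" "wtgt (canon i I k) = i"
proof -
  have "canon i I k \<in> wds \<and> nf (canon i I k) = (I, k) \<and> wtgt (canon i I k) = i \<and>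
      wsrc (canon i I k) = psrc I i"
    using assms
  proof (induction i I k rule: canon.induct)
    case (1 i k)
    then show ?case
      using wds_replicate[of i "nat k"] nf_replicate[of "nat k" i] by simp
  next
    case (2 i a b n k)
    then have e: "(a, b, n) \<in> edges" "(a, b) \<in> Omega" "b = i"
      using edgesD(1)[of "(a, b, n)"] by (auto simp: path_to_Cons)
    have "carry 0 (a, b, n + k * int (A a b)) = (n, k)"
      using e by (intro carry_eqI) (auto simp: edges_def)
    then show ?case
      using e by (simp add: nf_def)
  next
    case (3 i e f I k)
    then have e: "e \<in> edges" "path_to (f # I) i" "etgt e = esrc f"
      by (auto simp: path_to_Cons)
    note IH = 3(1)[OF e(2)]
    have ne: "canon i (f # I) k \<noteq> []"
      by (rule canon_nonempty) simp
    have el: "edge_letter e \<in> alphabet"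
      using edgesD(1)[OF e(1)] by (cases e) auto
    have fI: "set (f # I) \<subseteq> edges"
      using e(2) by (simp add: path_to_def)
    have "act_fin 0 (e # f # I) = (e # f # I, 0)"
      using fI e(1) by (intro act_fin_zero) auto
    then have "nf (canon i (e # f # I) k) = (e # f # I, k)"
      using IH by (cases e) (simp add: nf_def del: act_fin.simps canon.simps(2) list.set)
    then show ?case
      using IH ne el e by (simp add: wds_Cons)
  qed
  then show "canon i I k \<in> wds" "nf (canon i I k) = (I, k)" "wtgt (canon i I k) = i"
    by auto
qed

lemma weq_Cons: "weq v w \<Longrightarrow> l # v \<in> wds \<Longrightarrow> weq (l # v) (l # w)"
  using weq_context[of v w "[l]" "[]"] by simp

text \<open>Both words arise from the one with \<open>LH j\<close> between the two letters, by
  absorbing it to the left or to the right.\<close>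

lemma weq_step:
  assumes "LG i j (n + int (A i j)) # LG j d n' # R \<in> wds"
  shows "weq (LG i j (n + int (A i j)) # LG j d n' # R) (LG i j n # LG j d (n' + B j d) # R)"
proof -
  have ij: "(i, j) \<in> Omega"
    using assms by (simp add: wds_Cons)
  have w: "LG i j n # LH j # LG j d n' # R \<in> wds"
    using assms OmegaD[OF ij] by (simp add: wds_Cons)
  have "rewr (LG i j n # LH j # LG j d n' # R) (LG i j (n + int (A i j)) # LG j d n' # R)"
    using rewr.intros(1)[of "[]" i j n "LG j d n' # R"] w by simp
  moreover have "rewr (LG i j n # LH j # LG j d n' # R) (LG i j n # LG j d (n' + B j d) # R)"
    using rewr.intros(2)[of "[LG i j n]" j d n' R] w by simp
  ultimately show ?thesis
    using rewr_weq by (blast intro: weq_trans weq_sym)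
qed

lemma wds_change:
  assumes "LG i j n # LG j d n' # R \<in> wds"
  shows "LG i j m # LG j d m' # R \<in> wds"
  using assms by (cases "R = []") (auto simp: wds_Cons)

text \<open>Negative k is reached by reading \<open>weq_step\<close> backwards. So between two edge
  letters powers of either sign can be moved, although h_j itself has no inverse.\<close>

lemma weq_shift:
  assumes "LG i j n # LG j d n' # R \<in> wds"
  shows "weq (LG i j (n + k * int (A i j)) # LG j d n' # R) (LG i j n # LG j d (n' + k * B j d) # R)"
proof (induction k arbitrary: n' rule: int_induct[of _ 0])
  case base
  show ?case
    using wds_change[OF assms] by simp
next
  case (step1 k)
  have "weq (LG i j (n + k * int (A i j) + int (A i j)) # LG j d n' # R)
      (LG i j (n + k * int (A i j)) # LG j d (n' + B j d) # R)"
    by (rule weq_step) (rule wds_change[OF assms])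
  also have "weq \<dots> (LG i j n # LG j d (n' + B j d + k * B j d) # R)"
    by (rule step1.IH)
  finally show ?case
    by (simp add: algebra_simps)
next
  case (step2 k)
  have "weq (LG i j (n + (k - 1) * int (A i j) + int (A i j)) # LG j d (n' - B j d) # R)
      (LG i j (n + (k - 1) * int (A i j)) # LG j d (n' - B j d + B j d) # R)"
    by (rule weq_step) (rule wds_change[OF assms])
  then have "weq (LG i j (n + (k - 1) * int (A i j)) # LG j d n' # R)
      (LG i j (n + k * int (A i j)) # LG j d (n' - B j d) # R)"
    by (simp add: algebra_simps weq_sym)
  also have "weq \<dots> (LG i j n # LG j d (n' - B j d + k * B j d) # R)"
    by (rule step2.IH)
  finally show ?case
    by (simp add: algebra_simps)
qed

text \<open>The quotient of the first index is pushed into the next letter. This changes the head of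
  the remaining list, so the induction is on the length.\<close>

lemma weq_canon_edges:
  assumes "L \<noteq> []" "map edge_letter L \<in> wds" "act_fin 0 L = (I, k)"
  shows "weq (map edge_letter L) (canon i I k)"
  using assms
proof (induction "length L" arbitrary: L I k)
  case (Suc len)
  obtain a b n L0 where L: "L = (a, b, n) # L0"
    using Suc.prems(1) by (cases L) auto
  have ab: "(a, b) \<in> Omega"
    using Suc.prems(2) by (cases "L0 = []") (auto simp: L wds_Cons)
  obtain m c where mk: "carry 0 (a, b, n) = (m, c)" "n + 0 * B a b = m + c * int (A a b)"
    using carryE[OF ab] by metis
  show ?case
  proof (cases L0)
    case Nil
    then show ?thesis
      using Suc.prems ab mk by (auto simp: L)
  next
    case (Cons f L')
    obtain d n' where f: "f = (b, d, n')"
      using Suc.prems(2) by (cases f) (auto simp: L Cons wds_Cons)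
    have w: "LG a b m # LG b d (n' + c * B b d) # map edge_letter L' \<in> wds"
      "LG a b m # LG b d n' # map edge_letter L' \<in> wds"
      using wds_change[of a b n d n' "map edge_letter L'"] Suc.prems(2) by (auto simp: L Cons f)
    \<comment> \<open>Pushing the quotient c into the index first and reducing afterwards is the
      same as acting by the power c.\<close>
    have c: "carry 0 (b, d, n' + c * B b d) = carry c (b, d, n')"
      by (simp add: carry_def)
    have "weq (map edge_letter L) (LG a b m # LG b d (n' + c * B b d) # map edge_letter L')"
      using weq_shift[OF w(2), of c] mk(2) by (simp add: L Cons f)
    also have "weq \<dots> (LG a b m # canon i (fst (act_fin c L0)) k)"
    proof (rule weq_Cons)
      have eq: "act_fin 0 ((b, d, n' + c * B b d) # L') = act_fin c L0"
        by (simp add: Cons f c)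
      have k: "snd (act_fin c L0) = k"
        using Suc.prems(3) mk by (auto simp: L split: prod.splits)
      show "weq (LG b d (n' + c * B b d) # map edge_letter L') (canon i (fst (act_fin c L0)) k)"
        using Suc.hyps(1)[of "(b, d, n' + c * B b d) # L'" "fst (act_fin c L0)" k] Suc.hyps(2) w(1)
        by (simp add: L Cons wds_Cons eq flip: k del: act_fin.simps)
    qed (rule w)
    also have "LG a b m # canon i (fst (act_fin c L0)) k = canon i I k"
    proof -
      have "fst (act_fin c L0) \<noteq> []"
        by (auto simp: Cons split: prod.splits)
      then have "LG a b m # canon i (fst (act_fin c L0)) k = canon i ((a, b, m) # fst (act_fin c L0)) k"
        by (cases "fst (act_fin c L0)") auto
      also have "(a, b, m) # fst (act_fin c L0) = I"
        using Suc.prems(3) mk by (auto simp: L split: prod.splits)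
      finally show ?thesis .
    qed
    finally show ?thesis .
  qed
qed simp

lemma weq_LG_replicate:
  assumes "(i, j) \<in> Omega"
  shows "weq (LG i j n # replicate k (LH j)) [LG i j (n + int k * int (A i j))]"
proof (induction k arbitrary: n)
  case 0
  then show ?case
    using assms by simp
next
  case (Suc k)
  have w: "LG i j n # LH j # replicate k (LH j) \<in> wds"
    using wds_replicate[of j "Suc k"] OmegaD[OF assms] assms wds_Cons[of "replicate (Suc k) (LH j)"]
    by (simp add: wsrc_def)
  have "weq (LG i j n # LH j # replicate k (LH j)) (LG i j (n + int (A i j)) # replicate k (LH j))"
    using rewr.intros(1)[of "[]" i j n "replicate k (LH j)"] w rewr_weq by simp
  also have "weq \<dots> [LG i j (n + int (A i j) + int k * int (A i j))]"
    by (rule Suc.IH)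
  finally show ?case
    by (simp add: algebra_simps)
qed

text \<open>As soon as an edge letter occurs, every h next to the edges is absorbed from one side or
  the other; otherwise the word is a power of one h_i.\<close>

lemma weq_cases:
  assumes "w \<in> wds"
  shows "(\<exists>k i. k \<noteq> 0 \<and> weq w (replicate k (LH i))) \<or> (\<exists>L. L \<noteq> [] \<and> weq w (map edge_letter L))"
  using wds_nonempty[OF assms] assms
proof (induction w rule: list_nonempty_induct)
  case (single l)
  show ?case
  proof (cases l)
    case (LH i)
    then have "weq [l] (replicate 1 (LH i))"
      using single by simp
    then show ?thesis
      by (metis one_neq_zero)
  next
    case (LG i j n)
    then have "weq [l] (map edge_letter [(i, j, n)])"
      using single by simp
    then show ?thesis
      by blast
  qed
next
  case (cons l w)
  then have w: "l \<in> alphabet" "w \<in> wds" "ltgt l = wsrc w"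
    by (auto simp: wds_Cons)
  from cons.IH[OF w(2)] show ?case
  proof
    assume "\<exists>k i. k \<noteq> 0 \<and> weq w (replicate k (LH i))"
    then obtain k i where k: "k \<noteq> 0" "weq w (replicate k (LH i))"
      by blast
    have eq: "weq (l # w) (l # replicate k (LH i))"
      using weq_Cons[OF k(2) cons.prems] .
    have "wsrc (replicate k (LH i)) = i"
      using k(1) by (cases k) auto
    then have i: "ltgt l = i"
      using weq_ends(1)[OF k(2)] w(3) by simp
    show ?thesis
    proof (cases l)
      case (LH i')
      then show ?thesis
        using eq i by (intro disjI1 exI[of _ "Suc k"] exI[of _ i]) simp
    next
      case (LG a b n)
      then have "weq (l # w) [LG a b (n + int k * int (A a b))]"
        using weq_trans[OF eq] weq_LG_replicate[of a b n k] w i by simp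
      then have "weq (l # w) (map edge_letter [(a, b, n + int k * int (A a b))])"
        by simp
      then show ?thesis
        by blast
    qed
  next
    assume "\<exists>L. L \<noteq> [] \<and> weq w (map edge_letter L)"
    then obtain L where L: "L \<noteq> []" "weq w (map edge_letter L)"
      by blast
    have eq: "weq (l # w) (l # map edge_letter L)"
      using weq_Cons[OF L(2) cons.prems] .
    show ?thesis
    proof (cases l)
      case (LH i)
      obtain a b n L' where L': "L = (a, b, n) # L'"
        using L(1) by (cases L) auto
      have "a = i"
        using weq_ends(1)[OF L(2)] w(3) by (simp add: LH L')
      then have "rewr (l # map edge_letter L) (map edge_letter ((a, b, n + B a b) # L'))"
        using rewr.intros(2)[of "[]" i b n "map edge_letter L'"] weq_wds(2)[OF eq] by (simp add: LH L')
      then have "weq (l # w) (map edge_letter ((a, b, n + B a b) # L'))"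
        using eq rewr_weq weq_trans by blast
      then show ?thesis
        by blast
    next
      case (LG a b n)
      then have "weq (l # w) (map edge_letter ((a, b, n) # L))"
        using eq by simp
      then show ?thesis
        by blast
    qed
  qed
qed

lemma map_edge_wds_raw: "map edge_letter L \<in> wds \<Longrightarrow> set L \<subseteq> raw_edges"
  by (auto simp: wds_def raw_edges_def edge_letter_def)

lemma weq_canon:
  assumes "w \<in> wds"
  shows "weq w (canon (wtgt w) (fst (nf w)) (snd (nf w)))"
  using weq_cases[OF assms]
proof
  assume "\<exists>k i. k \<noteq> 0 \<and> weq w (replicate k (LH i))"
  then obtain k i where k: "k \<noteq> 0" "weq w (replicate k (LH i))"
    by blast
  have "wtgt w = i"
    using weq_ends(2)[OF k(2)] k(1) by (simp add: wtgt_def)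
  then show ?thesis
    using k(2) weq_nf[OF k(2)] by (simp add: nf_replicate)
next
  assume "\<exists>L. L \<noteq> [] \<and> weq w (map edge_letter L)"
  then obtain L where L: "L \<noteq> []" "weq w (map edge_letter L)"
    by blast
  have "nf w = act_fin 0 L"
    using weq_nf[OF L(2)] nf_map_edge[OF map_edge_wds_raw[OF weq_wds(2)[OF L(2)]]] by simp
  then show ?thesis
    using weq_trans[OF L(2) weq_canon_edges[OF L(1) weq_wds(2)[OF L(2)]]] by simp
qed

text \<open>The target is compared separately because the normal form ([], k) does not record its
  vertex.\<close>

lemma weq_iff_nf:
  assumes "v \<in> wds" "w \<in> wds"
  shows "weq v w \<longleftrightarrow> nf v = nf w \<and> wtgt v = wtgt w"
proof
  assume "nf v = nf w \<and> wtgt v = wtgt w"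
  then show "weq v w"
    using weq_canon[OF assms(1)] weq_canon[OF assms(2)] by (metis weq_sym weq_trans)
qed (simp add: weq_nf weq_ends)

end

section \<open>Divisibility and the semilattice\<close>

lemma shift_eq_shift:
  assumes "I @- \<gamma> = J @- \<delta>" "length I \<le> length J"
  obtains K where "J = I @ K" "\<gamma> = K @- \<delta>"
proof -
  have "I = stake (length I) (J @- \<delta>)"
    using assms(1) by (metis append_Nil2 diff_self_eq_0 stake.simps(1) stake_shift take_all order_refl)
  then have "I = take (length I) J"
    using assms(2) by (simp add: stake_shift)
  then have J: "J = I @ drop (length I) J"
    by (metis append_take_drop_id)
  then have "I @- \<gamma> = I @- drop (length I) J @- \<delta>"
    using assms(1) by (metis shift_append)
  then show thesis
    using that J by (simp add: shift_left_inj)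
qed

context katsura_std
begin

lemma weq_append:
  assumes "weq v v'" "weq x x'" "v @ x \<in> wds"
  shows "weq (v @ x) (v' @ x')"
proof -
  have "weq (v @ x) (v' @ x)"
    using weq_context[OF assms(1), of "[]" x] assms(3) by simp
  also have "weq \<dots> (v' @ x')"
    using weq_context[OF assms(2), of v' "[]"] weq_wds(2)[OF calculation] by simp
  finally show ?thesis .
qed

lemma composable_cls:
  assumes "v \<in> wds" "x \<in> wds"
  shows "composable (cls v) (cls x) \<longleftrightarrow> wtgt v = wsrc x"
proof
  assume "composable (cls v) (cls x)"
  then obtain v' x' where *: "weq v v'" "weq x x'" "v' @ x' \<in> wds"
    by (auto simp: composable_def in_cls_iff)
  then have "wtgt v' = wsrc x'"
    using wds_append[of v' x'] weq_wds(2) wds_nonempty by blast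
  then show "wtgt v = wsrc x"
    using weq_ends[OF *(1)] weq_ends[OF *(2)] by simp
next
  assume "wtgt v = wsrc x"
  then have "v @ x \<in> wds"
    using assms wds_append[of v x] wds_nonempty by blast
  moreover have "v \<in> cls v" "x \<in> cls x"
    using assms by (simp_all add: in_cls_iff)
  ultimately show "composable (cls v) (cls x)"
    unfolding composable_def by blast
qed

lemma compL_cls:
  assumes "v @ x \<in> wds" "v \<in> wds" "x \<in> wds"
  shows "compL (cls v) (cls x) = cls (v @ x)"
proof -
  have "cls (v' @ x') = cls (v @ x)" if "v' \<in> cls v" "x' \<in> cls x" for v' x'
    using weq_append[of v v' x x'] that assms by (simp add: in_cls_iff cls_eq_iff[OF assms(1)] eq_commute[of _ "cls (v @ x)"])
  moreover have "v \<in> cls v" "x \<in> cls x"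
    using assms by (simp_all add: in_cls_iff)
  ultimately show ?thesis
    unfolding compL_def by blast
qed

text \<open>Divisibility in terms of normal forms. If edges are added, the powers are unconstrained,
  because the cofactor can be chosen to compensate for u^k. With equal paths a proper cofactor is a
  positive power of h_i, hence the comparison of k and l.\<close>

definition path_le :: "edge list \<Rightarrow> nat \<Rightarrow> int \<Rightarrow> edge list \<Rightarrow> nat \<Rightarrow> int \<Rightarrow> bool" where
  "path_le I i k J j l \<longleftrightarrow> (\<exists>K. K \<noteq> [] \<and> J = I @ K \<and> psrc K j = i) \<or> (I = J \<and> i = j \<and> k \<le> l)"

lemma nf_append:
  assumes "v \<in> wds" "x \<in> wds" "nf v = (I, k)" "nf x = (J, l)" "act_fin k J = (J', c)"
  shows "nf (v @ x) = (I @ J', c + l)"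
  using run_eq[OF _ nf_edges[OF assms(2,4)] assms(3,5), of l] assms
  by (simp add: nf_def run_append wds_def)

lemma act_fin_Nil_iff: "act_fin k J = (J', c) \<Longrightarrow> J' = [] \<longleftrightarrow> J = []"
  by (cases J) (auto split: prod.splits)

lemma divides_cls:
  assumes v: "v \<in> wds" "nf v = (I, k)" and w: "w \<in> wds" "nf w = (J, l)"
  shows "divides (cls v) (cls w) \<longleftrightarrow> path_le I (wtgt v) k J (wtgt w) l"
proof
  assume "divides (cls v) (cls w)"
  then consider "weq v w" | x where "x \<in> wds" "composable (cls v) (cls x)" "compL (cls v) (cls x) = cls w"
    by (auto simp: divides_def Lambda_sup_def Lambda_eq cls_eq_iff[OF v(1)])
  then show "path_le I (wtgt v) k J (wtgt w) l"
  proof cases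
    case 1
    then show ?thesis
      using weq_nf[OF 1] weq_ends[OF 1] v w by (simp add: path_le_def)
  next
    case 2
    have vx: "wtgt v = wsrc x" "v @ x \<in> wds"
      using composable_cls[OF v(1) 2(1)] 2 v wds_append[of v x] wds_nonempty by auto
    have "cls (v @ x) = cls w"
      using compL_cls[OF vx(2) v(1) 2(1)] 2(3) by simp
    then have "weq (v @ x) w"
      using cls_eq_iff[OF vx(2)] by blast
    then have nf: "nf (v @ x) = (J, l)" "wtgt w = wtgt x"
      using weq_nf[of "v @ x" w] weq_ends(2)[of "v @ x" w] w wds_nonempty[OF 2(1)] by simp_all
    obtain K0 r where x: "nf x = (K0, r)"
      by fastforce
    obtain K c where K: "act_fin k K0 = (K, c)"
      by fastforce
    have J: "J = I @ K" "l = c + r"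
      using nf_append[OF v(1) 2(1) v(2) x K] nf by auto
    note xp = nf_path[OF 2(1) x]
    show ?thesis
    proof (cases "K0 = []")
      case True
      then show ?thesis
        using J K xp vx nf by (auto simp: path_le_def)
    next
      case False
      then have "K \<noteq> []"
        using act_fin_Nil_iff[OF K] by simp
      moreover have "psrc K (wtgt w) = wtgt v"
        using act_fin_path(2)[OF xp(1) K] xp(2) vx nf by simp
      ultimately show ?thesis
        using J by (auto simp: path_le_def)
    qed
  qed
next
  assume le: "path_le I (wtgt v) k J (wtgt w) l"
  have *: "divides (cls v) (cls w)" if "x \<in> wds" "wtgt v = wsrc x" "nf (v @ x) = (J, l)" "wtgt x = wtgt w" for x
  proof -
    have vx: "v @ x \<in> wds"
      using that(1,2) v(1) wds_append[of v x] wds_nonempty by blast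
    have "cls (v @ x) = cls w"
      using that w vx wds_nonempty by (simp add: cls_eq_iff weq_iff_nf)
    moreover have "cls x \<in> Lambda_sup (cls v)"
      using that v by (simp add: Lambda_sup_def composable_cls)
    ultimately show ?thesis
      using compL_cls[OF vx v(1) that(1)] unfolding divides_def by metis
  qed
  from le consider K where "K \<noteq> []" "J = I @ K" "psrc K (wtgt w) = wtgt v"
    | "I = J" "wtgt v = wtgt w" "k = l" | "I = J" "wtgt v = wtgt w" "k < l"
    by (fastforce simp: path_le_def)
  then show "divides (cls v) (cls w)"
  proof cases
    case 1
    have K: "path_to K (wtgt w)"
      using nf_path(1)[OF w] 1 by (simp add: path_to_append)
    \<comment> \<open>The cofactor has the path u^(-k) K, so that u^k turns it back into K. This
      produces the carry -c0, which the power l + c0 of the cofactor corrects to l.\<close>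
    obtain K0 c0 where K0: "act_fin (- k) K = (K0, c0)"
      by fastforce
    obtain K1 c1 where K1: "act_fin k K0 = (K1, c1)"
      by fastforce
    have Ke: "set K \<subseteq> edges"
      using K by (simp add: path_to_def)
    then have "act_fin (k + - k) K = (K1, c0 + c1)"
      using act_fin_add[OF _ K0 K1] edges_raw by blast
    then have K1': "K1 = K" "c1 = - c0"
      using act_fin_zero[OF Ke] by auto
    have "K0 \<noteq> []"
      using act_fin_Nil_iff[OF K0] 1 by simp
    note x = canon_props[OF act_fin_path(1)[OF K K0], of "l + c0"]
    show ?thesis
    proof (rule *)
      show "canon (wtgt w) K0 (l + c0) \<in> wds" "wtgt (canon (wtgt w) K0 (l + c0)) = wtgt w"
        using x \<open>K0 \<noteq> []\<close> by auto
      then show "wtgt v = wsrc (canon (wtgt w) K0 (l + c0))"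
        using nf_path(2)[of "canon (wtgt w) K0 (l + c0)" K0 "l + c0"] x act_fin_path(2)[OF K K0] 1 \<open>K0 \<noteq> []\<close>
        by simp
      show "nf (v @ canon (wtgt w) K0 (l + c0)) = (J, l)"
        using nf_append[OF v(1) _ v(2) _ K1, of "canon (wtgt w) K0 (l + c0)" "l + c0"] x \<open>K0 \<noteq> []\<close> K1' 1
        by simp
    qed
  next
    case 2
    then have "cls v = cls w"
      using v w by (simp add: cls_eq_iff weq_iff_nf)
    then show ?thesis
      by (simp add: divides_def)
  next
    case 3
    \<comment> \<open>The cofactor is the power of h with exponent l - k, which is positive
      here.\<close>
    have x: "canon (wtgt w) [] (l - k) \<in> wds" "nf (canon (wtgt w) [] (l - k)) = ([], l - k)"
      "wtgt (canon (wtgt w) [] (l - k)) = wtgt w"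
      using canon_props[of "[]" "wtgt w" "l - k"] wds_V(2)[OF w(1)] 3 by (auto simp del: canon.simps)
    show ?thesis
    proof (rule *[OF x(1) _ _ x(3)])
      show "wtgt v = wsrc (canon (wtgt w) [] (l - k))"
        using nf_path(2)[OF x(1,2)] x(3) 3 by simp
      show "nf (v @ canon (wtgt w) [] (l - k)) = (J, l)"
        using nf_append[OF v(1) x(1) v(2) x(2), of "[]" k] 3 by simp
    qed
  qed
qed

lemma divides_antisym:
  assumes "f \<in> Lambda" "g \<in> Lambda" "divides f g" "divides g f"
  shows "f = g"
proof -
  obtain v w where v: "f = cls v" "v \<in> wds" and w: "g = cls w" "w \<in> wds"
    using assms by (auto simp: Lambda_eq)
  obtain I k where I: "nf v = (I, k)"
    by fastforce
  obtain J l where J: "nf w = (J, l)"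
    by fastforce
  have "path_le I (wtgt v) k J (wtgt w) l" "path_le J (wtgt w) l I (wtgt v) k"
    using assms divides_cls[OF v(2) I w(2) J] divides_cls[OF w(2) J v(2) I] v w by auto
  then have "I = J \<and> wtgt v = wtgt w \<and> k = l"
    by (auto simp: path_le_def)
  then show ?thesis
    using v w I J by (simp add: cls_eq_iff weq_iff_nf)
qed

text \<open>Elements with a common multiple turn out to be comparable, so this determines
  \<open>lcmL\<close> wherever \<open>meet\<close> uses it.\<close>

lemma lcmL_divides:
  assumes "f \<in> Lambda" "g \<in> Lambda" "divides f g"
  shows "lcmL f g = g" "lcmL g f = g"
proof -
  have "divides g g"
    by (simp add: divides_def)
  then have eq: "common_mult f g g" "common_mult g f g"
    using assms by (auto simp: common_mult_def)
  have "lcmL x y = g" if "common_mult x y g" "{x, y} = {f, g}" for x y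
    unfolding lcmL_def
  proof (rule the_equality)
    show "common_mult x y g \<and> (\<forall>m'. common_mult x y m' \<longrightarrow> divides g m')"
      using that by (auto simp: common_mult_def doubleton_eq_iff)
  next
    fix m
    assume m: "common_mult x y m \<and> (\<forall>m'. common_mult x y m' \<longrightarrow> divides m m')"
    then have "m \<in> Lambda" "divides m g" "divides g m"
      using that by (auto simp: common_mult_def doubleton_eq_iff)
    then show "m = g"
      using divides_antisym assms(2) by blast
  qed
  from this[OF eq(1)] this[OF eq(2)] show "lcmL f g = g" "lcmL g f = g"
    by (simp_all add: insert_commute)
qed

section \<open>Cylinders of the elements of the semilattice\<close>

text \<open>The power in the normal form is dropped: as u permutes the paths starting at a vertex,
  the range of \<open>tau f\<close> is the whole cylinder. The normal form does not depend on the
  chosen representative.\<close>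

primrec cyl :: "semilat \<Rightarrow> edge stream set" where
  "cyl ZeroE = {}"
| "cyl (PE f) = (let w = (SOME w. w \<in> f) in cylinder (fst (nf w)) (wtgt w))"
| "cyl (QE i) = X_at i"

lemma cyl_PE:
  assumes "w \<in> wds"
  shows "cyl (PE (cls w)) = cylinder (fst (nf w)) (wtgt w)"
proof -
  have "(SOME x. x \<in> cls w) \<in> cls w"
    by (rule someI[of "\<lambda>x. x \<in> cls w" w]) (simp add: in_cls_iff assms)
  then have *: "weq w (SOME x. x \<in> cls w)"
    by (simp add: in_cls_iff)
  show ?thesis
    by (simp add: Let_def weq_nf[OF *, symmetric] weq_ends(2)[OF *, symmetric])
qed

declare cyl.simps(2) [simp del]

lemma cylinder_Nil: "cylinder [] i = X_at i"
  by (simp add: cylinder_eq)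

lemma cylinder_append: "path_to (I @ K) j \<Longrightarrow> cylinder (I @ K) j \<subseteq> cylinder I (psrc K j)"
  unfolding cylinder_eq path_to_append
  by (auto simp: X_at_shift)

lemma cylinder_meet:
  assumes I: "path_to I i" and J: "path_to J j" and \<gamma>: "\<gamma> \<in> cylinder I i" "\<gamma> \<in> cylinder J j"
    and le: "length I \<le> length J"
  obtains K where "J = I @ K" "psrc K j = i"
proof -
  obtain \<gamma>1 where g1: "\<gamma> = I @- \<gamma>1" "\<gamma>1 \<in> X_at i"
    using \<gamma>(1) by (auto simp: cylinder_eq)
  obtain \<gamma>2 where g2: "\<gamma> = J @- \<gamma>2" "\<gamma>2 \<in> X_at j"
    using \<gamma>(2) by (auto simp: cylinder_eq)
  note g = g1 g2
  obtain K where K: "J = I @ K" "\<gamma>1 = K @- \<gamma>2"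
    using shift_eq_shift[of I \<gamma>1 J \<gamma>2] g le by metis
  then have "psrc K j = i"
    using g by (auto simp: psrc_def X_at_def)
  then show thesis
    using that K by blast
qed

lemma path_le_cylinder:
  assumes "path_to J j" "path_le I i k J j l"
  shows "cylinder J j \<subseteq> cylinder I i"
  using assms cylinder_append by (auto simp: path_le_def)

text \<open>Two initial segments of one infinite path are comparable; if they are equal, the powers
  are compared as integers.\<close>

lemma path_le_total:
  assumes I: "path_to I i" and J: "path_to J j" and \<gamma>: "\<gamma> \<in> cylinder I i" "\<gamma> \<in> cylinder J j"
  shows "path_le I i k J j l \<or> path_le J j l I i k"
proof (cases "length I \<le> length J")
  case True
  then obtain K where "J = I @ K" "psrc K j = i"
    using cylinder_meet[OF I J \<gamma>] by metis
  then show ?thesis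
    by (cases "K = []") (auto simp: path_le_def)
next
  case False
  then obtain K where "I = J @ K" "psrc K i = j"
    using cylinder_meet[OF J I \<gamma>(2,1)] by (metis nat_le_linear)
  then show ?thesis
    by (cases "K = []") (auto simp: path_le_def)
qed

lemma E_cases:
  assumes "e \<in> E"
  obtains "e = ZeroE" | w where "e = PE (cls w)" "w \<in> wds" | i where "e = QE i" "i \<in> V"
  using assms by (auto simp: E_def Lambda_eq)

lemma PE_E [simp]: "w \<in> wds \<Longrightarrow> PE (cls w) \<in> E"
  and QE_E [simp]: "i \<in> V \<Longrightarrow> QE i \<in> E"
  and ZeroE_E [simp]: "ZeroE \<in> E"
  by (auto simp: E_def)

lemma cyl_path:
  assumes "e \<in> E" "e \<noteq> ZeroE"
  obtains I i where "path_to I i" "cyl e = cylinder I i"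
  using assms(1)
proof (cases rule: E_cases)
  case (2 w)
  then show thesis
    using that[of "fst (nf w)" "wtgt w"] nf_path(1)[of w] cyl_PE by (cases "nf w") auto
next
  case (3 i)
  then show thesis
    using that[of "[]" i] by (simp add: cylinder_Nil)
qed (use assms in auto)

lemma cyl_nonempty: "e \<in> E \<Longrightarrow> e \<noteq> ZeroE \<Longrightarrow> cyl e \<noteq> {}"
  by (metis cyl_path cylinder_nonempty)

lemma cylinder_X_A: "path_to I i \<Longrightarrow> cylinder I i \<subseteq> X_A"
  using cylinder_subset by (auto simp: X_at_def)

lemma cyl_X_A: "e \<in> E \<Longrightarrow> cyl e \<subseteq> X_A"
  by (cases "e = ZeroE") (auto elim!: cyl_path dest: cylinder_X_A[THEN subsetD])

lemma Lambda_sup_LH: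
  assumes "w \<in> wds" "i \<in> V"
  shows "cls w \<in> Lambda_sup (cls [LH i]) \<longleftrightarrow> wsrc w = i"
  using assms composable_cls[of "[LH i]" w] by (auto simp: Lambda_sup_def)

lemma cyl_PE_subset:
  assumes "w \<in> wds"
  shows "cyl (PE (cls w)) \<subseteq> X_at (wsrc w)"
  using nf_path(1,2)[OF assms, of "fst (nf w)" "snd (nf w)"] cylinder_subset
  unfolding cyl_PE[OF assms] by fastforce

lemma cyl_PE_X_at:
  assumes "w \<in> wds" "i \<in> V"
  shows "cyl (if cls w \<in> Lambda_sup (cls [LH i]) then PE (cls w) else ZeroE) = cyl (PE (cls w)) \<inter> X_at i"
  using cyl_PE_subset[OF assms(1)] by (auto simp: Lambda_sup_LH[OF assms] X_at_def)

text \<open>If the cylinders meet, one element divides the other and the multiple is the lcm. If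
  they are disjoint, a common multiple would have a nonempty cylinder inside both.\<close>

lemma meet_props:
  assumes "e \<in> E" "e' \<in> E"
  shows "meet e e' \<in> E \<and> cyl (meet e e') = cyl e \<inter> cyl e'"
  using assms(1)
proof (cases rule: E_cases)
  case e: (2 v)
  show ?thesis
    using assms(2)
  proof (cases rule: E_cases)
    case e': (2 w)
    obtain I k where I: "nf v = (I, k)"
      by fastforce
    obtain J l where J: "nf w = (J, l)"
      by fastforce
    note Ip = nf_path(1)[OF e(2) I] and Jp = nf_path(1)[OF e'(2) J]
    have cyl: "cyl e = cylinder I (wtgt v)" "cyl e' = cylinder J (wtgt w)"
      using cyl_PE e e' I J by auto
    note dvw = divides_cls[OF e(2) I e'(2) J] and dwv = divides_cls[OF e'(2) J e(2) I]
    have refl: "divides f f" for f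
      by (simp add: divides_def)
    consider "divides (cls v) (cls w)" | "divides (cls w) (cls v)" | "cyl e \<inter> cyl e' = {}"
      using path_le_total[OF Ip Jp] unfolding cyl dvw dwv by blast
    then show ?thesis
    proof cases
      case 1
      then have "common_mult (cls v) (cls w) (cls w)"
        using e' refl by (simp add: common_mult_def)
      then have "meet e e' = e'"
        using e e' lcmL_divides(1)[OF _ _ 1] by auto
      moreover have "cyl e' \<subseteq> cyl e"
        using path_le_cylinder[OF Jp] 1 unfolding cyl dvw by blast
      ultimately show ?thesis
        using assms by auto
    next
      case 2
      then have "common_mult (cls v) (cls w) (cls v)"
        using e refl by (simp add: common_mult_def)
      then have "meet e e' = e"
        using e e' lcmL_divides(2)[OF _ _ 2] by auto
      moreover have "cyl e \<subseteq> cyl e'"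
        using path_le_cylinder[OF Ip] 2 unfolding cyl dwv by blast
      ultimately show ?thesis
        using assms by auto
    next
      case 3
      have "\<not> common_mult (cls v) (cls w) m" for m
      proof
        assume m: "common_mult (cls v) (cls w) m"
        then obtain x where x: "m = cls x" "x \<in> wds"
          by (auto simp: common_mult_def Lambda_eq)
        obtain K r where K: "nf x = (K, r)"
          by fastforce
        note Kp = nf_path(1)[OF x(2) K]
        have "path_le I (wtgt v) k K (wtgt x) r" "path_le J (wtgt w) l K (wtgt x) r"
          using m divides_cls[OF e(2) I x(2) K] divides_cls[OF e'(2) J x(2) K]
          by (auto simp: common_mult_def x)
        then have "cylinder K (wtgt x) \<subseteq> cyl e \<inter> cyl e'"
          using path_le_cylinder[OF Kp] unfolding cyl by blast
        then show False
          using 3 cylinder_nonempty[OF Kp] by auto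
      qed
      then have "meet e e' = ZeroE"
        unfolding e e' meet.simps by (intro if_not_P) blast
      then show ?thesis
        using 3 by simp
    qed
  next
    case (3 i)
    then show ?thesis
      using e cyl_PE_X_at[OF e(2) 3(2)] by simp
  qed (use e in auto)
next
  case e: (3 i)
  show ?thesis
    using assms(2)
  proof (cases rule: E_cases)
    case (2 w)
    then show ?thesis
      using e cyl_PE_X_at[OF 2(2) e(2)] by (auto simp: Int_commute)
  next
    case (3 j)
    then show ?thesis
      using e by (auto simp: X_at_def)
  qed (use e in auto)
qed (cases e'; simp)

lemma canon_zero: "I \<noteq> [] \<Longrightarrow> canon i I 0 = map edge_letter I"
  by (induction i I "0 :: int" rule: canon.induct) auto

text \<open>A distinguished element among those sharing the cylinder of I. For nonempty I it is the
  p_f tested by \<open>stem_limit\<close>.\<close>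

definition node :: "edge list \<Rightarrow> nat \<Rightarrow> semilat" where
  "node I i = (if I = [] then QE i else PE (cls (map edge_letter I)))"

lemma node_props:
  assumes "path_to I i"
  shows "node I i \<in> E" "cyl (node I i) = cylinder I i"
proof -
  have "node I i \<in> E \<and> cyl (node I i) = cylinder I i"
  proof (cases "I = []")
    case True
    then show ?thesis
      using assms by (simp add: node_def cylinder_Nil)
  next
    case False
    then have "canon i I 0 \<in> wds" "nf (canon i I 0) = (I, 0)" "wtgt (canon i I 0) = i"
      using canon_props[OF assms, of 0] by auto
    then show ?thesis
      using cyl_PE[of "canon i I 0"] False by (simp add: node_def canon_zero)
  qed
  then show "node I i \<in> E" "cyl (node I i) = cylinder I i"
    by auto
qed


subsection \<open>The idempotents\<close>

definition letterO :: "letter \<Rightarrow> (nat \<Rightarrow> falg) set" where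
  "letterO l = (case l of LH i \<Rightarrow> uO i | LG i j n \<Rightarrow> sO i j n)"

text \<open>The normal form computed in the semigroupoid is valid in the algebra: (I, k) is the
  product s_I u^k. This makes \<open>tau\<close> well defined.\<close>

lemma word_value:
  assumes "w \<in> wds" "nf w = (I, k)"
  shows "prodO (map letterO w) = sprodO I (wtgt w) \<cdot> upowO (wtgt w) k"
  using wds_nonempty[OF assms(1)] assms
proof (induction w arbitrary: I k rule: list_nonempty_induct)
  case (single l)
  show ?case
  proof (cases l)
    case (LH i)
    then show ?thesis
      using single by (auto simp: nf_def letterO_def upowO_one)
  next
    case (LG i j n)
    then have ij: "(i, j) \<in> Omega"
      using single by simp
    obtain m k' where mk: "carry 0 (i, j, n) = (m, k')" "(i, j, m) \<in> edges"
      using carryE[OF ij] by metis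
    then have "I = [(i, j, m)]" "k = k'"
      using single LG by (auto simp: nf_def)
    then show ?thesis
      using upowO_sO_carry[OF ij mk(1)] ij LG OmegaD[OF ij] mk
      by (simp add: letterO_def sprodO_Cons path_to_Cons sE_def)
  qed
next
  case (cons l w)
  have w: "l \<in> alphabet" "w \<in> wds" "ltgt l = wsrc w"
    using cons by (auto simp: wds_Cons)
  define i where "i = wtgt w"
  have i: "i \<in> V"
    using wds_V[OF w(2)] by (simp add: i_def)
  obtain J r where J: "nf w = (J, r)"
    by fastforce
  have IH: "prodO (map letterO w) = sprodO J i \<cdot> upowO i r"
    using cons.IH[OF w(2) J] by (simp add: i_def)
  have Jp: "path_to J i" "psrc J i = wsrc w"
    using nf_path[OF w(2) J] by (auto simp: i_def)
  have prod: "prodO (map letterO (l # w)) = letterO l \<cdot> (sprodO J i \<cdot> upowO i r)"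
    using cons.hyps IH by (simp add: prodO_Cons)
  have act: "upowO (wsrc w) t \<cdot> (sprodO J i \<cdot> upowO i r) = sprodO J' i \<cdot> upowO i (c + r)"
    if "act_fin t J = (J', c)" for t J' c
  proof -
    have "upowO (wsrc w) t \<cdot> (sprodO J i \<cdot> upowO i r) = (sprodO J' i \<cdot> upowO i c) \<cdot> upowO i r"
      using act_fin_path(3)[OF Jp(1) that] Jp i wds_V[OF w(2)] by (intro mulO_absorb) auto
    then show ?thesis
      using act_fin_path(1)[OF Jp(1) that] i upowO_add[OF i] by simp
  qed
  show ?case
  proof (cases l)
    case (LH a)
    obtain J' c where J': "act_fin 1 J = (J', c)"
      by fastforce
    then have "I = J'" "k = c + r"
      using cons.prems(2) J LH by (auto simp: nf_def)
    moreover have "letterO l = upowO (wsrc w) 1"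
      using w(3) by (simp add: LH letterO_def upowO_one)
    ultimately show ?thesis
      using act[OF J'] cons.hyps unfolding prod by (simp add: i_def)
  next
    case (LG a b n)
    then have ab: "(a, b) \<in> Omega"
      using w by simp
    obtain m k' where mk: "carry 0 (a, b, n) = (m, k')" "(a, b, m) \<in> edges"
      using carryE[OF ab] by metis
    obtain J' c where J': "act_fin k' J = (J', c)"
      by fastforce
    have b: "b = wsrc w"
      using w LG by simp
    have I: "I = (a, b, m) # J'" "k = c + r"
      using cons.prems(2) J LG mk J' by (auto simp: nf_def)
    have J'p: "path_to J' i" "psrc J' i = b"
      using act_fin_path(1,2)[OF Jp(1) J'] Jp b by auto
    then have Ip: "path_to I i"
      using mk by (simp add: I path_to_Cons)
    have "sO a b n = sO a b m \<cdot> upowO b k'"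
      using upowO_sO_carry[OF ab mk(1)] ab OmegaD by simp
    then have "prodO (map letterO (l # w)) = sO a b m \<cdot> (upowO b k' \<cdot> (sprodO J i \<cdot> upowO i r))"
      unfolding prod using ab OmegaD Jp i by (simp add: LG letterO_def)
    also have "\<dots> = sO a b m \<cdot> (sprodO J' i \<cdot> upowO i (c + r))"
      using act[OF J'] b by simp
    also have "\<dots> = sprodO I i \<cdot> upowO i k"
      using Ip J'p ab i by (simp add: I sprodO_Cons sE_def)
    finally show ?thesis
      using cons.hyps by (simp add: i_def)
  qed
qed

lemma tau_cls:
  assumes w: "w \<in> wds" "nf w = (I, k)"
  shows "tau (cls w) = sprodO I (wtgt w) \<cdot> upowO (wtgt w) k"
proof -
  have "prodO (map letterO v) = sprodO I (wtgt w) \<cdot> upowO (wtgt w) k" if "v \<in> cls w" for v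
  proof -
    have *: "weq w v"
      using that by (simp add: in_cls_iff)
    show ?thesis
      using word_value[OF weq_wds(2)[OF *], of I k] weq_nf[OF *] weq_ends(2)[OF *] w by simp
  qed
  moreover have "w \<in> cls w"
    using w by (simp add: in_cls_iff)
  moreover have "letterO = (\<lambda>l. case l of LH i \<Rightarrow> uO i | LG i j n \<Rightarrow> sO i j n)"
    by (rule ext) (rule letterO_def)
  ultimately show ?thesis
    unfolding tau_def by (intro the_equality) metis+
qed

text \<open>The power of u cancels against its adjoint, so the idempotent depends on the path
  alone.\<close>

lemma img_PE:
  assumes w: "w \<in> wds" "nf w = (I, k)"
  shows "img (PE (cls w)) = sprodO I (wtgt w) \<cdot> adjO (sprodO I (wtgt w))"
proof -
  define i where "i = wtgt w"
  have i: "i \<in> V" "path_to I i"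
    using wds_V[OF w(1)] nf_path(1)[OF w] by (auto simp: i_def)
  have "img (PE (cls w)) = sprodO I i \<cdot> (upowO i k \<cdot> upowO i (- k) \<cdot> adjO (sprodO I i))"
    using i by (simp add: tau_cls[OF w, folded i_def])
  then show ?thesis
    using i upowO_add[of i k "- k"] by (simp add: i_def)
qed

lemma img_props:
  assumes "e \<in> E"
  shows "img e \<in> projs" "pact (img e) \<gamma> = (if \<gamma> \<in> cyl e then Some \<gamma> else None)"
proof -
  have "img e \<in> projs \<and> pact (img e) \<gamma> = (if \<gamma> \<in> cyl e then Some \<gamma> else None)"
    using assms
  proof (cases rule: E_cases)
    case 1
    then show ?thesis
      by (simp add: projs_def)
  next
    case (2 w)
    obtain I k where I: "nf w = (I, k)"
      by fastforce
    note Ip = nf_path(1)[OF 2(2) I]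
    show ?thesis
      using pact_proj[OF Ip] Ip I cyl_PE[OF 2(2)] unfolding 2(1) img_PE[OF 2(2) I]
      by (auto simp: projs_def)
  next
    case (3 i)
    have "qO i = sprodO [] i \<cdot> adjO (sprodO [] i)" "path_to [] i"
      using 3 by auto
    then have "qO i \<in> projs"
      unfolding projs_def by blast
    then show ?thesis
      using 3 by (simp add: pact_qO)
  qed
  then show "img e \<in> projs" "pact (img e) \<gamma> = (if \<gamma> \<in> cyl e then Some \<gamma> else None)"
    by auto
qed

lemma projs_img:
  assumes "a \<in> projs"
  shows "\<exists>e\<in>E. img e = a"
proof (cases "a = zeroO")
  case True
  then show ?thesis
    by (intro bexI[of _ ZeroE]) auto
next
  case False
  then obtain K k where K: "path_to K k" "a = sprodO K k \<cdot> adjO (sprodO K k)"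
    using assms by (auto simp: projs_def)
  show ?thesis
  proof (cases "K = []")
    case True
    then show ?thesis
      using K by (intro bexI[of _ "QE k"]) auto
  next
    case False
    note w = canon_props[OF K(1), of 0]
    then show ?thesis
      using False K img_PE[of "canon k K 0" K 0] by (intro bexI[of _ "PE (cls (canon k K 0))"]) auto
  qed
qed

end

section \<open>Filters and tight characters\<close>

context katsura_std
begin

definition filt :: "edge stream \<Rightarrow> semilat set" where
  "filt \<gamma> = {e \<in> E. \<gamma> \<in> cyl e}"

lemma filt_filter:
  assumes "\<gamma> \<in> X_A"
  shows "is_filter (filt \<gamma>)"
proof -
  have \<gamma>: "\<gamma> \<in> X_at (esrc (shd \<gamma>))"
    using assms by (simp add: X_at_def)
  then have "QE (esrc (shd \<gamma>)) \<in> filt \<gamma>"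
    using X_at_V by (simp add: filt_def)
  moreover have "e' \<in> filt \<gamma>" if "e \<in> filt \<gamma>" "e' \<in> E" "below e e'" for e e'
    using that meet_props[of e e'] by (auto simp: filt_def below_def)
  moreover have "meet e e' \<in> filt \<gamma>" if "e \<in> filt \<gamma>" "e' \<in> filt \<gamma>" for e e'
    using that meet_props[of e e'] by (auto simp: filt_def)
  moreover have "ZeroE \<notin> filt \<gamma>" "filt \<gamma> \<subseteq> E"
    by (auto simp: filt_def)
  ultimately show ?thesis
    unfolding is_filter_def by blast
qed

lemma stake_path:
  assumes "\<gamma> \<in> X_A"
  shows "path_to (stake n \<gamma>) (esrc (\<gamma> !! n))" "\<gamma> \<in> cylinder (stake n \<gamma>) (esrc (\<gamma> !! n))"
proof -
  have "stake n \<gamma> @- sdrop n \<gamma> \<in> X_at (esrc (shd \<gamma>))"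
    using assms by (simp add: stake_sdrop X_at_def)
  then obtain i where i: "sdrop n \<gamma> \<in> X_at i" "path_to (stake n \<gamma>) i"
    by (auto simp: X_at_shift)
  then have eq: "i = esrc (\<gamma> !! n)"
    by (simp add: X_at_def)
  show "path_to (stake n \<gamma>) (esrc (\<gamma> !! n))"
    using i eq by simp
  show "\<gamma> \<in> cylinder (stake n \<gamma>) (esrc (\<gamma> !! n))"
    using i eq stake_sdrop[of n \<gamma>] unfolding cylinder_eq by (metis (mono_tags, lifting) mem_Collect_eq)
qed

lemma cylinder_stake:
  assumes "path_to I i" "\<gamma> \<in> cylinder I i"
  shows "I = stake (length I) \<gamma>" "i = esrc (\<gamma> !! length I)"
proof -
  obtain \<gamma>' where \<gamma>': "\<gamma> = I @- \<gamma>'" "\<gamma>' \<in> X_at i"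
    using assms by (auto simp: cylinder_eq)
  then show "I = stake (length I) \<gamma>"
    by (simp add: stake_shift)
  show "i = esrc (\<gamma> !! length I)"
    using \<gamma>' by (simp add: X_at_def)
qed

lemma cylinder_nth: "\<gamma> \<in> cylinder I i \<Longrightarrow> k < length I \<Longrightarrow> \<gamma> !! k = I ! k"
  by (auto simp: cylinder_eq)

text \<open>The nodes of the initial segments determine an infinite path; this gives maximality of
  the filters \<open>filt \<gamma>\<close>.\<close>

lemma filt_subset_eq:
  assumes "\<gamma> \<in> X_A" "filt \<gamma> \<subseteq> filt \<delta>"
  shows "\<gamma> = \<delta>"
proof (rule stream_nth_eqI)
  fix n
  note p = stake_path[OF assms(1), of "Suc n"]
  have "node (stake (Suc n) \<gamma>) (esrc (\<gamma> !! Suc n)) \<in> filt \<gamma>"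
    using node_props[OF p(1)] p(2) by (simp add: filt_def)
  then have "\<delta> \<in> cylinder (stake (Suc n) \<gamma>) (esrc (\<gamma> !! Suc n))"
    using node_props[OF p(1)] assms(2) by (auto simp: filt_def)
  then show "\<gamma> !! n = \<delta> !! n"
    using cylinder_nth[of \<delta> "stake (Suc n) \<gamma>" "esrc (\<gamma> !! Suc n)" n] by (simp add: stake_nth del: stake.simps)
qed

text \<open>The cylinders of the elements of a filter meet pairwise, hence their paths are initial segments
  of each other.\<close>

lemma filter_subset_filt:
  assumes \<xi>: "is_filter \<xi>"
  shows "\<exists>\<gamma>\<in>X_A. \<xi> \<subseteq> filt \<gamma>"
proof -
  define S where "S = {(I, i). path_to I i \<and> (\<exists>e\<in>\<xi>. cyl e = cylinder I i)}"
  have \<xi>E: "\<xi> \<subseteq> E" "ZeroE \<notin> \<xi>" "\<xi> \<noteq> {}"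
    using \<xi> by (auto simp: is_filter_def)
  have in_S: "\<exists>(I, i)\<in>S. cyl e = cylinder I i" if e: "e \<in> \<xi>" for e
  proof -
    have "e \<in> E" "e \<noteq> ZeroE"
      using e \<xi>E by auto
    then obtain I i where "path_to I i" "cyl e = cylinder I i"
      by (rule cyl_path)
    then show ?thesis
      using e by (auto simp: S_def)
  qed
  have path: "path_to I i" if "(I, i) \<in> S" for I i
    using that by (simp add: S_def)
  have inter: "\<exists>\<gamma>. \<gamma> \<in> cylinder I i \<and> \<gamma> \<in> cylinder J j" if I: "(I, i) \<in> S" and J: "(J, j) \<in> S" for I i J j
  proof -
    obtain e e' where e: "e \<in> \<xi>" "cyl e = cylinder I i" "e' \<in> \<xi>" "cyl e' = cylinder J j"
      using I J by (auto simp: S_def)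
    then have "meet e e' \<in> \<xi>"
      using \<xi> by (auto simp: is_filter_def)
    then have "meet e e' \<in> E" "meet e e' \<noteq> ZeroE"
      using \<xi>E by auto
    then have "cyl (meet e e') \<noteq> {}"
      by (rule cyl_nonempty)
    moreover have "e \<in> E" "e' \<in> E"
      using e \<xi>E(1) by auto
    ultimately have "cylinder I i \<inter> cylinder J j \<noteq> {}"
      using meet_props[of e e'] e by simp
    then show ?thesis
      by blast
  qed
  have ext: "\<exists>K. J = I @ K \<and> psrc K j = i" if "(I, i) \<in> S" "(J, j) \<in> S" "length I \<le> length J" for I i J j
    using inter[OF that(1,2)] cylinder_meet[OF path[OF that(1)] path[OF that(2)] _ _ that(3)] by metis
  have "\<exists>\<gamma>\<in>X_A. \<forall>(I, i)\<in>S. \<gamma> \<in> cylinder I i"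
  \<comment> \<open>If the lengths are bounded, a longest path prolongs all the others, and any
    infinite prolongation of it will do. If not, the paths themselves determine an infinite
    one.\<close>
  proof (cases "\<exists>M. \<forall>p\<in>S. length (fst p) < M")
    case True
    then obtain M where M: "\<forall>p\<in>S. length (fst p) < M"
      by blast
    obtain e where "e \<in> \<xi>"
      using \<xi>E by blast
    then obtain p0 where "p0 \<in> S"
      using in_S by blast
    then obtain p where p: "p \<in> S" "\<forall>q. q \<in> S \<longrightarrow> length (fst q) \<le> length (fst p)"
      using ex_has_greatest_nat[of "\<lambda>p. p \<in> S" p0 "\<lambda>p. length (fst p)" M] M by blast
    obtain J j where J: "p = (J, j)"
      by fastforce
    obtain \<gamma> where \<gamma>: "\<gamma> \<in> cylinder J j"
      using cylinder_nonempty[OF path] p J by blast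
    have "\<gamma> \<in> cylinder I i" if I: "(I, i) \<in> S" for I i
    proof -
      obtain K where "J = I @ K" "psrc K j = i"
        using ext[OF I, of J j] p J I by fastforce
      then show ?thesis
        using cylinder_append[of I K j] path[of J j] p J \<gamma> by auto
    qed
    then show ?thesis
      using \<gamma> cylinder_X_A[OF path, of J j] p J by blast
  next
    case False
    then have "\<forall>n. \<exists>p\<in>S. n < length (fst p)"
      by (metis not_less_eq)
    then obtain c where c: "\<And>n. c n \<in> S" "\<And>n. n < length (fst (c n))"
      by metis
    \<comment> \<open>The n-th edge is read off from some path of length greater than n; which one
      is immaterial, since the cylinders meet pairwise.\<close>
    define \<gamma> where "\<gamma> = smap (\<lambda>n. fst (c n) ! n) nats"
    have nth: "\<gamma> !! n = I ! n" if I: "(I, i) \<in> S" "n < length I" for n I i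
    proof -
      obtain \<delta> where "\<delta> \<in> cylinder I i" "\<delta> \<in> cylinder (fst (c n)) (snd (c n))"
        using inter[OF I(1), of "fst (c n)" "snd (c n)"] c(1)[of n] by auto
      then show ?thesis
        using cylinder_nth[of \<delta> I i n] cylinder_nth[of \<delta> "fst (c n)" "snd (c n)" n] I(2) c(2)[of n]
        by (simp add: \<gamma>_def)
    qed
    have "\<gamma> !! n \<in> edges \<and> etgt (\<gamma> !! n) = esrc (\<gamma> !! Suc n)" for n
    proof -
      obtain I i where I: "c (Suc n) = (I, i)"
        by fastforce
      then have Ip: "path_to I i" "Suc n < length I" "\<gamma> !! n = I ! n" "\<gamma> !! Suc n = I ! Suc n"
        using c[of "Suc n"] path nth[of I i n] nth[of I i "Suc n"] by auto
      then show ?thesis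
        by (auto simp: path_to_def successively_conv_nth)
    qed
    then have \<gamma>: "\<gamma> \<in> X_A"
      by (simp only: X_A_def mem_Collect_eq) blast
    have "\<gamma> \<in> cylinder J j" if J: "(J, j) \<in> S" for J j
    proof -
      obtain I i where I: "c (length J) = (I, i)"
        by fastforce
      then have IS: "(I, i) \<in> S" "length J < length I"
        using c[of "length J"] by auto
      obtain K where K: "I = J @ K" "psrc K i = j"
        using ext[OF J IS(1)] IS(2) by auto
      have "stake (length J) \<gamma> = J"
        by (rule nth_equalityI) (simp_all add: stake_nth nth[OF J])
      moreover have "esrc (\<gamma> !! length J) = j"
        using nth[OF IS] K IS(2) by (cases K) auto
      ultimately show ?thesis
        using stake_path(2)[OF \<gamma>, of "length J"] by simp
    qed
    then show ?thesis
      using \<gamma> by blast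
  qed
  then obtain \<gamma> where \<gamma>: "\<gamma> \<in> X_A" "\<And>I i. (I, i) \<in> S \<Longrightarrow> \<gamma> \<in> cylinder I i"
    by blast
  have "e \<in> filt \<gamma>" if "e \<in> \<xi>" for e
    using in_S[OF that] \<gamma>(2) that \<xi>E by (auto simp: filt_def)
  then show ?thesis
    using \<gamma>(1) by blast
qed

lemma ultrafilter_iff: "is_ultrafilter \<xi> \<longleftrightarrow> \<xi> \<in> filt ` X_A"
proof
  assume \<xi>: "is_ultrafilter \<xi>"
  then have "is_filter \<xi>"
    by (simp add: is_ultrafilter_def)
  then obtain \<gamma> where "\<gamma> \<in> X_A" "\<xi> \<subseteq> filt \<gamma>"
    using filter_subset_filt by blast
  then show "\<xi> \<in> filt ` X_A"
    using \<xi> filt_filter by (auto simp: is_ultrafilter_def)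
next
  assume "\<xi> \<in> filt ` X_A"
  then obtain \<gamma> where \<gamma>: "\<gamma> \<in> X_A" "\<xi> = filt \<gamma>"
    by blast
  have "\<eta> = \<xi>" if \<eta>: "is_filter \<eta>" "\<xi> \<subseteq> \<eta>" for \<eta>
  proof -
    obtain \<delta> where "\<delta> \<in> X_A" "\<eta> \<subseteq> filt \<delta>"
      using filter_subset_filt[OF \<eta>(1)] by blast
    then show ?thesis
      using filt_subset_eq[of \<gamma> \<delta>] \<gamma> \<eta>(2) by blast
  qed
  then show "is_ultrafilter \<xi>"
    using \<gamma> filt_filter by (simp add: is_ultrafilter_def)
qed

section \<open>Characters of infinite paths and their closure\<close>

definition chi :: "edge stream \<Rightarrow> semilat \<Rightarrow> nat" where
  "chi \<gamma> = char_of (filt \<gamma>)"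

lemma chi_eq: "e \<in> E \<Longrightarrow> chi \<gamma> e = of_bool (\<gamma> \<in> cyl e)"
  by (simp add: chi_def char_of_def filt_def indicator_def)

lemma chi_eq_1: "e \<in> E \<Longrightarrow> chi \<gamma> e = 1 \<longleftrightarrow> \<gamma> \<in> cyl e"
  by (simp only: chi_eq of_bool_eq_1_iff)

lemma topspace_cube: "topspace cube_top = PiE E (\<lambda>_. {0, 1})"
  by (simp add: cube_top_def)

lemma chi_cube: "chi \<gamma> \<in> topspace cube_top"
  by (auto simp: topspace_cube PiE_def chi_eq) (simp add: chi_def char_of_def)

lemma continuous_eval: "e \<in> E \<Longrightarrow> continuous_map cube_top (discrete_topology {0, 1}) (\<lambda>\<phi>. \<phi> e)"
  unfolding cube_top_def by (rule continuous_map_product_projection)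

lemma openin_eval:
  assumes "e \<in> E"
  shows "openin cube_top {\<phi> \<in> topspace cube_top. \<phi> e = b}"
proof -
  have "openin cube_top {\<phi> \<in> topspace cube_top. \<phi> e \<in> {b} \<inter> {0, 1}}"
    by (rule openin_continuous_map_preimage[OF continuous_eval[OF assms]]) simp
  moreover have "{\<phi> \<in> topspace cube_top. \<phi> e \<in> {b} \<inter> {0, 1}} = {\<phi> \<in> topspace cube_top. \<phi> e = b}"
    using assms by (auto simp: topspace_cube PiE_def Pi_def)
  ultimately show ?thesis
    by simp
qed

lemma openin_finite_eval:
  assumes "finite F" "F \<subseteq> E"
  shows "openin cube_top {\<phi> \<in> topspace cube_top. \<forall>e\<in>F. \<phi> e = \<psi> e}"
  using assms
proof (induction F)
  case (insert e F)
  then have "openin cube_top ({\<phi> \<in> topspace cube_top. \<phi> e = \<psi> e} \<inter>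
      {\<phi> \<in> topspace cube_top. \<forall>e\<in>F. \<phi> e = \<psi> e})"
    using openin_eval by (intro openin_Int) auto
  moreover have "{\<phi> \<in> topspace cube_top. \<phi> e = \<psi> e} \<inter> {\<phi> \<in> topspace cube_top. \<forall>e\<in>F. \<phi> e = \<psi> e}
      = {\<phi> \<in> topspace cube_top. \<forall>e\<in>insert e F. \<phi> e = \<psi> e}"
    by auto
  ultimately show ?case
    by simp
qed simp

text \<open>Fixing finitely many coordinates is an open condition in the cube, so a point of the
  closure agrees there with some \<open>chi \<gamma>\<close>.\<close>

lemma tight_approx:
  assumes "\<phi> \<in> E_tight" "finite F" "F \<subseteq> E"
  shows "\<exists>\<gamma>\<in>X_A. \<forall>e\<in>F. \<phi> e = chi \<gamma> e"
proof -
  have "char_of ` {\<xi>. is_ultrafilter \<xi>} = chi ` X_A"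
    by (auto simp: ultrafilter_iff chi_def)
  then have \<phi>: "\<phi> \<in> cube_top closure_of (chi ` X_A)"
    using assms(1) by (simp add: E_tight_def)
  define T where "T = {\<psi> \<in> topspace cube_top. \<forall>e\<in>F. \<psi> e = \<phi> e}"
  have "\<phi> \<in> T" "openin cube_top T"
    using \<phi> openin_finite_eval[OF assms(2,3), of \<phi>] by (simp_all add: in_closure_of T_def)
  moreover have "\<forall>T. \<phi> \<in> T \<and> openin cube_top T \<longrightarrow> (\<exists>y. y \<in> chi ` X_A \<and> y \<in> T)"
    using \<phi> unfolding in_closure_of by (rule conjunct2)
  ultimately have "\<exists>y. y \<in> chi ` X_A \<and> y \<in> T"
    by blast
  then obtain \<gamma> where "\<gamma> \<in> X_A" "chi \<gamma> \<in> T"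
    by blast
  then show ?thesis
    by (intro bexI[of _ \<gamma>]) (simp_all add: T_def)
qed

text \<open>Every closure condition of a filter involves at most three coordinates and can be
  checked on an approximating \<open>chi \<gamma>\<close>. Nonemptiness is the exclusion of the zero
  function.\<close>

lemma tight_filter:
  assumes \<phi>: "\<phi> \<in> E_tight"
  shows "is_filter (filter_of \<phi>)"
proof -
  note approx = tight_approx[OF \<phi>]
  have "filter_of \<phi> \<noteq> {}"
  proof
    assume empty: "filter_of \<phi> = {}"
    have ext: "\<phi> \<in> extensional E"
      using \<phi> closure_of_subset_topspace[of cube_top] by (auto simp: E_tight_def topspace_cube PiE_def)
    have "\<phi> e = 0" if "e \<in> E" for e
    proof -
      have "\<phi> e \<noteq> 1"
        using empty that by (auto simp: filter_of_def)
      moreover have "\<phi> e \<in> {0, 1}"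
        using approx[of "{e}"] that by (auto simp: chi_eq)
      ultimately show ?thesis
        by simp
    qed
    then have "\<phi> = restrict (\<lambda>_. 0) E"
      using ext by (auto simp: fun_eq_iff extensional_def restrict_def)
    then show False
      using \<phi> by (simp add: E_tight_def)
  qed
  moreover have "ZeroE \<notin> filter_of \<phi>"
    using approx[of "{ZeroE}"] by (auto simp: filter_of_def chi_eq)
  moreover have "e' \<in> filter_of \<phi>" if "e \<in> filter_of \<phi>" "e' \<in> E" "below e e'" for e e'
  proof -
    have e: "e \<in> E" "\<phi> e = 1" "e' \<in> E"
      using that by (auto simp: filter_of_def)
    have "\<exists>\<gamma>\<in>X_A. \<forall>e\<in>{e, e'}. \<phi> e = chi \<gamma> e"
      by (rule approx) (use e in auto)
    then obtain \<gamma> where \<gamma>: "\<phi> e = chi \<gamma> e" "\<phi> e' = chi \<gamma> e'"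
      by blast
    have "meet e e' = e"
      using that(3) by (simp add: below_def)
    then have "cyl e \<subseteq> cyl e'"
      using meet_props[OF e(1,3)] by auto
    moreover have "\<gamma> \<in> cyl e"
      using chi_eq_1[OF e(1)] \<gamma>(1) e(2) by metis
    ultimately have "\<phi> e' = 1"
      using chi_eq_1[OF e(3)] \<gamma>(2) by (metis subsetD)
    then show ?thesis
      using e(3) by (simp add: filter_of_def)
  qed
  moreover have "meet e e' \<in> filter_of \<phi>" if "e \<in> filter_of \<phi>" "e' \<in> filter_of \<phi>" for e e'
  proof -
    have e: "e \<in> E" "\<phi> e = 1" "e' \<in> E" "\<phi> e' = 1"
      using that by (auto simp: filter_of_def)
    note m = meet_props[OF e(1,3)]
    have "\<exists>\<gamma>\<in>X_A. \<forall>e\<in>{e, e', meet e e'}. \<phi> e = chi \<gamma> e"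
      by (rule approx) (use e m in auto)
    then obtain \<gamma> where \<gamma>: "\<phi> e = chi \<gamma> e" "\<phi> e' = chi \<gamma> e'" "\<phi> (meet e e') = chi \<gamma> (meet e e')"
      by blast
    have "\<gamma> \<in> cyl e" "\<gamma> \<in> cyl e'"
      using \<gamma>(1,2) e(2,4) chi_eq_1[OF e(1)] chi_eq_1[OF e(3)] by metis+
    then have "\<phi> (meet e e') = 1"
      using \<gamma>(3) m chi_eq_1 by (metis IntI)
    then show ?thesis
      using m by (simp add: filter_of_def)
  qed
  moreover have "filter_of \<phi> \<subseteq> E"
    by (auto simp: filter_of_def)
  ultimately show ?thesis
    unfolding is_filter_def by blast
qed

lemma node_next:
  assumes "\<gamma> \<in> X_A" "e \<in> edges_at (esrc (\<gamma> !! n))"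
  shows "node (stake n \<gamma> @ [e]) (etgt e) \<in> E"
    "cyl (node (stake n \<gamma> @ [e]) (etgt e)) = cylinder (stake n \<gamma> @ [e]) (etgt e)"
proof -
  have "path_to (stake n \<gamma> @ [e]) (etgt e)"
    using stake_path(1)[OF assms(1), of n] assms(2) by (auto simp: path_to_append path_to_Cons edges_at_def edgesD)
  then show "node (stake n \<gamma> @ [e]) (etgt e) \<in> E"
    "cyl (node (stake n \<gamma> @ [e]) (etgt e)) = cylinder (stake n \<gamma> @ [e]) (etgt e)"
    using node_props by auto
qed

text \<open>By row finiteness, that a character is one on some edge prolonging a path on which it is one
  depends on finitely many coordinates, so it survives passing to the closure.\<close>

lemma tight_node:
  assumes \<phi>: "\<phi> \<in> E_tight" and \<gamma>: "\<gamma> \<in> X_A" "filter_of \<phi> \<subseteq> filt \<gamma>"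
  shows "\<phi> (node (stake n \<gamma>) (esrc (\<gamma> !! n))) = 1"
proof (induction n)
  case 0
  \<comment> \<open>For the empty path: the cylinder of any element of the filter lies in
    \<open>X_at k\<close> for the initial vertex k, so the value 1 passes from it to
    \<open>QE k\<close>.\<close>
  obtain e where e: "e \<in> filter_of \<phi>"
    using tight_filter[OF \<phi>] by (auto simp: is_filter_def)
  then have eE: "e \<in> E" "\<phi> e = 1" "\<gamma> \<in> cyl e" "e \<noteq> ZeroE"
    using \<gamma>(2) by (auto simp: filter_of_def filt_def)
  obtain I i where I: "path_to I i" "cyl e = cylinder I i"
    using cyl_path[OF eE(1,4)] .
  define k where "k = psrc I i"
  have sub: "cyl e \<subseteq> X_at k"
    using cylinder_subset[OF I(1)] I(2) by (simp add: k_def)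
  have k: "k \<in> V" "esrc (\<gamma> !! 0) = k"
    using path_toD(2)[OF I(1)] sub eE(3) by (auto simp: k_def X_at_def)
  have "\<exists>\<delta>\<in>X_A. \<forall>e\<in>{e, QE k}. \<phi> e = chi \<delta> e"
    by (rule tight_approx[OF \<phi>]) (use eE k in auto)
  then obtain \<delta> where \<delta>: "\<phi> e = chi \<delta> e" "\<phi> (QE k) = chi \<delta> (QE k)"
    by blast
  have "\<delta> \<in> cyl e"
    using chi_eq_1[OF eE(1)] \<delta>(1) eE(2) by metis
  then have "\<delta> \<in> cyl (QE k)"
    using sub by auto
  then have "\<phi> (QE k) = 1"
    using \<delta>(2) chi_eq_1[OF QE_E[OF k(1)]] by metis
  then show ?case
    using k by (simp add: node_def)
next
  case (Suc n)
  define i where "i = esrc (\<gamma> !! n)"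
  define I where "I = stake n \<gamma>"
  have I: "path_to I i"
    using stake_path[OF \<gamma>(1), of n] by (simp add: I_def i_def)
  have i: "i \<in> V"
    using I path_toD by blast
  \<comment> \<open>The coordinates of the path and of all its prolongations by one edge.\<close>
  define F where "F = insert (node I i) ((\<lambda>e. node (I @ [e]) (etgt e)) ` edges_at i)"
  have ext: "node (I @ [e]) (etgt e) \<in> E" "cyl (node (I @ [e]) (etgt e)) = cylinder (I @ [e]) (etgt e)"
    if "e \<in> edges_at i" for e
    using node_next[OF \<gamma>(1), of e n] that by (auto simp: I_def i_def)
  have "finite F" "F \<subseteq> E"
    using finite_edges_at[OF i] ext(1) node_props(1)[OF I] by (auto simp: F_def)
  then obtain \<delta> where \<delta>: "\<forall>e\<in>F. \<phi> e = chi \<delta> e"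
    using tight_approx[OF \<phi>] by blast
  have "\<delta> \<in> cylinder I i"
  proof -
    have "\<phi> (node I i) = chi \<delta> (node I i)"
      using \<delta> by (simp add: F_def)
    then show ?thesis
      using Suc.IH chi_eq_1 node_props[OF I] unfolding I_def i_def by metis
  qed
  then obtain \<delta>' where \<delta>': "\<delta> = I @- \<delta>'" "\<delta>' \<in> X_at i"
    by (auto simp: cylinder_eq)
  from \<delta>'(2) obtain e \<delta>'' where e: "\<delta>' = e ## \<delta>''" "e \<in> edges" "esrc e = i" "\<delta>'' \<in> X_at (etgt e)"
    by (rule X_at_cases)
  have ei: "e \<in> edges_at i"
    using e by (simp add: edges_at_def)
  have "\<delta> = (I @ [e]) @- \<delta>''"
    using \<delta>' e by simp
  then have "\<delta> \<in> cylinder (I @ [e]) (etgt e)"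
    using e(4) unfolding cylinder_eq by blast
  then have 1: "\<phi> (node (I @ [e]) (etgt e)) = 1"
    using \<delta> chi_eq_1[OF ext(1)[OF ei]] ext(2)[OF ei] ei by (auto simp: F_def)
  \<comment> \<open>The edge found along \<delta> is the next edge of \<gamma>, because
    \<open>filter_of \<phi>\<close> is contained in \<open>filt \<gamma>\<close>.\<close>
  then have "node (I @ [e]) (etgt e) \<in> filt \<gamma>"
    using \<gamma>(2) ext(1)[OF ei] by (auto simp: filter_of_def)
  then have \<gamma>c: "\<gamma> \<in> cylinder (I @ [e]) (etgt e)"
    using ext(2)[OF ei] by (simp add: filt_def)
  have p: "path_to (I @ [e]) (etgt e)"
    using I e by (auto simp: path_to_append path_to_Cons edgesD)
  have "length I = n"
    by (simp add: I_def)
  then have "stake (Suc n) \<gamma> = I @ [e]" "esrc (\<gamma> !! Suc n) = etgt e"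
    using cylinder_stake[OF p \<gamma>c] by simp_all
  then show ?case
    using 1 by (simp del: stake.simps snth.simps)
qed

lemma E_tight_eq: "E_tight = chi ` X_A"
proof
  show "chi ` X_A \<subseteq> E_tight"
  proof
    fix \<phi>
    assume "\<phi> \<in> chi ` X_A"
    then obtain \<gamma> where \<gamma>: "\<gamma> \<in> X_A" "\<phi> = chi \<gamma>"
      by blast
    have "chi ` X_A \<subseteq> topspace cube_top"
      using chi_cube by blast
    then have "chi ` X_A \<subseteq> cube_top closure_of (chi ` X_A)"
      by (rule closure_of_subset)
    moreover have "char_of ` {\<xi>. is_ultrafilter \<xi>} = chi ` X_A"
      by (auto simp: ultrafilter_iff chi_def)
    moreover have "chi \<gamma> \<noteq> restrict (\<lambda>_. 0) E"
    proof
      assume eq: "chi \<gamma> = restrict (\<lambda>_. 0) E"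
      obtain e where "e \<in> filt \<gamma>"
        using filt_filter[OF \<gamma>(1)] by (auto simp: is_filter_def)
      then have "e \<in> E" "chi \<gamma> e = 1"
        by (auto simp: filt_def chi_eq)
      then show False
        using eq by simp
    qed
    ultimately show "\<phi> \<in> E_tight"
      using \<gamma> by (auto simp: E_tight_def)
  qed
  show "E_tight \<subseteq> chi ` X_A"
  proof
    fix \<phi>
    assume \<phi>: "\<phi> \<in> E_tight"
    obtain \<gamma> where \<gamma>: "\<gamma> \<in> X_A" "filter_of \<phi> \<subseteq> filt \<gamma>"
      using filter_subset_filt[OF tight_filter[OF \<phi>]] by blast
    have "\<phi> \<in> topspace cube_top"
      using \<phi> closure_of_subset_topspace[of cube_top] by (auto simp: E_tight_def)
    then have ext: "\<phi> \<in> extensional E" and val: "\<And>e. e \<in> E \<Longrightarrow> \<phi> e \<in> {0, 1}"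
      by (auto simp: topspace_cube PiE_def Pi_def)
    have "\<phi> e = chi \<gamma> e" if e: "e \<in> E" for e
    proof (cases "\<gamma> \<in> cyl e")
      case True
      then obtain I i where I: "path_to I i" "cyl e = cylinder I i"
        using cyl_path[OF e] by (cases "e = ZeroE") auto
      have Ii: "I = stake (length I) \<gamma>" "i = esrc (\<gamma> !! length I)"
        using cylinder_stake[OF I(1)] True I(2) by auto
      have "\<phi> (node I i) = 1"
        using tight_node[OF \<phi> \<gamma>, of "length I"] Ii by simp
      \<comment> \<open>e and the node have the same cylinder, so no \<open>chi \<delta>\<close>
        separates them, and then \<phi> does not either.\<close>
      moreover have "\<exists>\<delta>\<in>X_A. \<forall>e\<in>{e, node I i}. \<phi> e = chi \<delta> e"
        by (rule tight_approx[OF \<phi>]) (use e node_props(1)[OF I(1)] in auto)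
      then obtain \<delta> where "\<phi> e = chi \<delta> e" "\<phi> (node I i) = chi \<delta> (node I i)"
        by blast
      ultimately have "\<phi> e = 1"
        using chi_eq_1 e node_props[OF I(1)] I(2) by metis
      then show ?thesis
        using True e by (simp add: chi_eq)
    next
      case False
      then have "\<phi> e \<noteq> 1"
        using \<gamma>(2) e by (auto simp: filter_of_def filt_def)
      then show ?thesis
        using False val[OF e] e by (simp add: chi_eq)
    qed
    then have "\<phi> = chi \<gamma>"
      using ext by (auto simp: fun_eq_iff extensional_def chi_def char_of_def)
    then show "\<phi> \<in> chi ` X_A"
      using \<gamma> by blast
  qed
qed

lemma filter_of_chi: "filter_of (chi \<gamma>) = filt \<gamma>"
  by (auto simp: filter_of_def chi_eq filt_def of_bool_def split: if_splits)

text \<open>The elements tested by \<open>stem_limit\<close> are nodes, and \<gamma> lies in the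
  cylinder of a node exactly if it prolongs the path of that node.\<close>

lemma Phi_chi:
  assumes "\<gamma> \<in> X_A"
  shows "Phi (chi \<gamma>) = \<gamma>"
proof -
  have PE: "PE (cls (map edge_letter (stake k \<delta>))) = node (stake k \<delta>) (esrc (\<delta> !! k))"
    if "k \<ge> 1" for k \<delta>
    using that by (cases k) (auto simp: node_def)
  have in_stem: "cls (map edge_letter (stake k \<delta>)) \<in> stem (filt \<gamma>) \<longleftrightarrow> \<gamma> \<in> cylinder (stake k \<delta>) (esrc (\<delta> !! k))"
    if "\<delta> \<in> X_A" "k \<ge> 1" for \<delta> k
  proof -
    note p = stake_path(1)[OF that(1), of k]
    have "PE (cls (map edge_letter (stake k \<delta>))) \<in> E"
      using node_props(1)[OF p] PE[OF that(2)] by simp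
    then have "cls (map edge_letter (stake k \<delta>)) \<in> Lambda"
      by (auto simp: E_def)
    then show ?thesis
      using node_props[OF p] PE[OF that(2), of \<delta>] by (simp add: stem_def filt_def)
  qed
  show ?thesis
    unfolding Phi_def filter_of_chi stem_limit_def edge_letter_eq[symmetric]
  proof (rule the_equality)
    show "\<gamma> \<in> X_A \<and> (\<forall>k\<ge>1. cls (map edge_letter (stake k \<gamma>)) \<in> stem (filt \<gamma>))"
      using assms in_stem[OF assms] stake_path(2)[OF assms] by blast
  next
    fix \<delta>
    assume \<delta>: "\<delta> \<in> X_A \<and> (\<forall>k\<ge>1. cls (map edge_letter (stake k \<delta>)) \<in> stem (filt \<gamma>))"
    show "\<delta> = \<gamma>"
    proof (rule stream_nth_eqI)
      fix n
      have "\<gamma> \<in> cylinder (stake (Suc n) \<delta>) (esrc (\<delta> !! Suc n))"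
        using \<delta> in_stem[of \<delta> "Suc n"] by (simp del: stake.simps snth.simps)
      then show "\<delta> !! n = \<gamma> !! n"
        using cylinder_nth[of \<gamma> "stake (Suc n) \<delta>" "esrc (\<delta> !! Suc n)" n]
        by (simp add: stake_nth del: stake.simps)
    qed
  qed
qed


subsection \<open>The homeomorphism\<close>

lemma topspace_X_top: "topspace X_top = X_A"
proof -
  have "X_A \<subseteq> \<Union> {cylinder I i | I i. path_to I i}"
  proof
    fix \<gamma>
    assume "\<gamma> \<in> X_A"
    then show "\<gamma> \<in> \<Union> {cylinder I i | I i. path_to I i}"
      using stake_path[of \<gamma> 0] by blast
  qed
  then show ?thesis
    using cylinder_X_A unfolding X_top_def topology_generated_by_topspace by blast
qed

lemma openin_cylinder: "path_to I i \<Longrightarrow> openin X_top (cylinder I i)"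
  unfolding X_top_def by (rule topology_generated_by_Basis) blast

text \<open>Two cylinders of paths of the same length coincide or are disjoint, so the cylinder of
  the initial segment of length n is a neighbourhood avoiding the given one.\<close>

lemma openin_cylinder_compl:
  assumes "path_to I i"
  shows "openin X_top (X_A - cylinder I i)"
proof (subst openin_subopen, intro ballI)
  fix \<gamma>
  assume \<gamma>: "\<gamma> \<in> X_A - cylinder I i"
  define n where "n = length I"
  note p = stake_path[of \<gamma> n]
  have "\<delta> \<notin> cylinder I i" if "\<delta> \<in> cylinder (stake n \<gamma>) (esrc (\<gamma> !! n))" for \<delta>
  proof
    assume "\<delta> \<in> cylinder I i"
    then have "I = stake n \<delta>" "i = esrc (\<delta> !! n)"
      using cylinder_stake[OF assms] by (auto simp: n_def)
    moreover have "stake n \<gamma> = stake n \<delta>" "esrc (\<gamma> !! n) = esrc (\<delta> !! n)"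
      using cylinder_stake[OF p(1) that] \<gamma> by auto
    ultimately have "cylinder (stake n \<gamma>) (esrc (\<gamma> !! n)) = cylinder I i"
      by simp
    then show False
      using p(2) \<gamma> by blast
  qed
  then show "\<exists>T. openin X_top T \<and> \<gamma> \<in> T \<and> T \<subseteq> X_A - cylinder I i"
    using openin_cylinder[OF p(1)] p \<gamma> cylinder_X_A[OF p(1)]
    by (intro exI[of _ "cylinder (stake n \<gamma>) (esrc (\<gamma> !! n))"]) auto
qed

lemma openin_cyl:
  assumes "e \<in> E"
  shows "openin X_top (cyl e)" "openin X_top (X_A - cyl e)"
proof -
  have "openin X_top (cyl e) \<and> openin X_top (X_A - cyl e)"
  proof (cases "e = ZeroE")
    case True
    then show ?thesis
      using openin_topspace[of X_top] by (simp add: topspace_X_top)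
  next
    case False
    then show ?thesis
      using cyl_path[OF assms False] openin_cylinder openin_cylinder_compl by metis
  qed
  then show "openin X_top (cyl e)" "openin X_top (X_A - cyl e)"
    by auto
qed

lemma continuous_chi: "continuous_map X_top cube_top chi"
  unfolding cube_top_def continuous_map_componentwise
proof (intro conjI ballI)
  show "chi ` topspace X_top \<subseteq> extensional E"
    by (auto simp: chi_def char_of_def)
  fix e
  assume e: "e \<in> E"
  have "openin X_top {\<gamma> \<in> topspace X_top. chi \<gamma> e \<in> U}" for U
  proof -
    have "{\<gamma> \<in> topspace X_top. chi \<gamma> e \<in> U}
      = (if 1 \<in> U then cyl e else {}) \<union> (if 0 \<in> U then X_A - cyl e else {})"
      using e cyl_X_A[OF e] by (auto simp: chi_eq topspace_X_top)
    then show ?thesis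
      by (simp only:) (intro openin_Un; simp add: openin_cyl[OF e])
  qed
  then show "continuous_map X_top (discrete_topology {0, 1}) (\<lambda>\<gamma>. chi \<gamma> e)"
    using e by (auto simp: continuous_map_def chi_eq)
qed

lemma topspace_tight: "topspace tight_top = chi ` X_A"
  using chi_cube by (auto simp: tight_top_def E_tight_eq)

lemma Phi_homeomorphic: "homeomorphic_map tight_top X_top Phi"
proof (rule homeomorphic_maps_imp_map)
  show "homeomorphic_maps tight_top X_top Phi chi"
    unfolding homeomorphic_maps_def
  proof (intro conjI ballI)
    show "continuous_map X_top tight_top chi"
      using continuous_chi by (auto simp: tight_top_def continuous_map_in_subtopology E_tight_eq topspace_X_top)
    show "continuous_map tight_top X_top Phi"
      unfolding X_top_def
    proof (rule continuous_on_generated_topo)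
      fix U
      assume "U \<in> {cylinder I i | I i. path_to I i}"
      then obtain I i where U: "U = cylinder I i" and I: "path_to I i"
        by blast
      \<comment> \<open>The preimage of a cylinder is cut out by a single coordinate, that of its
        node.\<close>
      have "Phi -` U \<inter> topspace tight_top = {\<phi> \<in> topspace cube_top. \<phi> (node I i) = 1} \<inter> E_tight"
        using node_props[OF I] chi_cube
        by (auto simp: topspace_tight Phi_chi U E_tight_eq chi_eq split: if_splits)
      then show "openin tight_top (Phi -` U \<inter> topspace tight_top)"
        using openin_eval[OF node_props(1)[OF I], of 1] by (auto simp: tight_top_def openin_subtopology)
    next
      show "Phi ` topspace tight_top \<subseteq> \<Union> {cylinder I i | I i. path_to I i}"
        using topspace_X_top by (auto simp: topspace_tight Phi_chi X_top_def topology_generated_by_topspace)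
    qed
    fix \<phi>
    assume "\<phi> \<in> topspace tight_top"
    then show "chi (Phi \<phi>) = \<phi>"
      by (auto simp: topspace_tight Phi_chi)
  next
    fix \<gamma>
    assume "\<gamma> \<in> topspace X_top"
    then show "Phi (chi \<gamma>) = \<gamma>"
      by (simp add: topspace_X_top Phi_chi)
  qed
qed


subsection \<open>The action\<close>

text \<open>All preimages of x under \<open>img\<close> have the same cylinder, the domain of
  \<open>pact x\<close>. This makes the description in \<open>ev\<close> unique, and
  \<open>projs_img\<close> provides a preimage.\<close>

lemma ev_chi:
  assumes "x \<in> projs"
  shows "ev (chi \<gamma>) x = of_bool (pact x \<gamma> \<noteq> None)"
proof -
  obtain e where e: "e \<in> E" "img e = x"
    using projs_img[OF assms] by blast
  have "chi \<gamma> e' = of_bool (pact x \<gamma> \<noteq> None)" if "e' \<in> E" "img e' = x" for e'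
    using img_props(2)[OF that(1), of \<gamma>] that by (simp add: chi_eq)
  then show ?thesis
    unfolding ev_def using e by (intro the_equality) auto
qed

lemma pact_source:
  assumes "s \<in> S_AB"
  shows "pact (adjO s \<cdot> s) \<gamma> \<noteq> None \<longleftrightarrow> pact s \<gamma> \<noteq> None"
proof -
  note s = S_AB_monomials[OF assms]
  have "pact (adjO s \<cdot> s) \<gamma> = Option.bind (pact s \<gamma>) (pact (adjO s))"
    by (rule pact_mul(2)[OF pact_adj(1)[OF s] s])
  then show ?thesis
    using pact_adj(2)[OF s] by (cases "pact s \<gamma>") auto
qed

lemma projs_monomials: "a \<in> projs \<Longrightarrow> a \<in> monomials"
  by (auto simp: projs_def intro!: pact_mul pact_adj pact_sprodO)

lemma pact_conj:
  assumes s: "s \<in> S_AB" and e: "e \<in> E"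
  shows "pact (adjO s \<cdot> img e \<cdot> s) \<gamma> \<noteq> None \<longleftrightarrow> (\<exists>\<delta>. pact s \<gamma> = Some \<delta> \<and> \<delta> \<in> cyl e)"
proof -
  note sm = S_AB_monomials[OF s] and em = projs_monomials[OF img_props(1)[OF e]]
  note am = pact_adj(1)[OF sm]
  have "pact (adjO s \<cdot> img e \<cdot> s) \<gamma>
    = Option.bind (pact s \<gamma>) (\<lambda>\<delta>. Option.bind (pact (img e) \<delta>) (pact (adjO s)))"
    using pact_mul(2)[OF am em] pact_mul(2)[OF pact_mul(1)[OF am em] sm, of \<gamma>]
    by (cases "pact s \<gamma>") auto
  then show ?thesis
    using pact_adj(2)[OF sm] img_props(2)[OF e] by (cases "pact s \<gamma>") auto
qed

lemma Theta_dom_eq: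
  assumes "s \<in> S_AB"
  shows "Theta_dom s = chi ` {\<gamma>. pact s \<gamma> \<noteq> None}"
proof -
  have "{\<gamma>. pact s \<gamma> \<noteq> None} \<subseteq> X_A"
    using cylinder_X_A unfolding X_dom_eq[OF assms, symmetric] X_dom_def by (auto simp: std_form_iff)
  then show ?thesis
    using ev_chi[OF projs_source[OF assms]] pact_source[OF assms]
    by (auto simp: Theta_dom_def E_tight_eq of_bool_def split: if_splits)
qed

text \<open>The conjugate of \<open>img e\<close> by s is the identity on those paths that s moves
  into the cylinder of e, so evaluating it at \<gamma> is evaluating e at \<delta>.\<close>

lemma Theta_chi:
  assumes s: "s \<in> S_AB" and \<delta>: "pact s \<gamma> = Some \<delta>"
  shows "Theta s (chi \<gamma>) = chi \<delta>"
proof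
  fix e
  show "Theta s (chi \<gamma>) e = chi \<delta> e"
  proof (cases "e \<in> E")
    case True
    have "ev (chi \<gamma>) (adjO s \<cdot> img e \<cdot> s) = of_bool (\<delta> \<in> cyl e)"
      using ev_chi[OF projs_conj[OF s img_props(1)[OF True]], of \<gamma>] pact_conj[OF s True, of \<gamma>] \<delta> by simp
    then show ?thesis
      using True by (simp add: Theta_def chi_eq)
  next
    case False
    then show ?thesis
      by (simp add: Theta_def chi_def char_of_def)
  qed
qed

lemma pact_X_A:
  assumes "s \<in> S_AB" "pact s \<gamma> = Some \<delta>"
  shows "\<gamma> \<in> X_A" "\<delta> \<in> X_A"
proof -
  have dom: "\<gamma> \<in> X_A" if "s \<in> S_AB" "pact s \<gamma> = Some \<delta>" for s \<gamma> \<delta>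
  proof -
    have "\<gamma> \<in> X_dom s"
      using that by (simp add: X_dom_eq)
    then show ?thesis
      using cylinder_X_A by (auto simp: X_dom_def std_form_iff)
  qed
  show "\<gamma> \<in> X_A"
    using dom assms .
  \<comment> \<open>The image point lies in the domain of the adjoint, which again consists of
    infinite paths.\<close>
  have "pact (adjO s) \<delta> = Some \<gamma>"
    using pact_adj(2)[OF S_AB_monomials[OF assms(1)]] assms(2) by simp
  then show "\<delta> \<in> X_A"
    using dom[OF S_AB_adj[OF assms(1)]] by simp
qed

lemma Phi_Theta_dom:
  assumes "s \<in> S_AB"
  shows "Phi ` Theta_dom s = X_dom s"
proof -
  have "Phi (chi \<gamma>) = \<gamma>" if "pact s \<gamma> \<noteq> None" for \<gamma>
    using that pact_X_A[OF assms] Phi_chi by auto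
  then show ?thesis
    unfolding Theta_dom_eq[OF assms] X_dom_eq[OF assms] image_image by simp
qed

lemma Phi_Theta:
  assumes s: "s \<in> S_AB" and \<phi>: "\<phi> \<in> Theta_dom s"
  shows "Theta s \<phi> \<in> E_tight" "Phi (Theta s \<phi>) = alpha s (Phi \<phi>)"
proof -
  obtain \<gamma> \<delta> where \<gamma>: "\<phi> = chi \<gamma>" "pact s \<gamma> = Some \<delta>"
    using \<phi> unfolding Theta_dom_eq[OF s] by auto
  note X = pact_X_A[OF s \<gamma>(2)]
  show "Theta s \<phi> \<in> E_tight"
    using Theta_chi[OF s \<gamma>(2)] \<gamma>(1) X by (simp add: E_tight_eq)
  show "Phi (Theta s \<phi>) = alpha s (Phi \<phi>)"
    using Theta_chi[OF s \<gamma>(2)] alpha_eq[OF s \<gamma>(2)] \<gamma>(1) X by (simp add: Phi_chi)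
qed

end

theorem theorem5p14:
  fixes N :: enat and A :: "nat \<Rightarrow> nat \<Rightarrow> nat" and B :: "nat \<Rightarrow> nat \<Rightarrow> int"
  assumes "N \<ge> 1"
    and "\<forall>i\<in>katsura.V N. finite {j \<in> katsura.V N. A i j \<noteq> 0}"
    and "\<forall>i\<in>katsura.V N. finite {j \<in> katsura.V N. B i j \<noteq> 0}"
    and "\<forall>i\<in>katsura.V N. katsura.Omega_at N A i \<noteq> {}"
    and "\<forall>i\<in>katsura.V N. \<forall>j\<in>katsura.V N. (i, j) \<notin> katsura.Omega N A \<longrightarrow> B i j = 0"
  shows "homeomorphic_map (katsura.tight_top N A B) (katsura.X_top N A) (katsura.Phi N A B) \<and>
    (\<forall>s \<in> katsura.S_AB N A B.
       katsura.Phi N A B ` katsura.Theta_dom N A B s = katsura.X_dom N A B s \<and>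
       (\<forall>\<phi> \<in> katsura.Theta_dom N A B s.
          katsura.Theta N A B s \<phi> \<in> katsura.E_tight N A B \<and>
          katsura.Phi N A B (katsura.Theta N A B s \<phi>)
            = katsura.alpha N A B s (katsura.Phi N A B \<phi>)))"
proof -
  have "finite (katsura.Omega_at N A i)" if "i \<in> katsura.V N" for i
    using assms(2) that
    by (auto simp: katsura.Omega_at_def katsura.Omega_def Suc_le_eq elim!: finite_subset[rotated])
  then interpret katsura_std N A B
    using assms(4) by unfold_locales auto
  show ?thesis
    using Phi_homeomorphic Phi_Theta_dom Phi_Theta by blast
qed

end
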